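(* Let $N\geq2$ and $m\geq 2$ be integers and let $\Omega$ be a nonempty open bounded subset of $\mathbb R^N$ with Lipschitz boundary $\operatorname{bdry}\Omega$. Let $(\Omega_i)_{1\leq i\leq m}$ be disjoint open subsets of $\Omega$ such that the boundaries $(\operatorname{bdry}\Omega_i)_{1\leq i\leq m}$ are Lipschitz, $\overline\Omega=\bigcup_{i=1}^m\overline{\Omega_i}$, and, for every $i\in\{1,\ldots,m\}$, $$\Upsilon_{i,i}=\operatorname{int}_{\operatorname{bdry}\Omega}(\operatorname{bdry}\Omega_i\cap\operatorname{bdry}\Omega)\neq\varnothing.$$ For every $i\in\{1,\ldots,m\}$, set $$(\forall j\in\{i+1,\ldots,m\})\quad\Upsilon_{i,j}=\Upsilon_{j,i}=\operatorname{int}_{\operatorname{bdry}\Omega_i}(\operatorname{bdry}\Omega_i\cap\operatorname{bdry}\Omega_j),$$ let $J(i)=\{j\in\{1,\ldots,m\}\smallsetminus\{i\}\mid\Upsilon_{i,j}\neq\varnothing\}$, let $\mathsf T_i\colon H^1(\Omega_i)\to L^2(\operatorname{bdry}\Omega_i)$ be the trace operator, let $$\mathcal H_i=\{x\in H^1(\Omega_i)\mid\mathsf T_ix=0\text{ on }\Upsilon_{i,i}\}$$ be equipped with the scalar product $\langle x\mid y\rangle=\int_{\Omega_i}(Dx)^\top Dy$, let $f_i\in\Gamma_0(\mathcal H_i)$, and, for every $j\in J(i)$, let $\tau_{ij}\in\left]0,+\infty\right[$, let $\varphi_{ij}\colon L^2(\Upsilon_{i,j})\to\mathbb R$ be convex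 and differentiable with $\tau_{ij}$-Lipschitz continuous gradient, and set $\mathsf T_{ij}\colon\mathcal H_i\to L^2(\Upsilon_{i,j})\colon x\mapsto(\mathsf T_ix)|_{\Upsilon_{i,j}}$. Suppose that the problem $$\text{(P)}\quad\underset{x_1\in\mathcal H_1,\ldots,x_m\in\mathcal H_m}{\text{minimize}}\ \ \sum_{i=1}^mf_i(x_i)+\sum_{i=1}^m\sum_{j\in J(i)}\varphi_{ij}(\mathsf T_{ij}x_i-\mathsf T_{ji}x_j)$$ has at least one solution. Set $$\beta=\frac{1}{p\,\max_{(k,l)\in\mathbb K}\tau_{kl}\big(\|\mathsf T_{kl}\|^2+\|\mathsf T_{lk}\|^2\big)},$$ where $p$ is the cardinality of $\mathbb K=\{(k,l)\mid1\leq k\leq m,\ l\in J(k)\}$. Fix $\varepsilon\in\left]0,\min\{1,\beta\}\right[$, a sequence $(\gamma_n)_{n\in\mathbb N}$ in $[\varepsilon,2\beta-\varepsilon]$, and a sequence $(\lambda_n)_{n\in\mathbb N}$ in $[0,1-\varepsilon]$. For every $i\in\{1,\ldots,m\}$, let: (i) $x_{i,0}\in\mathcal H_i$; (ii) $(a_{i,n})_{n\in\mathbb N}$ and $(b_{i,n})_{n\in\mathbb N}$ be sequences in $\mathcal H_i$ such that $\sum_{n\in\mathbb N}\sqrt{\int_{\Omega_i}|Da_{i,n}|^2}<+\infty$ and $\sum_{n\in\mathbb N}\sqrt{\int_{\Omega_i}|Db_{i,n}|^2}<+\infty$; (iii) $(\lambda_{i,n})_{n\in\mathbb N}$ be a sequence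 in $\left[0,1\right[$ such that $\sum_{n\in\mathbb N}|\lambda_{i,n}-\lambda_n|<+\infty$. For every $n\in\mathbb N$ and every $i\in\{1,\ldots,m\}$, let $y_{i,n}$ be the unique solution in $\mathcal H_i$ to the problem $$\underset{y\in\mathcal H_i}{\text{minimize}}\ \ \gamma_nf_i(y)+\frac12\int_{\Omega_i}|Dy-Dx_{i,n}+\gamma_nD(z_{i,n}+b_{i,n})|^2,$$ where $z_{i,n}$ is the unique weak solution in $H^1(\Omega_i)$ to the Dirichlet–Neumann boundary problem $$\begin{cases}\Delta z_{i,n}=0&\text{on }\Omega_i\\ z_{i,n}=0&\text{on }\Upsilon_{i,i}\\ \nu_i^\top Dz_{i,n}=\sum_{j\in J(i)}\widetilde{v_{ij,n}}&\text{on }\bigcup_{j\in J(i)}\Upsilon_{i,j},\end{cases}$$ where, for every $j\in J(i)$, $\widetilde{v_{ij,n}}$ equals $$v_{ij,n}=\nabla\varphi_{ij}(\mathsf T_{ij}x_{i,n}-\mathsf T_{ji}x_{j,n})-\nabla\varphi_{ji}(\mathsf T_{ji}x_{j,n}-\mathsf T_{ij}x_{i,n})$$ on $\Upsilon_{i,j}$ and equals $0$ on $\operatorname{bdry}\Omega_i\smallsetminus\Upsilon_{i,j}$, and set $$x_{i,n+1}=\lambda_{i,n}x_{i,n}+(1-\lambda_{i,n})(y_{i,n}+a_{i,n}).$$ Then, for every $i\in\{1,\ldots,m\}$, $(x_{i,n})_{n\in\mathbb N}$ converges weakly in $\mathcal H_i$ to a point $x_i\in\mathcal H_i$, and $(x_i)_{1\leq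 i\leq m}$ is a solution to (P).
   Context: $|\cdot|$ is the Euclidean norm of $\mathbb R^N$; $\operatorname{int}_{S}$ denotes the interior relative to the set $S$. For a nonempty bounded open set $\Omega\subset\mathbb R^N$ with Lipschitz boundary, $H^1(\Omega)=\{x\in L^2(\Omega)\mid Dx\in(L^2(\Omega))^N\}$, where $D$ is the weak gradient, with scalar product $\int_\Omega xy+\int_\Omega(Dx)^\top Dy$. $S$ denotes the surface measure on the boundary; for a nonempty relatively open subset $\Upsilon$ of $\operatorname{bdry}\Omega$, $L^2(\Upsilon)$ is the space of square $S$-integrable functions on $\Upsilon$, with scalar product $(v,w)\mapsto\int_\Upsilon vw\,dS$. The trace operator of $\Omega$ is the unique bounded linear operator $\mathsf T\colon H^1(\Omega)\to L^2(\operatorname{bdry}\Omega)$ such that $\mathsf Tx=x|_{\operatorname{bdry}\Omega}$ for every $x\in\mathcal C^1(\overline\Omega)$. The space $\{x\in H^1(\Omega)\mid\mathsf Tx=0\text{ on }\Upsilon\}$ with scalar product $(x,y)\mapsto\int_\Omega(Dx)^\top Dy$ is taken as a Hilbert space; weak convergence in $\mathcal H_i$ and the operator norms $\|\mathsf T_{ij}\|$ are with respect to this structure on $\mathcal H_i$. $\nu_i(\omega)$ is the unit outward normal vector at $S$-almost every $\omega\in\operatorname{bdry}\Omega_i$. $\Gamma_0(\mathcal H)$ is the class of proper lower semicontinuous convex functions $f\colon\mathcal H\to\left]-\infty,+\infty\right]$. A weak solution of the Dirichlet–Neumann problem consisting of $\Delta z_{i,n}=0$ on $\Omega_i$, $z_{i,n}=0$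 on $\Upsilon_{i,i}$, and $\nu_i^\top Dz_{i,n}=\sum_{j\in J(i)}\widetilde{v_{ij,n}}$ on $\bigcup_{j\in J(i)}\Upsilon_{i,j}$ is an element $z_{i,n}\in\mathcal H_i$ such that $\int_{\Omega_i}(Dx)^\top Dz_{i,n}=\int_{\bigcup_{j\in J(i)}\Upsilon_{i,j}}(\mathsf T_ix)\big(\sum_{j\in J(i)}\widetilde{v_{ij,n}}\big)dS$ for every $x\in\mathcal H_i$. *)

theory Defs
  imports "HOL-Analysis.Analysis"
begin

text \<open>
  Elements of the function spaces below are represented by real-valued functions on the whole
  ambient space; two functions represent the same element if they agree almost everywhere for the
  measure of the space in question. Subspaces are sets of such functions, and inner products on
  them are passed as explicit arguments.
\<close>

section \<open>Surface measure\<close>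

text \<open>
  The surface measure of a Lipschitz boundary in an N-dimensional Euclidean space is the
  Hausdorff measure of dimension \<open>N - 1\<close>, with the normalization which makes it agree with the area
  of hypersurfaces. The dimension \<open>k\<close> is meant to be positive here (\<open>k = 0\<close> does not give
  the counting measure, as the empty set is given the weight \<open>0 ^ 0 = 1\<close>).
\<close>

definition hausdorff_content :: "nat \<Rightarrow> real \<Rightarrow> 'a::metric_space set \<Rightarrow> ennreal" where
  "hausdorff_content k \<delta> A =
    (INF C \<in> {C :: nat \<Rightarrow> 'a set. A \<subseteq> (\<Union>j. C j) \<and> (\<forall>j. bounded (C j) \<and> diameter (C j) \<le> \<delta>)}.
       \<Sum>j. ennreal (unit_ball_vol (real k) * (diameter (C j) / 2) ^ k))"

definition hausdorff_outer :: "nat \<Rightarrow> 'a::metric_space set \<Rightarrow> ennreal" where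
  "hausdorff_outer k A = (SUP \<delta> \<in> {0<..}. hausdorff_content k \<delta> A)"

definition surface_measure :: "'a::euclidean_space measure" where
  "surface_measure = measure_of UNIV (sets borel) (hausdorff_outer (DIM('a) - 1))"

text \<open>
  Borel sets are measurable for the Hausdorff outer measure, by the Caratheodory criterion, so
  that \<open>measure_of\<close> does not fall back to the zero measure (\<open>emeasure_surface_measure\<close>).
\<close>

lemma hausdorff_content_le:
  assumes "A \<subseteq> (\<Union>j. C j)" "\<And>j. bounded (C j)" "\<And>j. diameter (C j) \<le> \<delta>"
  shows "hausdorff_content k \<delta> A \<le> (\<Sum>j. ennreal (unit_ball_vol (real k) * (diameter (C j) / 2) ^ k))"
  unfolding hausdorff_content_def by (rule INF_lower) (use assms in simp)

lemma hausdorff_content_mono: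
  assumes "A \<subseteq> B"
  shows "hausdorff_content k \<delta> A \<le> hausdorff_content k \<delta> B"
  unfolding hausdorff_content_def
  by (rule INF_superset_mono) (auto dest: subset_trans[OF assms])

lemma hausdorff_content_antimono:
  assumes "\<delta> \<le> \<delta>'"
  shows "hausdorff_content k \<delta>' A \<le> hausdorff_content k \<delta> A"
  unfolding hausdorff_content_def
  by (rule INF_superset_mono) (auto simp: order_trans[OF _ assms])

lemma hausdorff_content_cover:
  assumes "e > 0" "hausdorff_content k \<delta> A < top"
  shows "\<exists>C. A \<subseteq> (\<Union>j. C j) \<and> (\<forall>j. bounded (C j)) \<and> (\<forall>j. diameter (C j) \<le> \<delta>) \<and>
    (\<Sum>j. ennreal (unit_ball_vol (real k) * (diameter (C j) / 2) ^ k))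
       \<le> hausdorff_content k \<delta> A + ennreal e"
proof -
  have "hausdorff_content k \<delta> A < hausdorff_content k \<delta> A + ennreal e"
    using assms by (cases "hausdorff_content k \<delta> A")
      (auto simp: ennreal_less_iff simp flip: ennreal_plus)
  then obtain C where "C \<in> {C :: nat \<Rightarrow> 'a set. A \<subseteq> (\<Union>j. C j) \<and> (\<forall>j. bounded (C j) \<and> diameter (C j) \<le> \<delta>)}"
    "(\<Sum>j. ennreal (unit_ball_vol (real k) * (diameter (C j) / 2) ^ k))
       < hausdorff_content k \<delta> A + ennreal e"
    unfolding hausdorff_content_def[of k \<delta> A] INF_less_iff by blast
  then show ?thesis by (intro exI[of _ C]) (auto intro: less_imp_le)
qed

lemma ennreal_suminf_tail:
  fixes f :: "nat \<Rightarrow> ennreal"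
  assumes "(\<Sum>i. f i) < top"
  shows "(\<lambda>n. \<Sum>i. f (i + n)) \<longlonglongrightarrow> 0"
proof -
  define r where "r i = enn2real (f i)" for i
  have f: "f i = ennreal (r i)" for i
    using ennreal_suminf_lessD[OF assms, of i] by (simp add: r_def)
  have nn: "0 \<le> r i" for i by (simp add: r_def)
  have r: "summable r"
    using assms nn by (intro summable_suminf_not_top) (auto simp: f)
  have "(\<Sum>i. f (i + n)) = ennreal (\<Sum>i. r (i + n))" for n
    unfolding f using nn summable_ignore_initial_segment[OF r] by (intro suminf_ennreal2) auto
  then show ?thesis
    using tendsto_ennrealI[OF suminf_exist_split2[OF r]] by simp
qed

lemma hausdorff_content_empty:
  fixes k :: nat and \<delta> :: real
  assumes "k > 0" "\<delta> > 0"
  shows "hausdorff_content k \<delta> ({} :: 'a::metric_space set) = 0"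
proof -
  have "hausdorff_content k \<delta> ({} :: 'a set)
      \<le> (\<Sum>j :: nat. ennreal (unit_ball_vol (real k) * (diameter ((\<lambda>_. {} :: 'a set) j) / 2) ^ k))"
    by (rule hausdorff_content_le) (simp_all add: less_imp_le[OF assms(2)])
  also have "\<dots> = 0"
    by (simp add: zero_power[OF assms(1)])
  finally show ?thesis
    by (simp only: le_zero_eq)
qed

lemma hausdorff_content_UN:
  "hausdorff_content k \<delta> (\<Union>i. A i) \<le> (\<Sum>i. hausdorff_content k \<delta> (A i))"
proof (cases "(\<Sum>i. hausdorff_content k \<delta> (A i)) = \<infinity>")
  case False
  then have "(\<Sum>i. hausdorff_content k \<delta> (A i)) < top" by (simp add: top.not_eq_extremum)
  then have fin: "hausdorff_content k \<delta> (A i) < top" for i by (rule ennreal_suminf_lessD)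
  let ?w = "\<lambda>S. ennreal (unit_ball_vol (real k) * (diameter S / 2) ^ k)"
  show ?thesis
  proof (rule ennreal_le_epsilon)
    fix e :: real assume e: "0 < e"
    have "\<exists>C. A i \<subseteq> (\<Union>j. C j) \<and> (\<forall>j. bounded (C j)) \<and> (\<forall>j. diameter (C j) \<le> \<delta>) \<and>
       (\<Sum>j. ?w (C j)) \<le> hausdorff_content k \<delta> (A i) + ennreal (e * (1/2) ^ Suc i)" for i
      using e by (intro hausdorff_content_cover[OF _ fin[of i]]) simp
    then obtain C where C: "\<And>i. A i \<subseteq> (\<Union>j. C i j)" "\<And>i j. bounded (C i j)"
        "\<And>i j. diameter (C i j) \<le> \<delta>"
        "\<And>i. (\<Sum>j. ?w (C i j)) \<le> hausdorff_content k \<delta> (A i) + ennreal (e * (1/2) ^ Suc i)"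
      by metis
    define D where "D n = (case prod_decode n of (i, j) \<Rightarrow> C i j)" for n
    have "hausdorff_content k \<delta> (\<Union>i. A i) \<le> (\<Sum>n. ?w (D n))"
    proof (rule hausdorff_content_le)
      show "(\<Union>i. A i) \<subseteq> (\<Union>n. D n)"
      proof
        fix x assume "x \<in> (\<Union>i. A i)"
        then obtain i j where "x \<in> C i j" using C(1) by blast
        then have "x \<in> D (prod_encode (i, j))" by (simp add: D_def)
        then show "x \<in> (\<Union>n. D n)" by blast
      qed
    qed (auto simp: D_def C split: prod.splits)
    also have "\<dots> = (\<Sum>n. case prod_decode n of (i, j) \<Rightarrow> ?w (C i j))"
      by (intro suminf_cong) (simp add: D_def split: prod.splits)
    also have "\<dots> = (\<Sum>i. \<Sum>j. ?w (C i j))"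
      by (subst suminf_ennreal_2dimen[where g="\<lambda>i. \<Sum>j. ?w (C i j)" and f="\<lambda>(i,j). ?w (C i j)", symmetric])
        (auto simp: comp_def)
    also have "\<dots> \<le> (\<Sum>i. hausdorff_content k \<delta> (A i) + ennreal (e * (1/2) ^ Suc i))"
      by (intro suminf_le C) auto
    also have "\<dots> = (\<Sum>i. hausdorff_content k \<delta> (A i)) + (\<Sum>i. ennreal (e * (1/2) ^ Suc i))"
      by (rule suminf_add[symmetric]) auto
    also have "(\<Sum>i. ennreal (e * (1/2) ^ Suc i)) = ennreal e"
    proof (rule suminf_ennreal_eq)
      show "(\<lambda>i. e * (1/2) ^ Suc i) sums e"
        using sums_mult[OF power_half_series, of e] by (simp only: mult_1_right)
    qed (use e in simp)
    finally show "hausdorff_content k \<delta> (\<Union>i. A i) \<le> (\<Sum>i. hausdorff_content k \<delta> (A i)) + ennreal e" .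
  qed
next
  case True
  then show ?thesis by (simp only: infinity_ennreal_def top_greatest)
qed

lemma hausdorff_outer_mono: "A \<subseteq> B \<Longrightarrow> hausdorff_outer k A \<le> hausdorff_outer k B"
  unfolding hausdorff_outer_def by (rule SUP_subset_mono) (simp_all add: hausdorff_content_mono)

lemma hausdorff_outer_empty: "k > 0 \<Longrightarrow> hausdorff_outer k {} = 0"
  unfolding hausdorff_outer_def
  by (rule antisym[OF SUP_least]) (simp_all add: hausdorff_content_empty)

lemma hausdorff_outer_UN: "hausdorff_outer k (\<Union>i. A i) \<le> (\<Sum>i. hausdorff_outer k (A i))"
  unfolding hausdorff_outer_def[of k "\<Union>i. A i"]
proof (rule SUP_least)
  fix \<delta> :: real assume "\<delta> \<in> {0<..}"
  then have "hausdorff_content k \<delta> (A i) \<le> hausdorff_outer k (A i)" for i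
    unfolding hausdorff_outer_def by (intro SUP_upper) auto
  then have "(\<Sum>i. hausdorff_content k \<delta> (A i)) \<le> (\<Sum>i. hausdorff_outer k (A i))"
    by (intro suminf_le) auto
  with hausdorff_content_UN show "hausdorff_content k \<delta> (\<Union>i. A i) \<le> (\<Sum>i. hausdorff_outer k (A i))"
    by (rule order_trans)
qed

lemma hausdorff_outer_Un:
  assumes "k > 0"
  shows "hausdorff_outer k (A \<union> B) \<le> hausdorff_outer k A + hausdorff_outer k B"
proof -
  have "hausdorff_outer k (A \<union> B) \<le> (\<Sum>i. hausdorff_outer k (binaryset A B i))"
    using hausdorff_outer_UN[of k "binaryset A B"] by (simp add: UN_binaryset_eq)
  also have "\<dots> = hausdorff_outer k A + hausdorff_outer k B"
    using assms by (intro suminf_binaryset_eq hausdorff_outer_empty)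
  finally show ?thesis .
qed

lemma hausdorff_outer_separated:
  assumes k: "k > 0" and d: "d > 0" and sep: "\<And>x y. x \<in> A \<Longrightarrow> y \<in> B \<Longrightarrow> d \<le> dist x y"
  shows "hausdorff_outer k A + hausdorff_outer k B \<le> hausdorff_outer k (A \<union> B)"
proof -
  let ?w = "\<lambda>S. ennreal (unit_ball_vol (real k) * (diameter S / 2) ^ k)"
  have key: "hausdorff_content k \<delta> A + hausdorff_content k \<delta> B \<le> hausdorff_outer k (A \<union> B)"
    if \<delta>: "0 < \<delta>" "\<delta> < d" for \<delta>
  proof -
    have "hausdorff_content k \<delta> A + hausdorff_content k \<delta> B \<le> hausdorff_content k \<delta> (A \<union> B)"
      unfolding hausdorff_content_def[of k \<delta> "A \<union> B"]
    proof (rule INF_greatest)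
      fix C :: "nat \<Rightarrow> 'a set"
      assume "C \<in> {C. A \<union> B \<subseteq> (\<Union>j. C j) \<and> (\<forall>j. bounded (C j) \<and> diameter (C j) \<le> \<delta>)}"
      then have C: "A \<union> B \<subseteq> (\<Union>j. C j)" "\<And>j. bounded (C j)" "\<And>j. diameter (C j) \<le> \<delta>" by auto
      define CA where "CA j = (if C j \<inter> A = {} then {} else C j)" for j
      define CB where "CB j = (if C j \<inter> A = {} then C j else {})" for j
      have AB: "C j \<inter> B = {}" if "C j \<inter> A \<noteq> {}" for j
      proof (rule ccontr)
        assume "C j \<inter> B \<noteq> {}"
        with that obtain x y where "x \<in> C j" "x \<in> A" "y \<in> C j" "y \<in> B" by auto
        then have "d \<le> diameter (C j)"
          using sep diameter_bounded_bound[OF C(2)] by (meson order_trans)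
        with C(3)[of j] \<delta> show False by linarith
      qed
      have B: "B \<subseteq> (\<Union>j. CB j)"
      proof
        fix b assume b: "b \<in> B"
        then obtain j where j: "b \<in> C j" using C(1) by blast
        with b AB[of j] have "b \<in> CB j" by (auto simp: CB_def)
        then show "b \<in> (\<Union>j. CB j)" by blast
      qed
      have A: "A \<subseteq> (\<Union>j. CA j)"
      proof
        fix a assume a: "a \<in> A"
        then obtain j where j: "a \<in> C j" using C(1) by blast
        with a have "a \<in> CA j" by (auto simp: CA_def)
        then show "a \<in> (\<Union>j. CA j)" by blast
      qed
      have "hausdorff_content k \<delta> A \<le> (\<Sum>j. ?w (CA j))"
        by (rule hausdorff_content_le[OF A]) (use C \<delta> in \<open>auto simp: CA_def\<close>)
      moreover have "hausdorff_content k \<delta> B \<le> (\<Sum>j. ?w (CB j))"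
        by (rule hausdorff_content_le[OF B]) (use C \<delta> in \<open>auto simp: CB_def\<close>)
      ultimately have "hausdorff_content k \<delta> A + hausdorff_content k \<delta> B
          \<le> (\<Sum>j. ?w (CA j)) + (\<Sum>j. ?w (CB j))"
        by (rule add_mono)
      also have "\<dots> = (\<Sum>j. ?w (CA j) + ?w (CB j))" by (rule suminf_add) auto
      also have "\<dots> = (\<Sum>j. ?w (C j))"
        using k by (intro suminf_cong) (simp add: CA_def CB_def)
      finally show "hausdorff_content k \<delta> A + hausdorff_content k \<delta> B \<le> (\<Sum>j. ?w (C j))" .
    qed
    also have "\<dots> \<le> hausdorff_outer k (A \<union> B)"
      unfolding hausdorff_outer_def using \<delta> by (intro SUP_upper) auto
    finally show ?thesis .
  qed
  have "hausdorff_outer k A + hausdorff_outer k B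
     = (SUP \<delta> \<in> {0<..}. hausdorff_content k \<delta> A + hausdorff_content k \<delta> B)"
    unfolding hausdorff_outer_def
  proof (rule SUP_add_directed_ennreal[symmetric])
    fix i j :: real assume "i \<in> {0<..}" "j \<in> {0<..}"
    then show "\<exists>l\<in>{0<..}. hausdorff_content k i A + hausdorff_content k j B
        \<le> hausdorff_content k l A + hausdorff_content k l B"
      by (intro bexI[of _ "min i j"] add_mono hausdorff_content_antimono) auto
  qed
  also have "\<dots> \<le> hausdorff_outer k (A \<union> B)"
  proof (rule SUP_least)
    fix \<delta> :: real assume "\<delta> \<in> {0<..}"
    then have "hausdorff_content k \<delta> A + hausdorff_content k \<delta> B
      \<le> hausdorff_content k (min \<delta> (d/2)) A + hausdorff_content k (min \<delta> (d/2)) B"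
      by (intro add_mono hausdorff_content_antimono) auto
    also have "\<dots> \<le> hausdorff_outer k (A \<union> B)"
      using d \<open>\<delta> \<in> {0<..}\<close> by (intro key) auto
    finally show "hausdorff_content k \<delta> A + hausdorff_content k \<delta> B \<le> hausdorff_outer k (A \<union> B)" .
  qed
  finally show ?thesis .
qed

lemma closed_caratheodory_hausdorff:
  fixes F A :: "'a::metric_space set"
  assumes k: "k > 0" and F: "closed F"
  shows "hausdorff_outer k (A \<inter> F) + hausdorff_outer k (A - F) \<le> hausdorff_outer k A"
proof (cases "F = {} \<or> hausdorff_outer k A = \<infinity>")
  case True
  then show ?thesis using k by (auto simp: hausdorff_outer_empty)
next
  case False
  then have "F \<noteq> {}" and fin: "hausdorff_outer k A < \<infinity>" by (auto simp: less_top)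
  let ?H = "hausdorff_outer k"
  define B where "B n = {a \<in> A. 1 / real (Suc n) \<le> infdist a F}" for n
  define R where "R n = B (Suc n) - B n" for n
  have B_mono: "i \<le> n \<Longrightarrow> B i \<subseteq> B n" for i n
    using order_trans[of "1 / real (Suc n)" "1 / real (Suc i)"]
    by (auto simp: B_def frac_le)
  have R_B: "R i \<subseteq> B n" if "i < n" for i n
    using B_mono[of "Suc i" n] that by (auto simp: R_def)
  have inf_le: "infdist a F \<le> dist a b + infdist b F" for a b
    using infdist_triangle[of a F b] by (simp add: add.commute)
  have sepR: "?H (R (Suc n)) + ?H (B n) \<le> ?H (R (Suc n) \<union> B n)" for n
  proof (rule hausdorff_outer_separated[OF k])
    have "1 / real (Suc (Suc n)) < 1 / real (Suc n)"
      by (rule frac_less2) simp_all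
    then show "0 < 1 / real (Suc n) - 1 / real (Suc (Suc n))"
      by simp
  next
    fix x y assume "x \<in> R (Suc n)" "y \<in> B n"
    then show "1 / real (Suc n) - 1 / real (Suc (Suc n)) \<le> dist x y"
      using inf_le[of y x] unfolding R_def B_def by (auto simp: dist_commute)
  qed
  have sumR: "(\<Sum>i<n. ?H (R (2 * i + c))) \<le> ?H A" if "c \<le> 1" for n c
  proof -
    have "(\<Sum>i<n. ?H (R (2 * i + c))) \<le> ?H (B (2 * n + c - 1))"
    proof (induction n)
      case (Suc n)
      show ?case
      proof (cases "2 * n + c = 0")
        case True
        then have "n = 0" "c = 0" by auto
        then show ?thesis using hausdorff_outer_mono[of "R 0" "B 1"] R_B[of 0 1] by simp
      next
        case False
        then obtain q where q: "2 * n + c = Suc q" by (cases "2 * n + c") auto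
        have "(\<Sum>i<Suc n. ?H (R (2 * i + c))) \<le> ?H (R (Suc q)) + ?H (B q)"
          using Suc q by (simp add: add.commute add_left_mono)
        also have "\<dots> \<le> ?H (R (Suc q) \<union> B q)" by (rule sepR)
        also have "\<dots> \<le> ?H (B (Suc (Suc q)))"
          using R_B[of "Suc q" "Suc (Suc q)"] B_mono[of q "Suc (Suc q)"]
          by (intro hausdorff_outer_mono) auto
        also have "Suc (Suc q) = 2 * Suc n + c - 1" using q by simp
        finally show ?thesis .
      qed
    qed simp
    also have "\<dots> \<le> ?H A" by (intro hausdorff_outer_mono) (auto simp: B_def)
    finally show ?thesis .
  qed
  have sumR': "(\<Sum>i<n. ?H (R i)) \<le> ?H A + ?H A" for n
  proof -
    have "(\<Sum>i<n. ?H (R i)) \<le> (\<Sum>i<2 * n. ?H (R i))"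
      by (intro sum_mono2) auto
    also have "\<dots> = (\<Sum>i<n. ?H (R (2 * i + 0))) + (\<Sum>i<n. ?H (R (2 * i + 1)))"
      by (induction n) (simp_all add: ac_simps)
    also have "\<dots> \<le> ?H A + ?H A" by (intro add_mono sumR) auto
    finally show ?thesis .
  qed
  have R_fin: "(\<Sum>i. ?H (R i)) < top"
  proof -
    have "(\<Sum>i. ?H (R i)) \<le> ?H A + ?H A"
      by (intro suminf_le_const sumR') auto
    also have "\<dots> < top" using fin by simp
    finally show ?thesis .
  qed
  have AF: "A - F \<subseteq> B n \<union> (\<Union>i. R (i + n))" for n
  proof
    fix a assume a: "a \<in> A - F"
    then have "infdist a F > 0"
      using F \<open>F \<noteq> {}\<close> by (metis DiffD2 in_closed_iff_infdist_zero infdist_nonneg less_eq_real_def)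
    then obtain q where "1 / real (Suc q) < infdist a F"
      using reals_Archimedean by (metis inverse_eq_divide)
    then have ex: "a \<in> B q" using a by (auto simp: B_def)
    define q0 where "q0 = (LEAST q. a \<in> B q)"
    have q0: "a \<in> B q0" "\<And>i. i < q0 \<Longrightarrow> a \<notin> B i"
      unfolding q0_def using ex by (auto intro: LeastI dest: not_less_Least)
    show "a \<in> B n \<union> (\<Union>i. R (i + n))"
    proof (cases "q0 \<le> n")
      case True then show ?thesis using q0 B_mono by blast
    next
      case False
      then have "a \<in> R ((q0 - 1 - n) + n)" using q0 by (auto simp: R_def)
      then show ?thesis by blast
    qed
  qed
  have step: "?H (A \<inter> F) + ?H (A - F) \<le> ?H A + (\<Sum>i. ?H (R (i + n)))" for n
  proof -
    have "?H (A - F) \<le> ?H (B n) + ?H (\<Union>i. R (i + n))"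
      using hausdorff_outer_mono[OF AF[of n]] hausdorff_outer_Un[OF k] by (rule order_trans)
    also have "\<dots> \<le> ?H (B n) + (\<Sum>i. ?H (R (i + n)))"
      by (intro add_left_mono hausdorff_outer_UN)
    finally have "?H (A \<inter> F) + ?H (A - F) \<le> (?H (A \<inter> F) + ?H (B n)) + (\<Sum>i. ?H (R (i + n)))"
      by (simp add: add.assoc add_left_mono)
    also have "?H (A \<inter> F) + ?H (B n) \<le> ?H ((A \<inter> F) \<union> B n)"
    proof (rule hausdorff_outer_separated[OF k])
      show "0 < 1 / real (Suc n)" by simp
      fix x y assume "x \<in> A \<inter> F" "y \<in> B n"
      then show "1 / real (Suc n) \<le> dist x y"
        using infdist_le[of x F y] unfolding B_def by (auto simp: dist_commute)
    qed
    also have "?H ((A \<inter> F) \<union> B n) \<le> ?H A" by (intro hausdorff_outer_mono) (auto simp: B_def)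
    finally show ?thesis by (simp add: add_right_mono)
  qed
  have "(\<lambda>n. \<Sum>i. ?H (R (i + n))) \<longlonglongrightarrow> 0"
    using R_fin by (rule ennreal_suminf_tail)
  then have "(\<lambda>n. ?H A + (\<Sum>i. ?H (R (i + n)))) \<longlonglongrightarrow> ?H A + 0"
    by (intro tendsto_add tendsto_const)
  then show ?thesis
    using step by (intro LIMSEQ_le_const[where X="\<lambda>n. ?H A + (\<Sum>i. ?H (R (i + n)))"]) auto
qed

lemma measure_space_hausdorff:
  assumes k: "k > 0"
  shows "measure_space UNIV (sets (borel :: 'a::metric_space measure)) (hausdorff_outer k)"
proof -
  interpret P: sigma_algebra "UNIV :: 'a set" UNIV
    using sigma_algebra_Pow[of UNIV] by simp
  let ?L = "lambda_system (UNIV :: 'a set) UNIV (hausdorff_outer k)"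
  have "outer_measure_space (UNIV :: 'a set set) (hausdorff_outer k)"
    unfolding outer_measure_space_def positive_def increasing_def countably_subadditive_def
    using hausdorff_outer_mono hausdorff_outer_empty[OF k] hausdorff_outer_UN by auto
  from P.caratheodory_lemma[OF this]
  have L: "measure_space UNIV ?L (hausdorff_outer k)" .
  have "sets (borel :: 'a measure) \<subseteq> ?L"
  proof -
    have "{F :: 'a set. closed F} \<subseteq> ?L"
    proof
      fix F :: "'a set" assume "F \<in> {F. closed F}"
      then have F: "closed F" by simp
      have "hausdorff_outer k (F \<inter> A) + hausdorff_outer k ((UNIV - F) \<inter> A) = hausdorff_outer k A" for A
      proof (rule antisym)
        show "hausdorff_outer k (F \<inter> A) + hausdorff_outer k ((UNIV - F) \<inter> A) \<le> hausdorff_outer k A"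
          using closed_caratheodory_hausdorff[OF k F, of A] by (simp add: Int_commute Diff_eq)
        have "A = (F \<inter> A) \<union> ((UNIV - F) \<inter> A)" by auto
        then show "hausdorff_outer k A \<le> hausdorff_outer k (F \<inter> A) + hausdorff_outer k ((UNIV - F) \<inter> A)"
          using hausdorff_outer_Un[OF k] by metis
      qed
      then show "F \<in> ?L" by (auto simp: lambda_system_def)
    qed
    moreover have "sigma_algebra UNIV ?L" using L by (simp add: measure_space_def)
    ultimately show ?thesis
      unfolding borel_eq_closed sets_measure_of_conv
      by (auto intro: sigma_algebra.sigma_sets_subset[THEN subsetD])
  qed
  with L show ?thesis
    using sets.sigma_algebra_axioms[of "borel :: 'a measure"]
    by (auto simp: measure_space_def positive_def countably_additive_def subset_iff)
qed

lemma space_surface_measure [simp]: "space surface_measure = UNIV"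
  by (simp add: surface_measure_def space_measure_of_conv)

lemma sets_surface_measure [simp, measurable_cong]: "sets surface_measure = sets borel"
  using sets.sigma_sets_eq[of borel] by (simp add: surface_measure_def sets_measure_of_conv)

lemma emeasure_surface_measure:
  assumes "2 \<le> DIM('a)" "A \<in> sets borel"
  shows "emeasure (surface_measure :: 'a::euclidean_space measure) A = hausdorff_outer (DIM('a) - 1) A"
  unfolding surface_measure_def
  using measure_space_hausdorff[of "DIM('a) - 1", where 'a='a] assms
  by (intro emeasure_measure_of_sigma) (auto simp: measure_space_def)


section \<open>Lipschitz boundaries\<close>

text \<open>
  Locally, and up to a rotation, the set is the strict subgraph of a Lipschitz function on
  a hyperplane. Since \<open>e\<close> can be replaced by \<open>- e\<close>, it does not matter
  on which side of the graph the set lies.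
\<close>

definition lipschitz_boundary :: "'a::euclidean_space set \<Rightarrow> bool" where
  "lipschitz_boundary \<Omega> \<longleftrightarrow>
    (\<forall>p \<in> frontier \<Omega>. \<exists>U e L (g :: 'a \<Rightarrow> real).
       open U \<and> p \<in> U \<and> norm e = 1 \<and> L-lipschitz_on {\<omega>. \<omega> \<bullet> e = 0} g \<and>
       \<Omega> \<inter> U = {\<omega> \<in> U. \<omega> \<bullet> e < g (\<omega> - (\<omega> \<bullet> e) *\<^sub>R e)})"


section \<open>Lebesgue and Sobolev spaces\<close>

definition L2 :: "'a measure \<Rightarrow> ('a \<Rightarrow> real) set" where
  "L2 M = {u \<in> borel_measurable M. integrable M (\<lambda>\<omega>. (u \<omega>)\<^sup>2)}"

definition L2_inner :: "'a measure \<Rightarrow> ('a \<Rightarrow> real) \<Rightarrow> ('a \<Rightarrow> real) \<Rightarrow> real" where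
  "L2_inner M u v = (\<integral>\<omega>. u \<omega> * v \<omega> \<partial>M)"

fun C_k :: "nat \<Rightarrow> ('a::euclidean_space \<Rightarrow> real) \<Rightarrow> bool" where
  "C_k 0 \<psi> \<longleftrightarrow> continuous_on UNIV \<psi>"
| "C_k (Suc k) \<psi> \<longleftrightarrow> (\<forall>\<omega>. \<psi> differentiable (at \<omega>)) \<and>
     (\<forall>b \<in> Basis. C_k k (\<lambda>\<omega>. frechet_derivative \<psi> (at \<omega>) b))"

definition test_functions :: "'a::euclidean_space set \<Rightarrow> ('a \<Rightarrow> real) set" where
  "test_functions \<Omega> = {\<psi>. (\<forall>k. C_k k \<psi>) \<and>
     compact (closure {\<omega>. \<psi> \<omega> \<noteq> 0}) \<and> closure {\<omega>. \<psi> \<omega> \<noteq> 0} \<subseteq> \<Omega>}"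

definition is_weak_gradient ::
    "'a::euclidean_space set \<Rightarrow> ('a \<Rightarrow> real) \<Rightarrow> ('a \<Rightarrow> 'a) \<Rightarrow> bool" where
  "is_weak_gradient \<Omega> x g \<longleftrightarrow>
    (\<forall>\<psi> \<in> test_functions \<Omega>. \<forall>b \<in> Basis.
       (\<integral>\<omega>. x \<omega> * frechet_derivative \<psi> (at \<omega>) b \<partial>(lebesgue_on \<Omega>)) =
       - (\<integral>\<omega>. (g \<omega> \<bullet> b) * \<psi> \<omega> \<partial>(lebesgue_on \<Omega>)))"

definition H1 :: "'a::euclidean_space set \<Rightarrow> ('a \<Rightarrow> real) set" where
  "H1 \<Omega> = {x \<in> L2 (lebesgue_on \<Omega>).
     \<exists>g. (\<forall>b \<in> Basis. (\<lambda>\<omega>. g \<omega> \<bullet> b) \<in> L2 (lebesgue_on \<Omega>)) \<and> is_weak_gradient \<Omega> x g}"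

text \<open>A representative of the weak gradient of \<open>x \<in> H1 \<Omega>\<close>, which is unique almost everywhere
  in \<open>\<Omega>\<close>; it is only used inside integrals over \<open>\<Omega>\<close>.\<close>

definition weak_grad :: "'a::euclidean_space set \<Rightarrow> ('a \<Rightarrow> real) \<Rightarrow> 'a \<Rightarrow> 'a" where
  "weak_grad \<Omega> x =
    (SOME g. (\<forall>b \<in> Basis. (\<lambda>\<omega>. g \<omega> \<bullet> b) \<in> L2 (lebesgue_on \<Omega>)) \<and> is_weak_gradient \<Omega> x g)"

definition grad_inner :: "'a::euclidean_space set \<Rightarrow> ('a \<Rightarrow> real) \<Rightarrow> ('a \<Rightarrow> real) \<Rightarrow> real" where
  "grad_inner \<Omega> x y = (\<integral>\<omega>. weak_grad \<Omega> x \<omega> \<bullet> weak_grad \<Omega> y \<omega> \<partial>(lebesgue_on \<Omega>))"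

definition H1_inner :: "'a::euclidean_space set \<Rightarrow> ('a \<Rightarrow> real) \<Rightarrow> ('a \<Rightarrow> real) \<Rightarrow> real" where
  "H1_inner \<Omega> x y = L2_inner (lebesgue_on \<Omega>) x y + grad_inner \<Omega> x y"

definition C1_closure :: "'a::euclidean_space set \<Rightarrow> ('a \<Rightarrow> real) set" where
  "C1_closure \<Omega> = {x. continuous_on (closure \<Omega>) x \<and>
     (\<exists>G. continuous_on (closure \<Omega>) G \<and>
       (\<forall>\<omega> \<in> \<Omega>. (x has_derivative (\<lambda>h. G \<omega> \<bullet> h)) (at \<omega>)))}"


section \<open>Inner product spaces of functions\<close>

definition norm_of :: "('v \<Rightarrow> 'v \<Rightarrow> real) \<Rightarrow> 'v \<Rightarrow> real" where
  "norm_of ip x = sqrt (ip x x)"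

text \<open>\<open>V\<close> with inner product \<open>ip\<close> is a real Hilbert space, functions being
  identified when they agree \<open>M\<close>-almost everywhere.\<close>

definition hilbert_space ::
    "'a measure \<Rightarrow> ('a \<Rightarrow> real) set \<Rightarrow> (('a \<Rightarrow> real) \<Rightarrow> ('a \<Rightarrow> real) \<Rightarrow> real) \<Rightarrow> bool" where
  "hilbert_space M V ip \<longleftrightarrow>
    (\<lambda>\<omega>. 0) \<in> V \<and>
    (\<forall>x \<in> V. \<forall>y \<in> V. (\<lambda>\<omega>. x \<omega> + y \<omega>) \<in> V) \<and>
    (\<forall>x \<in> V. \<forall>c. (\<lambda>\<omega>. c * x \<omega>) \<in> V) \<and>
    (\<forall>x \<in> V. \<forall>y \<in> V. ip x y = ip y x) \<and>
    (\<forall>x \<in> V. \<forall>y \<in> V. \<forall>w \<in> V. ip (\<lambda>\<omega>. x \<omega> + y \<omega>) w = ip x w + ip y w) \<and>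
    (\<forall>x \<in> V. \<forall>w \<in> V. \<forall>c. ip (\<lambda>\<omega>. c * x \<omega>) w = c * ip x w) \<and>
    (\<forall>x \<in> V. 0 \<le> ip x x) \<and>
    (\<forall>x \<in> V. ip x x = 0 \<longrightarrow> (AE \<omega> in M. x \<omega> = 0)) \<and>
    (\<forall>xs. range xs \<subseteq> V \<and>
       (\<forall>e>0. \<exists>n0. \<forall>k\<ge>n0. \<forall>n\<ge>n0. norm_of ip (\<lambda>\<omega>. xs k \<omega> - xs n \<omega>) < e) \<longrightarrow>
       (\<exists>x \<in> V. (\<lambda>n. norm_of ip (\<lambda>\<omega>. xs n \<omega> - x \<omega>)) \<longlonglongrightarrow> 0))"

definition weakly_converges ::
    "'v set \<Rightarrow> ('v \<Rightarrow> 'v \<Rightarrow> real) \<Rightarrow> (nat \<Rightarrow> 'v) \<Rightarrow> 'v \<Rightarrow> bool" where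
  "weakly_converges V ip xs x \<longleftrightarrow> (\<forall>y \<in> V. (\<lambda>n. ip (xs n) y) \<longlonglongrightarrow> ip x y)"

definition op_norm ::
    "'v set \<Rightarrow> ('v \<Rightarrow> 'v \<Rightarrow> real) \<Rightarrow> ('w \<Rightarrow> 'w \<Rightarrow> real) \<Rightarrow> ('v \<Rightarrow> 'w) \<Rightarrow> real" where
  "op_norm V ipV ipW L = (SUP x \<in> {x \<in> V. norm_of ipV x \<le> 1}. norm_of ipW (L x))"

text \<open>
  Proper convex lower semicontinuous functions. Lower semicontinuity is with respect to the
  norm of \<open>ip\<close>; it forces \<open>f\<close> to take the same value at functions whose difference
  has norm 0, so that \<open>f\<close> is a function of classes. In the same way a differentiable
  function (see below) depends only on classes.
\<close>

definition Gamma0 ::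
    "('a \<Rightarrow> real) set \<Rightarrow> (('a \<Rightarrow> real) \<Rightarrow> ('a \<Rightarrow> real) \<Rightarrow> real) \<Rightarrow> (('a \<Rightarrow> real) \<Rightarrow> ereal) \<Rightarrow> bool" where
  "Gamma0 V ip f \<longleftrightarrow>
    (\<forall>x \<in> V. f x \<noteq> -\<infinity>) \<and> (\<exists>x \<in> V. f x \<noteq> \<infinity>) \<and>
    (\<forall>x \<in> V. \<forall>y \<in> V. \<forall>t \<in> {0<..<1}.
       f (\<lambda>\<omega>. (1 - t) * x \<omega> + t * y \<omega>) \<le> ereal (1 - t) * f x + ereal t * f y) \<and>
    (\<forall>x \<in> V. \<forall>c < f x. \<exists>\<delta>>0. \<forall>y \<in> V. norm_of ip (\<lambda>\<omega>. y \<omega> - x \<omega>) < \<delta> \<longrightarrow> c < f y)"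

definition convex_function :: "('a \<Rightarrow> real) set \<Rightarrow> (('a \<Rightarrow> real) \<Rightarrow> real) \<Rightarrow> bool" where
  "convex_function V \<phi> \<longleftrightarrow>
    (\<forall>x \<in> V. \<forall>y \<in> V. \<forall>t \<in> {0<..<1}.
       \<phi> (\<lambda>\<omega>. (1 - t) * x \<omega> + t * y \<omega>) \<le> (1 - t) * \<phi> x + t * \<phi> y)"

text \<open>\<open>g\<close> represents the Frechet derivative of \<open>\<phi>\<close> at \<open>x\<close>.\<close>

definition has_gradient ::
    "('a \<Rightarrow> real) set \<Rightarrow> (('a \<Rightarrow> real) \<Rightarrow> ('a \<Rightarrow> real) \<Rightarrow> real) \<Rightarrow> (('a \<Rightarrow> real) \<Rightarrow> real) \<Rightarrow>
      ('a \<Rightarrow> real) \<Rightarrow> ('a \<Rightarrow> real) \<Rightarrow> bool" where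
  "has_gradient V ip \<phi> x g \<longleftrightarrow> g \<in> V \<and>
    (\<forall>e>0. \<exists>\<delta>>0. \<forall>y \<in> V. norm_of ip (\<lambda>\<omega>. y \<omega> - x \<omega>) < \<delta> \<longrightarrow>
       \<bar>\<phi> y - \<phi> x - ip g (\<lambda>\<omega>. y \<omega> - x \<omega>)\<bar> \<le> e * norm_of ip (\<lambda>\<omega>. y \<omega> - x \<omega>))"

definition gradient ::
    "('a \<Rightarrow> real) set \<Rightarrow> (('a \<Rightarrow> real) \<Rightarrow> ('a \<Rightarrow> real) \<Rightarrow> real) \<Rightarrow> (('a \<Rightarrow> real) \<Rightarrow> real) \<Rightarrow>
      ('a \<Rightarrow> real) \<Rightarrow> 'a \<Rightarrow> real" where
  "gradient V ip \<phi> x = (SOME g. has_gradient V ip \<phi> x g)"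

definition differentiable_with_lipschitz_gradient ::
    "('a \<Rightarrow> real) set \<Rightarrow> (('a \<Rightarrow> real) \<Rightarrow> ('a \<Rightarrow> real) \<Rightarrow> real) \<Rightarrow> (('a \<Rightarrow> real) \<Rightarrow> real) \<Rightarrow>
      real \<Rightarrow> bool" where
  "differentiable_with_lipschitz_gradient V ip \<phi> \<tau> \<longleftrightarrow>
    (\<forall>x \<in> V. \<exists>g. has_gradient V ip \<phi> x g) \<and>
    (\<forall>x \<in> V. \<forall>y \<in> V.
       norm_of ip (\<lambda>\<omega>. gradient V ip \<phi> x \<omega> - gradient V ip \<phi> y \<omega>)
         \<le> \<tau> * norm_of ip (\<lambda>\<omega>. x \<omega> - y \<omega>))"


section \<open>Traces and the mixed boundary value problem\<close>

abbreviation surface_on :: "'a::euclidean_space set \<Rightarrow> 'a measure" where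
  "surface_on \<Upsilon> \<equiv> restrict_space surface_measure \<Upsilon>"

text \<open>These properties determine \<open>T x\<close> up to equality almost everywhere on the boundary, since
  \<open>C1_closure \<Omega>\<close> is dense in \<open>H1 \<Omega>\<close> for bounded \<open>\<Omega>\<close> with Lipschitz boundary.\<close>

definition is_trace_operator ::
    "'a::euclidean_space set \<Rightarrow> (('a \<Rightarrow> real) \<Rightarrow> 'a \<Rightarrow> real) \<Rightarrow> bool" where
  "is_trace_operator \<Omega> T \<longleftrightarrow>
    (\<forall>x \<in> H1 \<Omega>. T x \<in> L2 (surface_on (frontier \<Omega>))) \<and>
    (\<forall>x \<in> H1 \<Omega>. \<forall>y \<in> H1 \<Omega>.
       AE \<omega> in surface_on (frontier \<Omega>). T (\<lambda>\<omega>. x \<omega> + y \<omega>) \<omega> = T x \<omega> + T y \<omega>) \<and>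
    (\<forall>x \<in> H1 \<Omega>. \<forall>c.
       AE \<omega> in surface_on (frontier \<Omega>). T (\<lambda>\<omega>. c * x \<omega>) \<omega> = c * T x \<omega>) \<and>
    (\<exists>K. \<forall>x \<in> H1 \<Omega>.
       norm_of (L2_inner (surface_on (frontier \<Omega>))) (T x) \<le> K * norm_of (H1_inner \<Omega>) x) \<and>
    (\<forall>x \<in> C1_closure \<Omega>. AE \<omega> in surface_on (frontier \<Omega>). T x \<omega> = x \<omega>)"

definition H1_vanishing_on ::
    "'a::euclidean_space set \<Rightarrow> (('a \<Rightarrow> real) \<Rightarrow> 'a \<Rightarrow> real) \<Rightarrow> 'a set \<Rightarrow> ('a \<Rightarrow> real) set" where
  "H1_vanishing_on \<Omega> T \<Upsilon> = {x \<in> H1 \<Omega>. AE \<omega> in surface_on \<Upsilon>. T x \<omega> = 0}"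

text \<open>Weak solutions of the Laplace equation on \<open>\<Omega>\<close> with Dirichlet condition 0 on \<open>\<Upsilon>\<close> and
  Neumann condition \<open>v\<close> on \<open>\<Sigma>\<close>; \<open>T\<close> is the trace operator of \<open>\<Omega>\<close>.\<close>

definition dirichlet_neumann_weak_solution ::
    "'a::euclidean_space set \<Rightarrow> (('a \<Rightarrow> real) \<Rightarrow> 'a \<Rightarrow> real) \<Rightarrow> 'a set \<Rightarrow> 'a set \<Rightarrow>
      ('a \<Rightarrow> real) \<Rightarrow> ('a \<Rightarrow> real) \<Rightarrow> bool" where
  "dirichlet_neumann_weak_solution \<Omega> T \<Upsilon> \<Sigma> v z \<longleftrightarrow>
    z \<in> H1_vanishing_on \<Omega> T \<Upsilon> \<and>
    (\<forall>x \<in> H1_vanishing_on \<Omega> T \<Upsilon>.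
       grad_inner \<Omega> x z = (\<integral>\<omega>. T x \<omega> * v \<omega> \<partial>(surface_on \<Sigma>)))"

end

theory Submission
  imports Defs "HOL-Library.Function_Algebras"
begin

text \<open>
  The problem is to minimize \<open>f + \<Phi>\<close> over the product of the spaces
  \<open>\<H> i\<close>, where \<open>f\<close> is the separable sum of the functions
  \<open>f i\<close> and \<open>\<Phi>\<close> is the sum of the functions \<open>\<phi> i j\<close>
  composed with the linear maps \<open>u \<mapsto> Tr i j (u i) - Tr j i (u j)\<close>. The weak form
  of the Dirichlet-Neumann problems says exactly that \<open>z\<close> represents the derivative of
  \<open>\<Phi>\<close> at \<open>x\<close> in the product, and \<open>y\<close> is the proximal point
  of \<open>\<gamma> f\<close> at \<open>x - \<gamma> (z + b)\<close>. The scheme is thus an inexact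
  forward-backward iteration with summable errors; replacing the relaxation parameters of the
  components by a common one is one more summable error.

  Descent (\<open>forward_backward_step\<close>). By the theorem of Baillon and Haddad each gradient
  of \<open>\<phi> i j\<close> is cocoercive, and the Cauchy-Schwarz inequality over the pairs of
  neighbours turns this into cocoercivity of the derivative of \<open>\<Phi>\<close> with the constant
  \<open>\<beta>\<close>. Together with the variational inequalities for the proximal point and for a
  minimizer, this bounds, up to the error \<open>b\<close>, the distance from \<open>y\<close> to a
  minimizer by the distance from \<open>x\<close>, with a gain proportional to the square of the norm
  of \<open>x - y\<close>. Hence the distances from the iterates to each minimizer converge,
  \<open>x - y\<close> tends to zero, and the objective at \<open>y\<close> tends to its infimum.

  Weak convergence (\<open>weak_limit_in_closed_convex_sets\<close>). The limit is found as an
  asymptotic center, a minimizer of \<open>u \<mapsto> limsup (norm (x n - u))\<close>. The center of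
  any subsequence lies in every closed convex set that the sequence approaches, here in all sublevel
  sets of the objective, so it is a minimizer; since the distances to minimizers converge, one point
  is the center of all subsequences, and such a point is the weak limit.

  Boundedness of traces (\<open>trace_bounded\<close>). The constant \<open>\<beta>\<close> involves
  operator norms for the gradient norm, so the traces must be bounded for that norm, which is a
  Poincare inequality. On a domain with several components it would fail if one component did not meet
  the part of the boundary with the Dirichlet condition, so it has to come from the completeness of
  \<open>\<H> i\<close>, by the argument of the closed graph theorem: the \<open>L2\<close> norm is a
  countably subadditive seminorm on \<open>\<H> i\<close>, hence bounded by the gradient norm
  (\<open>countably_subadditive_seminorm_bounded\<close>). Countable subadditivity holds because
  absolutely convergent series in \<open>H1\<close> converge there and because traces are continuous
  on \<open>H1\<close>; it relies on the uniqueness of weak gradients, which is the fundamental lemma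
  of the calculus of variations.

  Elements of the spaces are functions, not classes. All spaces are therefore subspaces of a vector
  space of functions with a semi-inner product, and vectors of norm zero play the part of zero.
\<close>

section \<open>Semi-inner product spaces\<close>

instantiation "fun" :: (type, real_vector) real_vector
begin
definition scaleR_fun_def: "scaleR c f = (\<lambda>x. c *\<^sub>R f x)"
instance
  by standard (auto simp: scaleR_fun_def fun_eq_iff algebra_simps)
end

lemma scaleR_fun_apply [simp]: "(c *\<^sub>R f) x = c *\<^sub>R f x"
  by (simp add: scaleR_fun_def)

text \<open>
  First-order conditions are all obtained in this form: minimality along a segment bounds a quadratic
  in the parameter from below, and dividing by the parameter leaves the linear coefficient.
\<close>

lemma nonneg_of_quadratic:
  fixes a b :: real
  assumes "\<And>t. 0 < t \<Longrightarrow> t < 1 \<Longrightarrow> 0 \<le> t * a + t\<^sup>2 * b"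
  shows "0 \<le> a"
proof (rule tendsto_lowerbound)
  show "((\<lambda>t. a + t * b) \<longlongrightarrow> a) (at_right 0)"
    by (auto intro!: tendsto_eq_intros)
  show "\<forall>\<^sub>F t in at_right 0. 0 \<le> a + t * b"
  proof (rule eventually_at_rightI[of 0 1])
    fix t :: real assume t: "t \<in> {0<..<1}"
    then have "0 \<le> t * (a + t * b)"
      using assms[of t] by (simp add: algebra_simps power2_eq_square)
    then show "0 \<le> a + t * b"
      using t by (simp add: zero_le_mult_iff)
  qed simp
qed simp

text \<open>
  The vectors of norm zero need not vanish, so that spaces of functions with an inner product on the
  classes are covered.
\<close>

locale semi_inner_space =
  fixes V :: "'v::real_vector set" and ip :: "'v \<Rightarrow> 'v \<Rightarrow> real"
  assumes subspace: "subspace V"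
    and sym: "x \<in> V \<Longrightarrow> y \<in> V \<Longrightarrow> ip x y = ip y x"
    and add_left: "x \<in> V \<Longrightarrow> y \<in> V \<Longrightarrow> w \<in> V \<Longrightarrow> ip (x + y) w = ip x w + ip y w"
    and scale_left: "x \<in> V \<Longrightarrow> w \<in> V \<Longrightarrow> ip (c *\<^sub>R x) w = c * ip x w"
    and nonneg: "x \<in> V \<Longrightarrow> 0 \<le> ip x x"
begin

abbreviation nrm :: "'v \<Rightarrow> real" where "nrm \<equiv> norm_of ip"

lemma zero_mem [simp]: "0 \<in> V"
  using subspace by (rule subspace_0)

lemma add_mem [simp]: "x \<in> V \<Longrightarrow> y \<in> V \<Longrightarrow> x + y \<in> V"
  using subspace by (rule subspace_add)

lemma scale_mem [simp]: "x \<in> V \<Longrightarrow> c *\<^sub>R x \<in> V"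
  using subspace by (rule subspace_scale)

lemma diff_mem [simp]: "x \<in> V \<Longrightarrow> y \<in> V \<Longrightarrow> x - y \<in> V"
  using subspace by (rule subspace_diff)

lemma sum_mem [simp]: "(\<And>i. i \<in> A \<Longrightarrow> x i \<in> V) \<Longrightarrow> sum x A \<in> V"
  using subspace by (rule subspace_sum)

lemma diff_left: "x \<in> V \<Longrightarrow> y \<in> V \<Longrightarrow> w \<in> V \<Longrightarrow> ip (x - y) w = ip x w - ip y w"
  using add_left[of x "(-1) *\<^sub>R y" w] scale_left[of y w "-1"] scale_mem[of y "-1"] by simp

lemma add_right: "x \<in> V \<Longrightarrow> y \<in> V \<Longrightarrow> w \<in> V \<Longrightarrow> ip w (x + y) = ip w x + ip w y"
  using add_left sym by (metis add_mem)

lemma diff_right: "x \<in> V \<Longrightarrow> y \<in> V \<Longrightarrow> w \<in> V \<Longrightarrow> ip w (x - y) = ip w x - ip w y"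
  using diff_left sym by (metis diff_mem)

lemma scale_right: "x \<in> V \<Longrightarrow> w \<in> V \<Longrightarrow> ip w (c *\<^sub>R x) = c * ip w x"
  using scale_left sym by (metis scale_mem)

lemma zero_left [simp]: "w \<in> V \<Longrightarrow> ip 0 w = 0"
  using scale_left[of w w 0] by simp

lemma minus_mem [simp]: "x \<in> V \<Longrightarrow> - x \<in> V"
  using scale_mem[of x "-1"] by simp

lemma minus_right: "x \<in> V \<Longrightarrow> w \<in> V \<Longrightarrow> ip w (- x) = - ip w x"
  using scale_right[of x w "-1"] by simp

lemmas bilinear = add_left add_right diff_left diff_right scale_left scale_right

lemma nrm_nonneg [simp]: "x \<in> V \<Longrightarrow> 0 \<le> nrm x"
  by (simp add: norm_of_def nonneg)

lemma nrm_power2: "x \<in> V \<Longrightarrow> (nrm x)\<^sup>2 = ip x x"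
  by (simp add: norm_of_def nonneg)

lemma nrm_zero [simp]: "nrm 0 = 0"
  by (simp add: norm_of_def)

lemma nrm_scale: "x \<in> V \<Longrightarrow> nrm (c *\<^sub>R x) = \<bar>c\<bar> * nrm x"
  by (simp add: norm_of_def bilinear real_sqrt_mult flip: mult.assoc power2_eq_square)

lemma nrm_minus_commute: "x \<in> V \<Longrightarrow> y \<in> V \<Longrightarrow> nrm (x - y) = nrm (y - x)"
  using nrm_scale[of "x - y" "-1"] by simp

lemma nrm2_add: "x \<in> V \<Longrightarrow> y \<in> V \<Longrightarrow> (nrm (x + y))\<^sup>2 = (nrm x)\<^sup>2 + 2 * ip x y + (nrm y)\<^sup>2"
  by (simp add: nrm_power2 bilinear sym)

lemma nrm2_diff: "x \<in> V \<Longrightarrow> y \<in> V \<Longrightarrow> (nrm (x - y))\<^sup>2 = (nrm x)\<^sup>2 - 2 * ip x y + (nrm y)\<^sup>2"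
  by (simp add: nrm_power2 bilinear sym)

lemma ip_eq_0: 
  assumes "x \<in> V" "y \<in> V" "nrm y = 0"
  shows "ip x y = 0"
proof -
  have *: "0 \<le> ip u y" if "u \<in> V" for u
  proof (rule nonneg_of_quadratic)
    fix t :: real assume t: "0 < t" "t < 1"
    have "0 \<le> (nrm (t *\<^sub>R u + y))\<^sup>2" by simp
    also have "\<dots> = t\<^sup>2 * (nrm u)\<^sup>2 + 2 * t * ip u y"
      using that assms by (simp add: nrm2_add nrm_scale bilinear power_mult_distrib)
    finally show "0 \<le> t * ip u y + t\<^sup>2 * ((nrm u)\<^sup>2 / 2)" by (simp add: field_simps)
  qed
  from *[of x] *[of "(-1) *\<^sub>R x"] show ?thesis
    using assms scale_left[of x y "-1"] scale_mem[of x "-1"] by simp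
qed

lemma cauchy_schwarz:
  assumes "x \<in> V" "y \<in> V"
  shows "\<bar>ip x y\<bar> \<le> nrm x * nrm y"
proof (cases "nrm y = 0")
  case True
  then show ?thesis using ip_eq_0[OF assms] by simp
next
  case False
  define t where "t = ip x y / (nrm y)\<^sup>2"
  have "0 \<le> (nrm (x - t *\<^sub>R y))\<^sup>2" by simp
  also have "\<dots> = (nrm x)\<^sup>2 - 2 * t * ip x y + t\<^sup>2 * (nrm y)\<^sup>2"
    using assms by (simp add: nrm2_diff nrm_scale bilinear power_mult_distrib)
  also have "\<dots> = (nrm x)\<^sup>2 - (ip x y)\<^sup>2 / (nrm y)\<^sup>2"
    using False by (simp add: t_def power2_eq_square field_simps)
  finally have "(ip x y)\<^sup>2 \<le> (nrm x * nrm y)\<^sup>2"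
    using False by (simp add: power_mult_distrib field_simps)
  then show ?thesis
    using assms by (simp add: abs_le_square_iff[symmetric])
qed

lemma nrm_triangle: 
  assumes "x \<in> V" "y \<in> V" shows "nrm (x + y) \<le> nrm x + nrm y"
proof (rule power2_le_imp_le)
  show "(nrm (x + y))\<^sup>2 \<le> (nrm x + nrm y)\<^sup>2"
    using cauchy_schwarz[OF assms] assms by (simp add: nrm2_add power2_sum)
qed (use assms in simp)

lemma nrm_triangle_diff: "x \<in> V \<Longrightarrow> y \<in> V \<Longrightarrow> nrm (x - y) \<le> nrm x + nrm y"
  using nrm_triangle[of x "(-1) *\<^sub>R y"] nrm_scale[of y "-1"] scale_mem[of y "-1"] by simp

lemma nrm_triangle_via: "x \<in> V \<Longrightarrow> y \<in> V \<Longrightarrow> w \<in> V \<Longrightarrow> nrm (x - y) \<le> nrm (x - w) + nrm (w - y)"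
  using nrm_triangle[of "x - w" "w - y"] by simp

lemma nrm_sum_le: "(\<And>i. i \<in> A \<Longrightarrow> x i \<in> V) \<Longrightarrow> nrm (sum x A) \<le> (\<Sum>i\<in>A. nrm (x i))"
proof (induction A rule: infinite_finite_induct)
  case (insert a F)
  then show ?case using nrm_triangle[of "x a" "sum x F"] by (simp add: add_left_mono order.trans)
qed simp_all

lemma nrm_congruent:
  assumes "x \<in> V" "y \<in> V" "nrm (x - y) = 0"
  shows "nrm x = nrm y"
  using nrm_triangle[of "x - y" y] nrm_triangle[of "y - x" x] assms nrm_minus_commute[of x y] by simp

lemma nrm2_midpoint:
  assumes "x \<in> V" "u \<in> V" "v \<in> V"
  shows "(nrm (x - ((1/2) *\<^sub>R u + (1/2) *\<^sub>R v)))\<^sup>2 =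
    (nrm (x - u))\<^sup>2 / 2 + (nrm (x - v))\<^sup>2 / 2 - (nrm (u - v))\<^sup>2 / 4"
  using assms by (simp add: nrm_power2 bilinear sym[of v u] sym[of u x] sym[of v x] field_simps)

lemma nrm2_convex_combination:
  assumes "u \<in> V" "v \<in> V"
  shows "(nrm ((1 - t) *\<^sub>R u + t *\<^sub>R v))\<^sup>2 =
    (1 - t) * (nrm u)\<^sup>2 + t * (nrm v)\<^sup>2 - t * (1 - t) * (nrm (u - v))\<^sup>2"
proof -
  have "(1 - t) * a + t * b - t * (1 - t) * (a - c - (c - b)) = (1 - t) * ((1 - t) * a + t * c) + t * ((1 - t) * c + t * b)" for a b c :: real
    by algebra
  from this[of "ip u u" "ip v v" "ip u v"] show ?thesis
    using assms by (simp add: nrm_power2 bilinear sym[of v u])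
qed

section \<open>Asymptotic centers and weak convergence\<close>

text \<open>
  Closedness is sequential and up to vectors of norm zero: a closed set contains every vector at
  distance zero from one of its members.
\<close>

definition norm_closed :: "'v set \<Rightarrow> bool" where
  "norm_closed C \<longleftrightarrow> C \<subseteq> V \<and>
    (\<forall>xs x. (\<forall>n. xs n \<in> C) \<longrightarrow> x \<in> V \<longrightarrow> (\<lambda>n. nrm (xs n - x)) \<longlonglongrightarrow> 0 \<longrightarrow> x \<in> C)"

text \<open>
  This is \<open>limsup (nrm (x n - u))\<close>, in the form of the infimum of the eventual upper
  bounds, which is a real number for bounded sequences.
\<close>

definition asymptotic_radius :: "(nat \<Rightarrow> 'v) \<Rightarrow> 'v \<Rightarrow> real" where
  "asymptotic_radius x u = Inf {r. \<forall>\<^sub>F n in sequentially. nrm (x n - u) \<le> r}"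

lemma asymptotic_radius_le:
  assumes "\<And>n. x n \<in> V" "u \<in> V" "\<forall>\<^sub>F n in sequentially. nrm (x n - u) \<le> r"
  shows "asymptotic_radius x u \<le> r"
  unfolding asymptotic_radius_def
proof (rule cInf_lower)
  show "bdd_below {r. \<forall>\<^sub>F n in sequentially. nrm (x n - u) \<le> r}"
  proof (rule bdd_belowI)
    fix r assume "r \<in> {r. \<forall>\<^sub>F n in sequentially. nrm (x n - u) \<le> r}"
    then obtain n where "nrm (x n - u) \<le> r" by (auto dest: eventually_happens)
    then show "0 \<le> r" using assms nrm_nonneg[of "x n - u"] by (meson diff_mem order.trans)
  qed
qed (use assms in simp)

lemma asymptotic_radius_less_imp:
  assumes "\<And>n. x n \<in> V" "u \<in> V" "\<And>n. nrm (x n) \<le> B" "asymptotic_radius x u < r"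
  shows "\<forall>\<^sub>F n in sequentially. nrm (x n - u) \<le> r"
proof -
  have "nrm (x n - u) \<le> B + nrm u" for n
    using nrm_triangle_diff[OF assms(1,2), of n] assms(3)[of n] by linarith
  then have "{r. \<forall>\<^sub>F n in sequentially. nrm (x n - u) \<le> r} \<noteq> {}" by (auto intro: exI[of _ "B + nrm u"])
  from cInf_lessD[OF this assms(4)[unfolded asymptotic_radius_def]]
  show ?thesis by (auto elim: eventually_mono)
qed

lemma asymptotic_radius_nonneg:
  assumes "\<And>n. x n \<in> V" "u \<in> V" "\<And>n. nrm (x n) \<le> B"
  shows "0 \<le> asymptotic_radius x u"
proof (rule ccontr)
  assume "\<not> ?thesis"
  then have "\<forall>\<^sub>F n in sequentially. nrm (x n - u) \<le> asymptotic_radius x u / 2"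
    using assms by (intro asymptotic_radius_less_imp[of _ _ B]) auto
  then obtain n where "nrm (x n - u) \<le> asymptotic_radius x u / 2" by (auto dest: eventually_happens)
  with \<open>\<not> ?thesis\<close> show False using assms nrm_nonneg[of "x n - u"] by fastforce
qed

lemma asymptotic_radius_eq_lim:
  assumes x: "\<And>n. x n \<in> V" "u \<in> V" "\<And>n. nrm (x n) \<le> B" and lim: "(\<lambda>n. nrm (x n - u)) \<longlonglongrightarrow> l"
  shows "asymptotic_radius x u = l"
proof (rule antisym)
  show "asymptotic_radius x u \<le> l"
  proof (rule field_le_epsilon)
    fix e :: real assume "0 < e"
    then have "\<forall>\<^sub>F n in sequentially. nrm (x n - u) < l + e"
      by (intro order_tendstoD(2)[OF lim]) simp
    then show "asymptotic_radius x u \<le> l + e"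
      using x by (intro asymptotic_radius_le) (auto elim: eventually_mono)
  qed
  show "l \<le> asymptotic_radius x u"
  proof (rule field_le_epsilon)
    fix e :: real assume "0 < e"
    then have "\<forall>\<^sub>F n in sequentially. nrm (x n - u) \<le> asymptotic_radius x u + e"
      using x by (intro asymptotic_radius_less_imp[of _ _ B]) auto
    then show "l \<le> asymptotic_radius x u + e"
      using lim by (intro tendsto_upperbound[OF lim]) auto
  qed
qed

lemma asymptotic_radius_shift:
  assumes "\<And>n. x n \<in> V" "u \<in> V" "v \<in> V" "\<And>n. nrm (x n) \<le> B"
  shows "asymptotic_radius x v \<le> asymptotic_radius x u + nrm (u - v)"
proof (rule field_le_epsilon)
  fix e :: real assume "0 < e"
  then have "\<forall>\<^sub>F n in sequentially. nrm (x n - u) \<le> asymptotic_radius x u + e"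
    using assms by (intro asymptotic_radius_less_imp[of _ _ B]) auto
  then have "\<forall>\<^sub>F n in sequentially. nrm (x n - v) \<le> asymptotic_radius x u + nrm (u - v) + e"
  proof (rule eventually_mono)
    fix n assume "nrm (x n - u) \<le> asymptotic_radius x u + e"
    then show "nrm (x n - v) \<le> asymptotic_radius x u + nrm (u - v) + e"
      using nrm_triangle_via[of "x n" v u] assms by fastforce
  qed
  then show "asymptotic_radius x v \<le> asymptotic_radius x u + nrm (u - v) + e"
    using assms by (intro asymptotic_radius_le) auto
qed

end

locale semi_hilbert_space = semi_inner_space V ip for V :: "'v::real_vector set" and ip +
  assumes complete: "(\<And>n. xs n \<in> V) \<Longrightarrow>
    (\<And>e. 0 < e \<Longrightarrow> \<exists>n0. \<forall>k\<ge>n0. \<forall>n\<ge>n0. norm_of ip (xs k - xs n) < e) \<Longrightarrow>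
    \<exists>x\<in>V. (\<lambda>n. norm_of ip (xs n - x)) \<longlonglongrightarrow> 0"
begin

text \<open>
  By the parallelogram law the asymptotic radius at a midpoint is smaller than at the end points by an
  amount governed by their distance, so a minimizing sequence is a Cauchy sequence.
\<close>

lemma asymptotic_center_exists:
  assumes C: "norm_closed C" "convex C" "C \<noteq> {}"
    and x: "\<And>n. x n \<in> V" "\<And>n. nrm (x n) \<le> B"
  shows "\<exists>c\<in>C. \<forall>u\<in>C. asymptotic_radius x c \<le> asymptotic_radius x u"
proof -
  let ?R = "asymptotic_radius x"
  have CV: "u \<in> V" if "u \<in> C" for u using C(1) that by (auto simp: norm_closed_def)
  have R0: "0 \<le> ?R u" if "u \<in> C" for u using asymptotic_radius_nonneg[OF x(1) CV[OF that] x(2)] .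
  define \<rho> where "\<rho> = Inf (?R ` C)"
  have bdd: "bdd_below (?R ` C)" using R0 by (auto intro!: bdd_belowI[of _ 0])
  have \<rho>_le: "\<rho> \<le> ?R u" if "u \<in> C" for u
    unfolding \<rho>_def using bdd that by (auto intro: cInf_lower)
  have \<rho>0: "0 \<le> \<rho>" unfolding \<rho>_def using C(3) R0 by (auto intro: cInf_greatest)
  have "\<exists>u\<in>C. ?R u < \<rho> + 1 / real (Suc k)" for k
    using cInf_lessD[of "?R ` C" "\<rho> + 1 / real (Suc k)"] C(3) unfolding \<rho>_def by auto
  then obtain u where u: "\<And>k. u k \<in> C" "\<And>k. ?R (u k) < \<rho> + 1 / real (Suc k)" by metis
  \<comment> \<open>points of almost minimal radius are close to each other, since their midpoint has radius at least \<open>\<rho>\<close>\<close>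
  have close: "(nrm (v - w))\<^sup>2 \<le> 4 * (r\<^sup>2 - \<rho>\<^sup>2)" if v: "v \<in> C" "?R v < r" and w: "w \<in> C" "?R w < r" for v w r
  proof -
    define mid where "mid = (1/2) *\<^sub>R v + (1/2) *\<^sub>R w"
    define q where "q = r\<^sup>2 - (nrm (v - w))\<^sup>2 / 4"
    have mid: "mid \<in> C" unfolding mid_def using C(2) v w by (intro convexD) auto
    have "\<forall>\<^sub>F n in sequentially. nrm (x n - v) \<le> r" "\<forall>\<^sub>F n in sequentially. nrm (x n - w) \<le> r"
      using v w x CV by (auto intro!: asymptotic_radius_less_imp[of _ _ B])
    then have ev: "\<forall>\<^sub>F n in sequentially. (nrm (x n - mid))\<^sup>2 \<le> q"
    proof eventually_elim
      case (elim n)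
      have xn: "x n \<in> V" using x by auto
      have "(nrm (x n - v))\<^sup>2 \<le> r\<^sup>2" "(nrm (x n - w))\<^sup>2 \<le> r\<^sup>2"
        using elim xn CV v w by (auto intro!: power_mono)
      then show ?case
        unfolding mid_def q_def using nrm2_midpoint[OF xn CV[OF v(1)] CV[OF w(1)]] by simp
    qed
    then have "0 \<le> q" by (auto dest!: eventually_happens intro: order.trans[OF zero_le_power2])
    have "\<forall>\<^sub>F n in sequentially. nrm (x n - mid) \<le> sqrt q"
      using ev by eventually_elim (auto intro: real_le_rsqrt)
    then have "?R mid \<le> sqrt q" using x CV[OF mid] by (intro asymptotic_radius_le)
    with \<rho>_le[OF mid] have "\<rho> \<le> sqrt q" by simp
    with \<rho>0 have "\<rho>\<^sup>2 \<le> (sqrt q)\<^sup>2" by (intro power_mono)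
    with \<open>0 \<le> q\<close> show ?thesis by (simp add: q_def)
  qed
  have "\<exists>c\<in>V. (\<lambda>n. nrm (u n - c)) \<longlonglongrightarrow> 0"
  proof (rule complete)
    show "u n \<in> V" for n using u CV by auto
    fix e :: real assume e: "0 < e"
    have "(\<lambda>k. 4 * ((\<rho> + 1 / real (Suc k))\<^sup>2 - \<rho>\<^sup>2)) \<longlonglongrightarrow> 4 * ((\<rho> + 0)\<^sup>2 - \<rho>\<^sup>2)"
      by (intro tendsto_intros LIMSEQ_Suc lim_1_over_n)
    then have "(\<lambda>k. 4 * ((\<rho> + 1 / real (Suc k))\<^sup>2 - \<rho>\<^sup>2)) \<longlonglongrightarrow> 0" by simp
    then have "\<forall>\<^sub>F k in sequentially. 4 * ((\<rho> + 1 / real (Suc k))\<^sup>2 - \<rho>\<^sup>2) < e\<^sup>2"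
      using e by (intro order_tendstoD(2)) auto
    then obtain n0 where n0: "4 * ((\<rho> + 1 / real (Suc n0))\<^sup>2 - \<rho>\<^sup>2) < e\<^sup>2"
      by (auto dest: eventually_happens)
    show "\<exists>n0. \<forall>k\<ge>n0. \<forall>n\<ge>n0. nrm (u k - u n) < e"
    proof (intro exI[of _ n0] allI impI)
      fix k n assume kn: "n0 \<le> k" "n0 \<le> n"
      have "?R (u j) < \<rho> + 1 / real (Suc n0)" if "n0 \<le> j" for j
      proof -
        have "1 / real (Suc j) \<le> 1 / real (Suc n0)" using that by (simp add: frac_le)
        then show ?thesis using u(2)[of j] by linarith
      qed
      then have "(nrm (u k - u n))\<^sup>2 \<le> 4 * ((\<rho> + 1 / real (Suc n0))\<^sup>2 - \<rho>\<^sup>2)"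
        using kn by (intro close u(1))
      then have "(nrm (u k - u n))\<^sup>2 < e\<^sup>2" using n0 by simp
      then show "nrm (u k - u n) < e" using e by (auto intro: power2_less_imp_less)
    qed
  qed
  then obtain c where c: "c \<in> V" "(\<lambda>n. nrm (u n - c)) \<longlonglongrightarrow> 0" by blast
  then have cC: "c \<in> C" using C(1) u(1) unfolding norm_closed_def by blast
  have "?R c \<le> \<rho>"
  proof (rule tendsto_lowerbound)
    have "(\<lambda>k. \<rho> + 1 / real (Suc k) + nrm (u k - c)) \<longlonglongrightarrow> \<rho> + 0 + 0"
      by (intro tendsto_add tendsto_const LIMSEQ_Suc lim_1_over_n c)
    then show "(\<lambda>k. \<rho> + 1 / real (Suc k) + nrm (u k - c)) \<longlonglongrightarrow> \<rho>" by simp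
    have "?R c \<le> \<rho> + 1 / real (Suc k) + nrm (u k - c)" for k
      using asymptotic_radius_shift[of x "u k" c B] x CV[OF u(1)[of k]] c(1) u(2)[of k] by simp
    then show "\<forall>\<^sub>F k in sequentially. ?R c \<le> \<rho> + 1 / real (Suc k) + nrm (u k - c)" by simp
  qed simp
  with cC \<rho>_le show ?thesis by (meson order.trans)
qed

text \<open>
  The projection is the asymptotic center of a constant sequence. The inequality is the Pythagorean
  form of the obtuse angle condition.
\<close>

lemma projection_exists:
  assumes C: "norm_closed C" "convex C" "C \<noteq> {}" and c: "c \<in> V"
  shows "\<exists>q\<in>C. \<forall>w\<in>C. (nrm (w - q))\<^sup>2 + (nrm (q - c))\<^sup>2 \<le> (nrm (w - c))\<^sup>2"
proof -
  have CV: "u \<in> V" if "u \<in> C" for u using C(1) that by (auto simp: norm_closed_def)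
  obtain q where q: "q \<in> C" "\<And>u. u \<in> C \<Longrightarrow> asymptotic_radius (\<lambda>_. c) q \<le> asymptotic_radius (\<lambda>_. c) u"
    using asymptotic_center_exists[OF C, of "\<lambda>_. c" "nrm c"] c by auto
  have R: "asymptotic_radius (\<lambda>_. c) u = nrm (c - u)" if "u \<in> C" for u
    using asymptotic_radius_eq_lim[of "\<lambda>_. c" u "nrm c" "nrm (c - u)"] c CV[OF that] by simp
  show ?thesis
  proof (intro bexI[OF _ q(1)] ballI)
    fix w assume w: "w \<in> C"
    have V: "w \<in> V" "q \<in> V" "c \<in> V" using w q c CV by auto
    have "0 \<le> 2 * ip (q - c) (w - q)"
    proof (rule nonneg_of_quadratic)
      fix t :: real assume t: "0 < t" "t < 1"
      have "(1 - t) *\<^sub>R q + t *\<^sub>R w \<in> C" using C(2) q w t by (intro convexD) auto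
      moreover have "(1 - t) *\<^sub>R q + t *\<^sub>R w = q + t *\<^sub>R (w - q)" by (simp add: algebra_simps)
      ultimately have "q + t *\<^sub>R (w - q) \<in> C" by simp
      then have "nrm (c - q) \<le> nrm (c - (q + t *\<^sub>R (w - q)))"
        using q by (simp add: R)
      moreover have "nrm (c - (q + t *\<^sub>R (w - q))) = nrm (q + t *\<^sub>R (w - q) - c)"
        using V by (intro nrm_minus_commute) auto
      moreover have "q + t *\<^sub>R (w - q) - c = q - c + t *\<^sub>R (w - q)" by simp
      ultimately have "nrm (q - c) \<le> nrm (q - c + t *\<^sub>R (w - q))"
        using V nrm_minus_commute[of c q] by simp
      then have "(nrm (q - c))\<^sup>2 \<le> (nrm (q - c + t *\<^sub>R (w - q)))\<^sup>2" using V by (intro power_mono) auto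
      then show "0 \<le> t * (2 * ip (q - c) (w - q)) + t\<^sup>2 * (nrm (w - q))\<^sup>2"
        using V by (subst (asm) nrm2_add) (auto simp: nrm_scale scale_right power_mult_distrib)
    qed
    then show "(nrm (w - q))\<^sup>2 + (nrm (q - c))\<^sup>2 \<le> (nrm (w - c))\<^sup>2"
      using nrm2_add[of "q - c" "w - q"] V by simp
  qed
qed

text \<open>
  Projecting the center onto the set moves it closer to all points of the set, which the sequence
  approaches; this does not increase the asymptotic radius, and decreases it strictly unless the
  projection is at distance zero.
\<close>

lemma asymptotic_center_mem:
  assumes C: "norm_closed C" "convex C" and x: "\<And>n. x n \<in> V" "\<And>n. nrm (x n) \<le> B"
    and y: "\<And>n. y n \<in> V" "\<forall>\<^sub>F n in sequentially. y n \<in> C" "(\<lambda>n. nrm (x n - y n)) \<longlonglongrightarrow> 0"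
    and c: "c \<in> V" "\<And>u. u \<in> V \<Longrightarrow> asymptotic_radius x c \<le> asymptotic_radius x u"
  shows "c \<in> C"
proof -
  let ?R = "asymptotic_radius x"
  have xV [simp]: "x n \<in> V" and yV [simp]: "y n \<in> V" for n using x y by auto
  have CV: "u \<in> V" if "u \<in> C" for u using C(1) that by (auto simp: norm_closed_def)
  have "C \<noteq> {}" using y(2) by (auto dest: eventually_happens)
  then obtain q where q: "q \<in> C" "\<And>w. w \<in> C \<Longrightarrow> (nrm (w - q))\<^sup>2 + (nrm (q - c))\<^sup>2 \<le> (nrm (w - c))\<^sup>2"
    using projection_exists[OF C _ c(1)] by blast
  note qV = CV[OF q(1)]
  have Rc: "0 \<le> ?R c" using asymptotic_radius_nonneg[OF x(1) c(1) x(2)] .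
  have *: "(?R q)\<^sup>2 + (nrm (q - c))\<^sup>2 \<le> (?R c + e)\<^sup>2" if e: "0 < e" for e
  proof -
    have "\<forall>\<^sub>F n in sequentially. nrm (x n - c) \<le> ?R c + e / 3"
      using asymptotic_radius_less_imp[OF x(1) c(1) x(2)] e by simp
    moreover have "\<forall>\<^sub>F n in sequentially. nrm (x n - y n) < e / 3"
      using y(3) e by (intro order_tendstoD(2)) auto
    ultimately have "\<forall>\<^sub>F n in sequentially. nrm (x n - q) \<le> sqrt ((?R c + 2 * e / 3)\<^sup>2 - (nrm (q - c))\<^sup>2) + e / 3
       \<and> (nrm (q - c))\<^sup>2 \<le> (?R c + 2 * e / 3)\<^sup>2"
      using y(2)
    proof eventually_elim
      case (elim n)
      have "nrm (y n - c) \<le> ?R c + 2 * e / 3"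
        using nrm_triangle_via[of "y n" c "x n"] elim c nrm_minus_commute[of "x n" "y n"] by simp
      then have "(nrm (y n - c))\<^sup>2 \<le> (?R c + 2 * e / 3)\<^sup>2" using c by (intro power_mono) auto
      with q(2)[OF elim(3)] have *: "(nrm (y n - q))\<^sup>2 \<le> (?R c + 2 * e / 3)\<^sup>2 - (nrm (q - c))\<^sup>2" by simp
      then have "nrm (y n - q) \<le> sqrt ((?R c + 2 * e / 3)\<^sup>2 - (nrm (q - c))\<^sup>2)" by (rule real_le_rsqrt)
      moreover have "nrm (x n - q) \<le> nrm (x n - y n) + nrm (y n - q)"
        using qV by (intro nrm_triangle_via) auto
      moreover have "0 \<le> (nrm (y n - q))\<^sup>2" by simp
      ultimately show ?case using * elim(2) by (intro conjI) linarith+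
    qed
    then have le: "?R q \<le> sqrt ((?R c + 2 * e / 3)\<^sup>2 - (nrm (q - c))\<^sup>2) + e / 3"
      and n: "(nrm (q - c))\<^sup>2 \<le> (?R c + 2 * e / 3)\<^sup>2"
      using asymptotic_radius_le[OF x(1) qV] by (auto simp: eventually_conj_iff)
    let ?s = "sqrt ((?R c + 2 * e / 3)\<^sup>2 - (nrm (q - c))\<^sup>2)"
    have s: "0 \<le> ?s" "?s \<le> ?R c + 2 * e / 3"
      using n Rc e by (auto intro!: real_le_lsqrt)
    have "(?R q)\<^sup>2 \<le> (?s + e / 3)\<^sup>2"
      using le asymptotic_radius_nonneg[OF x(1) qV x(2)] by (intro power_mono)
    also have "\<dots> = ?s\<^sup>2 + 2 * (e / 3) * ?s + (e / 3)\<^sup>2" by (simp add: power2_sum)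
    also have "\<dots> \<le> ?s\<^sup>2 + 2 * (e / 3) * (?R c + 2 * e / 3) + (e / 3)\<^sup>2"
      using s e by (intro add_mono mult_left_mono) auto
    also have "?s\<^sup>2 = (?R c + 2 * e / 3)\<^sup>2 - (nrm (q - c))\<^sup>2" using n by simp
    finally show ?thesis by (simp add: power2_eq_square field_simps)
  qed
  have "(?R q)\<^sup>2 + (nrm (q - c))\<^sup>2 \<le> (?R c)\<^sup>2"
  proof (rule tendsto_lowerbound)
    show "((\<lambda>e. (?R c + e)\<^sup>2) \<longlongrightarrow> (?R c)\<^sup>2) (at_right 0)" by (auto intro!: tendsto_eq_intros)
    show "\<forall>\<^sub>F e in at_right 0. (?R q)\<^sup>2 + (nrm (q - c))\<^sup>2 \<le> (?R c + e)\<^sup>2"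
      using * by (auto intro!: eventually_at_rightI[of 0 1])
  qed simp
  moreover have "(?R c)\<^sup>2 \<le> (?R q)\<^sup>2" using c(2)[OF qV] Rc by (intro power_mono)
  ultimately have "(nrm (q - c))\<^sup>2 \<le> 0" by linarith
  then have "(\<lambda>n::nat. nrm (q - c)) \<longlonglongrightarrow> 0" by simp
  then show "c \<in> C" using C(1) c(1) q(1) unfolding norm_closed_def
    by (auto dest!: spec[of _ "\<lambda>_. q"])
qed

text \<open>
  If \<open>ip (x n - c) y\<close> stays above some \<open>d > 0\<close> along a subsequence, a small
  step from \<open>c\<close> in the direction \<open>y\<close> gives a point with smaller asymptotic
  radius for that subsequence.
\<close>

lemma weakly_converges_if_center:
  assumes x: "\<And>n. x n \<in> V" "\<And>n. nrm (x n) \<le> B" and c: "c \<in> V" "(\<lambda>n. nrm (x n - c)) \<longlonglongrightarrow> l"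
    and center: "\<And>r u. strict_mono r \<Longrightarrow> u \<in> V \<Longrightarrow> l \<le> asymptotic_radius (x \<circ> r) u"
  shows "weakly_converges V ip x c"
proof -
  have xV [simp]: "x n \<in> V" for n using x by auto
  have l: "0 \<le> l" using c by (auto intro: tendsto_lowerbound[OF c(2)])
  have no: False if y: "y \<in> V" and d: "0 < d" and inf: "\<exists>\<^sub>\<infinity>n. d \<le> ip (x n - c) y" for y d
  proof -
    define r where "r = enumerate {n. d \<le> ip (x n - c) y}"
    have infs: "infinite {n. d \<le> ip (x n - c) y}" using inf by (simp add: INFM_iff_infinite)
    have r: "strict_mono r" unfolding r_def using strict_mono_enumerate[OF infs] .
    have rd: "d \<le> ip (x (r n) - c) y" for n
      using enumerate_in_set[OF infs, of n] by (simp add: r_def)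
    \<comment> \<open>small enough for the quadratic term to be at most half of the gain \<open>2 t d\<close>\<close>
    define t where "t = d / ((nrm y)\<^sup>2 + 1)"
    have pos: "0 < (nrm y)\<^sup>2 + 1" by (simp add: add_nonneg_pos)
    have t: "0 < t" using d pos by (simp add: t_def)
    have "t * (nrm y)\<^sup>2 \<le> d" using d pos by (simp add: t_def field_simps)
    then have t2: "t\<^sup>2 * (nrm y)\<^sup>2 \<le> t * d" using t by (simp add: power2_eq_square mult.assoc mult_left_mono)
    have lim: "(\<lambda>n. sqrt ((nrm (x (r n) - c))\<^sup>2 - t * d)) \<longlonglongrightarrow> sqrt (l\<^sup>2 - t * d)"
      using LIMSEQ_subseq_LIMSEQ[OF c(2) r] by (intro tendsto_intros) (simp add: comp_def)
    have est: "(nrm (x (r n) - (c + t *\<^sub>R y)))\<^sup>2 \<le> (nrm (x (r n) - c))\<^sup>2 - t * d" for n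
    proof -
      have "(nrm (x (r n) - (c + t *\<^sub>R y)))\<^sup>2 = (nrm ((x (r n) - c) - t *\<^sub>R y))\<^sup>2" by (simp add: algebra_simps)
      also have "\<dots> = (nrm (x (r n) - c))\<^sup>2 - 2 * t * ip (x (r n) - c) y + t\<^sup>2 * (nrm y)\<^sup>2"
        using y c by (subst nrm2_diff) (auto simp: nrm_scale scale_right power_mult_distrib)
      also have "\<dots> \<le> (nrm (x (r n) - c))\<^sup>2 - 2 * t * d + t * d"
        using t by (intro add_mono diff_mono mult_left_mono rd t2) auto
      finally show ?thesis by (simp add: mult.commute)
    qed
    have est2: "nrm (x (r n) - (c + t *\<^sub>R y)) \<le> sqrt ((nrm (x (r n) - c))\<^sup>2 - t * d)" for n
      by (rule real_le_rsqrt[OF est])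
    have "0 \<le> (nrm (x (r n) - c))\<^sup>2 - t * d" for n
      using est[of n] by (rule order.trans[OF zero_le_power2])
    moreover have "(\<lambda>n. (nrm (x (r n) - c))\<^sup>2 - t * d) \<longlonglongrightarrow> l\<^sup>2 - t * d"
      using LIMSEQ_subseq_LIMSEQ[OF c(2) r] by (intro tendsto_intros) (simp add: comp_def)
    ultimately have nn: "0 \<le> l\<^sup>2 - t * d" by (intro LIMSEQ_le_const) auto
    have "sqrt (l\<^sup>2 - t * d) < sqrt (l\<^sup>2)" using t d by (intro real_sqrt_less_mono) simp
    then have "sqrt (l\<^sup>2 - t * d) < l" using l by simp
    then obtain m where m: "sqrt (l\<^sup>2 - t * d) < m" "m < l" using dense by blast
    have "\<forall>\<^sub>F n in sequentially. nrm ((x \<circ> r) n - (c + t *\<^sub>R y)) \<le> m"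
      using order_tendstoD(2)[OF lim m(1)]
      by eventually_elim (use est2 in \<open>auto intro: order.trans less_imp_le\<close>)
    then have "asymptotic_radius (x \<circ> r) (c + t *\<^sub>R y) \<le> m"
      using x c y by (intro asymptotic_radius_le) auto
    with center[OF r, of "c + t *\<^sub>R y"] m c y show False by simp
  qed
  have "(\<lambda>n. ip (x n) y) \<longlonglongrightarrow> ip c y" if y: "y \<in> V" for y
  proof -
    have "(\<lambda>n. ip (x n - c) y) \<longlonglongrightarrow> 0"
    proof (rule ccontr)
      assume "\<not> ?thesis"
      then obtain d where d: "0 < d" "\<exists>\<^sub>F n in sequentially. d \<le> \<bar>ip (x n - c) y\<bar>"
        by (auto simp: tendsto_iff not_eventually not_less)
      then have "\<exists>\<^sub>\<infinity>n. d \<le> ip (x n - c) y \<or> d \<le> ip (x n - c) (- y)"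
        using y c by (auto simp: cofinite_eq_sequentially minus_right abs_if split: if_splits elim!: frequently_elim1)
      then consider "\<exists>\<^sub>\<infinity>n. d \<le> ip (x n - c) y" | "\<exists>\<^sub>\<infinity>n. d \<le> ip (x n - c) (- y)"
        by (auto simp: frequently_disj_iff)
      then show False using no[OF y d(1)] no[OF minus_mem[OF y] d(1)] by cases auto
    qed
    then have "(\<lambda>n. ip (x n - c) y + ip c y) \<longlonglongrightarrow> 0 + ip c y" by (intro tendsto_intros)
    then show ?thesis using c y by (simp add: diff_left)
  qed
  then show ?thesis by (simp add: weakly_converges_def)
qed

text \<open>
  A form of the lemma of Opial. The centers of the sequence and of a subsequence both lie in all the
  sets, so the distances to them converge along the full sequence; comparing the two limits shows that
  the center of the sequence is also a center of the subsequence.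
\<close>

lemma weak_limit_in_closed_convex_sets:
  assumes x: "\<And>n. x n \<in> V"
    and C: "\<And>C. C \<in> \<C> \<Longrightarrow> norm_closed C" "\<And>C. C \<in> \<C> \<Longrightarrow> convex C"
    and y: "\<And>n. y n \<in> V" "\<And>C. C \<in> \<C> \<Longrightarrow> \<forall>\<^sub>F n in sequentially. y n \<in> C" "(\<lambda>n. nrm (x n - y n)) \<longlonglongrightarrow> 0"
    and conv: "\<And>s. s \<in> V \<Longrightarrow> (\<And>C. C \<in> \<C> \<Longrightarrow> s \<in> C) \<Longrightarrow> convergent (\<lambda>n. nrm (x n - s))"
    and s: "s \<in> V" "\<And>C. C \<in> \<C> \<Longrightarrow> s \<in> C"
  shows "\<exists>c\<in>V. (\<forall>C\<in>\<C>. c \<in> C) \<and> weakly_converges V ip x c"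
proof -
  have xV [simp]: "x n \<in> V" for n using x by auto
  obtain M where M: "\<And>n. \<bar>nrm (x n - s)\<bar> \<le> M"
    using convergent_imp_Bseq[OF conv[OF s]] by (auto simp: Bseq_def)
  have B: "nrm (x n) \<le> M + nrm s" for n
    using nrm_triangle[of "x n - s" s] M[of n] s by simp
  have center: "\<exists>c\<in>V. (\<forall>C\<in>\<C>. c \<in> C) \<and> (\<forall>u\<in>V. asymptotic_radius (x \<circ> r) c \<le> asymptotic_radius (x \<circ> r) u)"
    if r: "strict_mono r" for r
  proof -
    have xr: "\<And>n. (x \<circ> r) n \<in> V" "\<And>n. nrm ((x \<circ> r) n) \<le> M + nrm s" using x B by auto
    have "norm_closed V" "convex V" "V \<noteq> {}"
      using subspace_imp_convex[OF subspace] zero_mem by (simp add: norm_closed_def, blast, blast)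
    from asymptotic_center_exists[OF this, of "x \<circ> r"] xr
    obtain c where c: "c \<in> V" "\<And>u. u \<in> V \<Longrightarrow> asymptotic_radius (x \<circ> r) c \<le> asymptotic_radius (x \<circ> r) u"
      by blast
    have "c \<in> C" if "C \<in> \<C>" for C
    proof (rule asymptotic_center_mem[OF C(1)[OF that] C(2)[OF that] xr _ _ _ c])
      show "(y \<circ> r) n \<in> V" for n using y(1) by auto
      show "\<forall>\<^sub>F n in sequentially. (y \<circ> r) n \<in> C"
        using eventually_subseq[OF r y(2)[OF that]] by simp
      show "(\<lambda>n. nrm ((x \<circ> r) n - (y \<circ> r) n)) \<longlonglongrightarrow> 0"
        using LIMSEQ_subseq_LIMSEQ[OF y(3) r] by (simp add: comp_def)
    qed
    with c show ?thesis by blast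
  qed
  obtain c where c: "c \<in> V" "\<And>C. C \<in> \<C> \<Longrightarrow> c \<in> C"
      "\<And>u. u \<in> V \<Longrightarrow> asymptotic_radius x c \<le> asymptotic_radius x u"
    using center[of id] by (auto simp: strict_mono_def)
  obtain l where l: "(\<lambda>n. nrm (x n - c)) \<longlonglongrightarrow> l"
    using conv[OF c(1,2)] by (auto simp: convergent_def)
  have "weakly_converges V ip x c"
  proof (rule weakly_converges_if_center[OF x B c(1) l])
    fix r :: "nat \<Rightarrow> nat" and u assume r: "strict_mono r" and u: "u \<in> V"
    obtain d where d: "d \<in> V" "\<And>C. C \<in> \<C> \<Longrightarrow> d \<in> C"
        "\<And>u. u \<in> V \<Longrightarrow> asymptotic_radius (x \<circ> r) d \<le> asymptotic_radius (x \<circ> r) u"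
      using center[OF r] by blast
    obtain l' where l': "(\<lambda>n. nrm (x n - d)) \<longlonglongrightarrow> l'"
      using conv[OF d(1,2)] by (auto simp: convergent_def)
    have "l = asymptotic_radius x c" using asymptotic_radius_eq_lim[OF x c(1) B l] ..
    also have "\<dots> \<le> asymptotic_radius x d" using c(3) d(1) .
    also have "\<dots> = l'" using asymptotic_radius_eq_lim[OF x d(1) B l'] .
    also have "\<dots> = asymptotic_radius (x \<circ> r) d"
      using asymptotic_radius_eq_lim[of "x \<circ> r" d "M + nrm s" l'] x B d(1) LIMSEQ_subseq_LIMSEQ[OF l' r]
      by (auto simp: comp_def)
    also have "\<dots> \<le> asymptotic_radius (x \<circ> r) u" using d(3) u .
    finally show "l \<le> asymptotic_radius (x \<circ> r) u" .
  qed
  with c show ?thesis by blast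
qed

end

section \<open>Countably subadditive seminorms\<close>

context semi_hilbert_space begin

text \<open>
  This is a theorem of Zabreiko. By the Baire argument, written out with nested balls, some set
  \<open>{q \<le> N}\<close> is dense in a ball, by symmetry and convexity in a ball around 0, and by
  scaling in all smaller balls with smaller constants. Any small vector is then approximated
  successively by a series with \<open>q\<close>-values bounded by a geometric sequence, and countable
  subadditivity bounds \<open>q\<close> at its limit.
\<close>

lemma countably_subadditive_seminorm_bounded:
  fixes q :: "'v \<Rightarrow> real"
  assumes q_nonneg: "\<And>x. x \<in> V \<Longrightarrow> 0 \<le> q x"
    and q_add: "\<And>x y. x \<in> V \<Longrightarrow> y \<in> V \<Longrightarrow> q (x + y) \<le> q x + q y"
    and q_scale: "\<And>c x. x \<in> V \<Longrightarrow> q (c *\<^sub>R x) = \<bar>c\<bar> * q x"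
    and q_series: "\<And>u x. (\<And>k. u k \<in> V) \<Longrightarrow> x \<in> V \<Longrightarrow> summable (\<lambda>k. nrm (u k)) \<Longrightarrow>
      summable (\<lambda>k. q (u k)) \<Longrightarrow> (\<lambda>n. nrm (x - (\<Sum>k<n. u k))) \<longlonglongrightarrow> 0 \<Longrightarrow> q x \<le> (\<Sum>k. q (u k))"
  shows "\<exists>C\<ge>0. \<forall>x\<in>V. q x \<le> C * nrm x"
proof -
  have "\<exists>N::nat. \<exists>a\<in>V. \<exists>r>0. \<forall>x\<in>V. nrm (x - a) < r \<longrightarrow> (\<forall>e>0. \<exists>u\<in>V. q u \<le> real N \<and> nrm (x - u) < e)"
  proof (rule ccontr)
    assume neg: "\<not> ?thesis"
    \<comment> \<open>otherwise choose nested balls such that \<open>q > n\<close> on the ball with index \<open>n + 1\<close>; their common point contradicts the finiteness of \<open>q\<close>\<close>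
    define P where "P = (\<lambda>(n::nat) (a, r::real). a \<in> V \<and> 0 < r)"
    define Q where "Q = (\<lambda>(n::nat) (a, r::real) (a', r'::real). r' \<le> r / 2 \<and>
      (\<forall>u\<in>V. nrm (u - a') \<le> r' \<longrightarrow> nrm (u - a) \<le> r \<and> real n < q u))"
    have "\<exists>g. \<forall>n. P n (g n) \<and> Q n (g n) (g (Suc n))"
    proof (rule dependent_nat_choice)
      show "\<exists>s. P 0 s" by (intro exI[of _ "(0, 1)"]) (simp add: P_def)
      fix s and n :: nat assume "P n s"
      then obtain a r where s: "s = (a, r)" and a: "a \<in> V" and r: "0 < r" by (cases s) (auto simp: P_def)
      have "\<exists>x\<in>V. nrm (x - a) < r \<and> \<not> (\<forall>e>0. \<exists>u\<in>V. q u \<le> real n \<and> nrm (x - u) < e)"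
        using neg a r by blast
      then obtain x e where x: "x \<in> V" "nrm (x - a) < r" and e: "0 < e"
          "\<And>u. u \<in> V \<Longrightarrow> q u \<le> real n \<Longrightarrow> e \<le> nrm (x - u)"
        by (auto simp: not_less)
      define r' where "r' = min (r / 2) (min (e / 2) (r - nrm (x - a)))"
      have "P (Suc n) (x, r')" using x r e by (simp add: P_def r'_def)
      moreover have "Q n s (x, r')"
        unfolding Q_def s prod.case
      proof (intro conjI ballI impI)
        show "r' \<le> r / 2" unfolding r'_def by (rule min.cobounded1)
        fix u assume u: "u \<in> V" "nrm (u - x) \<le> r'"
        show "nrm (u - a) \<le> r" using nrm_triangle_via[OF u(1) a x(1)] u(2) by (simp add: r'_def)
        have "nrm (x - u) < e" using u nrm_minus_commute[OF u(1) x(1)] e(1) by (simp add: r'_def)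
        then show "real n < q u" using e(2)[OF u(1)] by fastforce
      qed
      ultimately show "\<exists>s'. P (Suc n) s' \<and> Q n s s'" by blast
    qed
    then obtain g where g: "\<And>n. P n (g n)" "\<And>n. Q n (g n) (g (Suc n))" by blast
    define a where "a n = fst (g n)" for n
    define r where "r n = snd (g n)" for n
    have aV [simp]: "a n \<in> V" and rpos: "0 < r n" for n using g(1)[of n] by (auto simp: P_def a_def r_def split: prod.splits)
    have Qn: "Q n (a n, r n) (a (Suc n), r (Suc n))" for n
      using g(2)[of n] by (simp add: a_def r_def)
    have half: "r (Suc n) \<le> r n / 2" for n
      using Qn[of n] unfolding Q_def prod.case by blast
    have nest: "nrm (u - a n) \<le> r n \<and> real n < q u" if "u \<in> V" "nrm (u - a (Suc n)) \<le> r (Suc n)" for u n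
      using Qn[of n] that unfolding Q_def prod.case by blast
    have nest_le: "nrm (u - a n) \<le> r n" if "u \<in> V" "nrm (u - a k) \<le> r k" "n \<le> k" for u n k
      using that(3,2)
    proof (induction rule: dec_induct)
      case (step k)
      with nest[OF that(1) step.prems] show ?case by blast
    qed
    have ball: "nrm (a k - a n) \<le> r n" if "n \<le> k" for n k
      using nest_le[of "a k" k n] that rpos[of k] by simp
    have r_le: "r n \<le> r 0 * (1/2) ^ n" for n
    proof (induction n)
      case (Suc n)
      then show ?case using half[of n] by simp
    qed simp
    have "(\<lambda>n. r 0 * (1/2) ^ n) \<longlonglongrightarrow> r 0 * 0" by (intro tendsto_intros LIMSEQ_power_zero) simp
    then have r0: "r \<longlonglongrightarrow> 0"
      using r_le rpos by (intro tendsto_sandwich[of "\<lambda>_. 0" r sequentially "\<lambda>n. r 0 * (1/2) ^ n"]) (auto intro!: always_eventually less_imp_le)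
    obtain c where c: "c \<in> V" "(\<lambda>n. nrm (a n - c)) \<longlonglongrightarrow> 0"
    proof -
      have "\<exists>c\<in>V. (\<lambda>n. nrm (a n - c)) \<longlonglongrightarrow> 0"
      proof (rule complete)
        fix e :: real assume "0 < e"
        then have "\<forall>\<^sub>F n in sequentially. r n < e / 2" by (intro order_tendstoD(2)[OF r0]) simp
        then obtain n0 where n0: "r n0 < e / 2" by (auto dest: eventually_happens)
        show "\<exists>n0. \<forall>k\<ge>n0. \<forall>n\<ge>n0. nrm (a k - a n) < e"
        proof (intro exI allI impI)
          fix k n assume "n0 \<le> k" "n0 \<le> n"
          then show "nrm (a k - a n) < e"
            using nrm_triangle_via[of "a k" "a n" "a n0"] ball[of n0 k] ball[of n0 n] n0
              nrm_minus_commute[of "a n" "a n0"] by simp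
        qed
      qed simp
      then show ?thesis using that by blast
    qed
    have in_ball: "nrm (c - a n) \<le> r n" for n
    proof (rule tendsto_lowerbound)
      show "(\<lambda>k. nrm (a k - c) + r n) \<longlonglongrightarrow> r n" using tendsto_add[OF c(2) tendsto_const[of "r n"]] by simp
      show "\<forall>\<^sub>F k in sequentially. nrm (c - a n) \<le> nrm (a k - c) + r n"
        using eventually_ge_at_top[of n]
      proof eventually_elim
        case (elim k)
        then show ?case
          using nrm_triangle_via[of c "a n" "a k"] ball[OF elim] nrm_minus_commute[of c "a k"] c(1) by simp
      qed
    qed simp
    obtain n :: nat where "q c < real n" using reals_Archimedean2 by blast
    with nest[OF c(1) in_ball[of "Suc n"]] show False by simp
  qed
  then obtain N :: nat and a r where a: "a \<in> V" and r: "0 < r"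
    and dense_a: "\<And>x e. x \<in> V \<Longrightarrow> nrm (x - a) < r \<Longrightarrow> 0 < e \<Longrightarrow> \<exists>u\<in>V. q u \<le> real N \<and> nrm (x - u) < e"
    by metis
  \<comment> \<open>\<open>x\<close> is half the difference of \<open>a + x\<close> and \<open>a - x\<close>\<close>
  have dense0: "\<exists>u\<in>V. q u \<le> real N \<and> nrm (x - u) < e" if x: "x \<in> V" "nrm x < r" and e: "0 < e" for x e
  proof -
    have "nrm (a + x - a) < r" "nrm (a - x - a) < r" using x nrm_scale[of x "-1"] by simp_all
    then obtain u v where u: "u \<in> V" "q u \<le> real N" "nrm (a + x - u) < e"
      and v: "v \<in> V" "q v \<le> real N" "nrm (a - x - v) < e"
      using dense_a[of "a + x" e] dense_a[of "a - x" e] a x e by force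
    have mem: "a + x - u \<in> V" "a - x - v \<in> V" "u - v \<in> V" using a x u v by simp_all
    show ?thesis
    proof (intro bexI[of _ "(1/2) *\<^sub>R (u - v)"] conjI)
      have "q (u - v) \<le> q u + q v"
        using q_add[of u "(-1) *\<^sub>R v"] q_scale[of v "-1"] u v scale_mem[of v "-1"] by simp
      then show "q ((1/2) *\<^sub>R (u - v)) \<le> real N" using q_scale[OF mem(3), of "1/2"] u v by simp
      have "x - (1/2) *\<^sub>R (u - v) = (1/2) *\<^sub>R ((a + x - u) - (a - x - v))"
        by (simp add: algebra_simps flip: scaleR_2)
      then have "nrm (x - (1/2) *\<^sub>R (u - v)) = \<bar>1/2\<bar> * nrm ((a + x - u) - (a - x - v))"
        by (simp only: nrm_scale[OF diff_mem[OF mem(1,2)]])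
      then show "nrm (x - (1/2) *\<^sub>R (u - v)) < e"
        using nrm_triangle_diff[OF mem(1,2)] u(3) v(3) by linarith
    qed (use mem in simp)
  qed
  have dense: "\<exists>u\<in>V. q u \<le> real N * t \<and> nrm (x - u) < e"
    if x: "x \<in> V" "nrm x < r * t" and e: "0 < e" and t: "0 < t" for x e t
  proof -
    have "nrm ((1/t) *\<^sub>R x) = nrm x / t" using nrm_scale[OF x(1), of "1/t"] t by simp
    also have "\<dots> < r" using x t by (simp add: pos_divide_less_eq)
    finally have "nrm ((1/t) *\<^sub>R x) < r" .
    then obtain u where u: "u \<in> V" "q u \<le> real N" "nrm ((1/t) *\<^sub>R x - u) < e / t"
      using dense0[of "(1/t) *\<^sub>R x" "e/t"] x t e by auto
    have "x - t *\<^sub>R u = t *\<^sub>R ((1/t) *\<^sub>R x - u)" using t by (simp add: algebra_simps)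
    then have "nrm (x - t *\<^sub>R u) = t * nrm ((1/t) *\<^sub>R x - u)"
      using nrm_scale[of "(1/t) *\<^sub>R x - u" t] u x t by simp
    then show ?thesis
      using u t q_scale[OF u(1), of t] by (intro bexI[of _ "t *\<^sub>R u"]) (auto simp: field_simps)
  qed
  have bound: "q x \<le> 2 * real N" if x: "x \<in> V" "nrm x < r" for x
  proof -
    \<comment> \<open>\<open>w n\<close> is what remains of \<open>x\<close> after \<open>n\<close> approximations\<close>
    define P where "P = (\<lambda>(n::nat) w. w \<in> V \<and> nrm w < r * (1/2)^n)"
    define Q where "Q = (\<lambda>(n::nat) w w'. q (w - w') \<le> real N * (1/2)^n)"
    have "\<exists>w. (\<forall>n. P n (w n) \<and> Q n (w n) (w (Suc n))) \<and> w 0 = x"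
    proof -
      define P' where "P' = (\<lambda>n w. P n w \<and> (n = 0 \<longrightarrow> w = x))"
      have "\<exists>w. \<forall>n. P' n (w n) \<and> Q n (w n) (w (Suc n))"
      proof (rule dependent_nat_choice)
        show "\<exists>w. P' 0 w" using x by (auto simp: P'_def P_def)
        fix w n assume "P' n w"
        then have w: "w \<in> V" "nrm w < r * (1/2)^n" by (auto simp: P'_def P_def)
        obtain u where "u \<in> V" "q u \<le> real N * (1/2)^n" "nrm (w - u) < r * (1/2) ^ Suc n"
          using dense[OF w, of "r * (1/2) ^ Suc n"] r by auto
        then show "\<exists>w'. P' (Suc n) w' \<and> Q n w w'"
          using w by (intro exI[of _ "w - u"]) (simp add: P'_def P_def Q_def)
      qed
      then show ?thesis by (auto simp: P'_def)
    qed
    then obtain w where w: "\<And>n. w n \<in> V" "\<And>n. nrm (w n) < r * (1/2)^n"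
       "\<And>n. q (w n - w (Suc n)) \<le> real N * (1/2)^n" "w 0 = x"
      by (auto simp: P_def Q_def)
    define u where "u n = w n - w (Suc n)" for n
    have uV: "u n \<in> V" for n using w by (simp add: u_def)
    have geo: "summable (\<lambda>n. c * (1/2::real)^n)" for c by (intro summable_mult summable_geometric) simp
    have part: "(\<Sum>k<n. u k) = x - w n" for n
      by (induction n) (simp_all add: u_def w(4))
    have "(\<lambda>n. r * (1/2::real)^n) \<longlonglongrightarrow> r * 0" by (intro tendsto_intros LIMSEQ_power_zero) simp
    then have w0: "(\<lambda>n. nrm (w n)) \<longlonglongrightarrow> 0"
      using w(1,2) by (intro tendsto_sandwich[of "\<lambda>_. 0" "\<lambda>n. nrm (w n)" sequentially "\<lambda>n. r * (1/2) ^ n"])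
        (auto intro!: always_eventually less_imp_le)
    have s1: "summable (\<lambda>k. nrm (u k))"
    proof (rule summable_comparison_test[OF _ geo[of "2 * r"]])
      have "nrm (u n) \<le> 2 * r * (1/2)^n" for n
      proof -
        have "0 < r * (1/2)^n" "r * (1/2) ^ Suc n = r * (1/2)^n / 2" using r by simp_all
        with nrm_triangle_diff[OF w(1)[of n] w(1)[of "Suc n"]] w(2)[of n] w(2)[of "Suc n"]
        have "nrm (u n) \<le> 2 * (r * (1/2)^n)" unfolding u_def by linarith
        then show ?thesis by (simp add: mult.assoc)
      qed
      then show "\<exists>N. \<forall>n\<ge>N. norm (nrm (u n)) \<le> 2 * r * (1/2)^n" using uV by auto
    qed
    have s2: "summable (\<lambda>k. q (u k))"
      using w(3) q_nonneg[OF uV] by (intro summable_comparison_test[OF _ geo[of "real N"]]) (auto simp: u_def)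
    have "q x \<le> (\<Sum>k. q (u k))"
      using w0 by (intro q_series uV x(1) s1 s2) (simp add: part)
    also have "\<dots> \<le> (\<Sum>k. real N * (1/2)^k)"
      using w(3) by (intro suminf_le s2 geo) (simp add: u_def)
    also have "\<dots> = 2 * real N"
      by (subst suminf_mult) (simp_all add: suminf_geometric)
    finally show ?thesis .
  qed
  show ?thesis
  proof (intro exI[of _ "4 * real N / r"] conjI ballI)
    show "0 \<le> 4 * real N / r" using r by simp
    fix x assume x: "x \<in> V"
    show "q x \<le> 4 * real N / r * nrm x"
    proof (cases "nrm x = 0")
      case True
      have le: "t * q x \<le> 2 * real N" if "0 < t" for t
        using bound[of "t *\<^sub>R x"] q_scale[OF x, of t] nrm_scale[OF x, of t] x True r that by simp
      have "q x \<le> 0"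
      proof (rule ccontr)
        assume "\<not> q x \<le> 0"
        then have "(2 * real N + 1) / q x * q x \<le> 2 * real N" by (intro le) (simp add: add_nonneg_pos)
        with \<open>\<not> q x \<le> 0\<close> show False by simp
      qed
      with True show ?thesis by simp
    next
      case False
      then have pos: "0 < nrm x" using nrm_nonneg[OF x] by linarith
      define t where "t = r / (2 * nrm x)"
      have t: "0 < t" using pos r by (simp add: t_def)
      have "nrm (t *\<^sub>R x) < r" using nrm_scale[OF x, of t] t pos r by (simp add: t_def)
      then have "t * q x \<le> 2 * real N" using bound[of "t *\<^sub>R x"] q_scale[OF x, of t] x t by simp
      then show ?thesis using pos r by (simp add: t_def field_simps)
    qed
  qed
qed

end

section \<open>A perturbed real recursion\<close>

text \<open>
  The product of the factors \<open>1 + d n\<close> is bounded by the exponential of the sum of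
  \<open>d\<close>, so the sequence is bounded. Then the multiplicative error is a summable additive
  one, and subtracting the accumulated errors leaves a decreasing sequence.
\<close>

lemma perturbed_recursion_convergent:
  fixes a d c :: "nat \<Rightarrow> real"
  assumes a: "\<And>n. 0 \<le> a n" and d: "\<And>n. 0 \<le> d n" "summable d" and c: "\<And>n. 0 \<le> c n" "summable c"
    and rec: "\<And>n. a (Suc n) \<le> (1 + d n) * a n + c n"
  shows "convergent a"
proof -
  define E where "E = exp (suminf d)"
  define B where "B = E * (a 0 + suminf c)"
  have prod_ge: "1 \<le> (\<Prod>k<n. 1 + d k)" for n by (intro prod_ge_1) (use d in auto)
  have bound: "a n \<le> (\<Prod>k<n. 1 + d k) * (a 0 + (\<Sum>k<n. c k))" for n
  proof (induction n)
    case (Suc n)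
    let ?P = "\<Prod>k<n. 1 + d k" and ?S = "a 0 + (\<Sum>k<n. c k)"
    have "a (Suc n) \<le> (1 + d n) * a n + c n" by (rule rec)
    also have "\<dots> \<le> (1 + d n) * (?P * ?S) + c n"
      using Suc d(1)[of n] by (intro add_right_mono mult_left_mono) auto
    also have "c n \<le> (1 + d n) * ?P * c n"
    proof -
      have "1 * 1 \<le> (1 + d n) * ?P" using prod_ge[of n] d(1)[of n] by (intro mult_mono) auto
      then show ?thesis using mult_right_mono[of 1 "(1 + d n) * ?P" "c n"] c(1)[of n] by simp
    qed
    finally show ?case by (simp add: algebra_simps)
  qed simp
  have "a n \<le> B" for n
  proof -
    have "(\<Prod>k<n. 1 + d k) \<le> (\<Prod>k<n. exp (d k))"
      using d(1) by (intro prod_mono) (auto intro: add_nonneg_nonneg)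
    also have "\<dots> = exp (\<Sum>k<n. d k)" by (simp add: exp_sum)
    also have "\<dots> \<le> E" unfolding E_def using sum_le_suminf[OF d(2)] d(1) by simp
    finally have "(\<Prod>k<n. 1 + d k) * (a 0 + (\<Sum>k<n. c k)) \<le> E * (a 0 + suminf c)"
      using a[of 0] c sum_le_suminf[OF c(2)] by (intro mult_mono add_left_mono) (auto simp: E_def intro: sum_nonneg add_nonneg_nonneg)
    with bound[of n] show ?thesis by (simp add: B_def)
  qed
  note B = this
  define e where "e n = d n * B + c n" for n
  have e: "0 \<le> e n" for n using d(1)[of n] c(1)[of n] order.trans[OF a[of 0] B[of 0]] by (simp add: e_def)
  have sume: "summable e" unfolding e_def using d c by (intro summable_add summable_mult2)
  define g where "g n = a n - (\<Sum>k<n. e k)" for n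
  have "decseq g"
    proof (rule decseq_SucI)
      fix n
      have "d n * a n \<le> d n * B" using B[of n] d(1)[of n] by (rule mult_left_mono)
      then show "g (Suc n) \<le> g n" using rec[of n] by (simp add: g_def e_def algebra_simps)
    qed
  moreover have "- suminf e \<le> g n" for n
    using a[of n] sum_le_suminf[OF sume finite_lessThan, of n] e by (simp add: g_def)
  ultimately have "convergent g"
    unfolding convergent_def by (metis decseq_convergent)
  moreover have "convergent (\<lambda>n. \<Sum>k<n. e k)" using sume by (simp add: summable_iff_convergent)
  ultimately have "convergent (\<lambda>n. g n + (\<Sum>k<n. e k))" by (rule convergent_add)
  then show ?thesis by (simp add: g_def)
qed

section \<open>Smooth convex functions\<close>

locale smooth_convex_function = semi_inner_space V ip
  for V :: "('a \<Rightarrow> real) set" and ip +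
  fixes \<phi> :: "('a \<Rightarrow> real) \<Rightarrow> real" and \<tau> :: real
  assumes convex_fun: "convex_function V \<phi>"
    and differentiable: "differentiable_with_lipschitz_gradient V ip \<phi> \<tau>"
    and \<tau>_pos: "0 < \<tau>"
begin

abbreviation grad :: "('a \<Rightarrow> real) \<Rightarrow> 'a \<Rightarrow> real" where "grad \<equiv> gradient V ip \<phi>"

lemma has_gradient_grad: "x \<in> V \<Longrightarrow> has_gradient V ip \<phi> x (grad x)"
  using differentiable someI_ex[of "has_gradient V ip \<phi> x"]
  unfolding differentiable_with_lipschitz_gradient_def gradient_def by blast

lemma grad_mem [simp]: "x \<in> V \<Longrightarrow> grad x \<in> V"
  using has_gradient_grad by (simp add: has_gradient_def)

lemma grad_lipschitz: "x \<in> V \<Longrightarrow> y \<in> V \<Longrightarrow> nrm (grad x - grad y) \<le> \<tau> * nrm (x - y)"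
  using differentiable by (simp add: differentiable_with_lipschitz_gradient_def fun_diff_def)

lemma gradient_inequality:
  assumes x: "x \<in> V" and w: "w \<in> V"
  shows "\<phi> x + ip (grad x) (w - x) \<le> \<phi> w"
proof -
  define h where "h = w - x"
  have h: "h \<in> V" using x w by (simp add: h_def)
  have *: "ip (grad x) h \<le> \<phi> w - \<phi> x + e * nrm h" if e: "0 < e" for e
  proof -
    obtain \<delta> where \<delta>: "0 < \<delta>" "\<And>y. y \<in> V \<Longrightarrow> nrm (y - x) < \<delta> \<Longrightarrow>
        \<bar>\<phi> y - \<phi> x - ip (grad x) (y - x)\<bar> \<le> e * nrm (y - x)"
      using has_gradient_grad[OF x] e unfolding has_gradient_def by (auto simp: fun_diff_def)
    define t where "t = min (1/2) (\<delta> / (2 * (nrm h + 1)))"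
    have hp: "0 < nrm h + 1" using nrm_nonneg[OF h] by linarith
    have t: "0 < t" "t < 1" using \<delta>(1) hp by (auto simp: t_def)
    have "t * nrm h \<le> \<delta> / (2 * (nrm h + 1)) * nrm h" using h by (intro mult_right_mono) (auto simp: t_def)
    also have "\<dots> \<le> \<delta> / 2" using hp \<delta>(1) by (simp add: field_simps)
    finally have small: "t * nrm h < \<delta>" using \<delta>(1) by simp
    have eq: "(1 - t) *\<^sub>R x + t *\<^sub>R w = x + t *\<^sub>R h" by (simp add: h_def algebra_simps)
    have "\<phi> ((1 - t) *\<^sub>R x + t *\<^sub>R w) \<le> (1 - t) * \<phi> x + t * \<phi> w"
      using convex_fun x w t by (auto simp: convex_function_def plus_fun_def scaleR_fun_def)
    then have "\<phi> (x + t *\<^sub>R h) \<le> (1 - t) * \<phi> x + t * \<phi> w" by (simp only: eq)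
    moreover have "\<bar>\<phi> (x + t *\<^sub>R h) - \<phi> x - ip (grad x) (t *\<^sub>R h)\<bar> \<le> e * (t * nrm h)"
      using \<delta>(2)[of "x + t *\<^sub>R h"] x h t small by (simp add: nrm_scale)
    ultimately have "t * ip (grad x) h \<le> t * (\<phi> w - \<phi> x + e * nrm h)"
      using x h by (simp add: scale_right algebra_simps abs_le_iff)
    then show ?thesis using t by simp
  qed
  have "ip (grad x) h \<le> \<phi> w - \<phi> x"
  proof (rule tendsto_lowerbound)
    show "((\<lambda>e. \<phi> w - \<phi> x + e * nrm h) \<longlongrightarrow> \<phi> w - \<phi> x) (at_right 0)" by (auto intro!: tendsto_eq_intros)
    show "\<forall>\<^sub>F e in at_right 0. ip (grad x) h \<le> \<phi> w - \<phi> x + e * nrm h"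
      using * by (auto intro!: eventually_at_rightI[of 0 1])
  qed simp
  then show ?thesis by (simp add: h_def)
qed

text \<open>
  Divide the segment from \<open>x\<close> to \<open>w\<close> into \<open>n\<close> parts, bound each
  increment by the gradient at the far end of the part, and compare this gradient with the one at
  \<open>x\<close> by the Lipschitz condition; the sum of the errors tends to
  \<open>\<tau> / 2 * (nrm (w - x))\<^sup>2\<close>.
\<close>

lemma descent:
  assumes x: "x \<in> V" and w: "w \<in> V"
  shows "\<phi> w \<le> \<phi> x + ip (grad x) (w - x) + \<tau> / 2 * (nrm (w - x))\<^sup>2"
proof -
  define h where "h = w - x"
  have h: "h \<in> V" using x w by (simp add: h_def)
  have *: "\<phi> w - \<phi> x \<le> ip (grad x) h + \<tau> * (nrm h)\<^sup>2 * ((1 + 1 / real n) / 2)" if n: "0 < n" for n :: nat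
  proof -
    define q where "q k = x + (real k / real n) *\<^sub>R h" for k
    have q: "q k \<in> V" for k using x h by (simp add: q_def)
    have step: "\<phi> (q (Suc k)) - \<phi> (q k) \<le> ip (grad x) h / real n + \<tau> * (nrm h)\<^sup>2 / (real n)\<^sup>2 * real (Suc k)" for k
    proof -
      have qd: "q k - q (Suc k) = (- 1 / real n) *\<^sub>R h"
      proof -
        have "real k / real n - real (Suc k) / real n = - 1 / real n"
          by (simp add: diff_divide_distrib[symmetric])
        then show ?thesis by (simp add: q_def flip: scaleR_left_diff_distrib)
      qed
      have "\<phi> (q (Suc k)) + ip (grad (q (Suc k))) (q k - q (Suc k)) \<le> \<phi> (q k)"
        using gradient_inequality q by blast
      then have 1: "\<phi> (q (Suc k)) - \<phi> (q k) \<le> ip (grad (q (Suc k))) h / real n"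
        unfolding qd using h q by (simp add: scale_right minus_right)
      have 2: "ip (grad (q (Suc k))) h = ip (grad x) h + ip (grad (q (Suc k)) - grad x) h"
        using x h q by (simp add: diff_left)
      have 3: "ip (grad (q (Suc k)) - grad x) h \<le> nrm (grad (q (Suc k)) - grad x) * nrm h"
        using cauchy_schwarz[of "grad (q (Suc k)) - grad x" h] x h q by simp
      have 4: "nrm (grad (q (Suc k)) - grad x) * nrm h \<le> \<tau> * nrm (q (Suc k) - x) * nrm h"
        using grad_lipschitz[OF q x] h by (intro mult_right_mono) auto
      have 5: "nrm (q (Suc k) - x) = real (Suc k) / real n * nrm h"
        using nrm_scale[OF h, of "real (Suc k) / real n"] by (simp add: q_def)
      have "ip (grad (q (Suc k))) h \<le> ip (grad x) h + \<tau> * (real (Suc k) / real n * nrm h) * nrm h"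
        using 2 3 4 unfolding 5 by linarith
      then have "ip (grad (q (Suc k))) h / real n
          \<le> (ip (grad x) h + \<tau> * (real (Suc k) / real n * nrm h) * nrm h) / real n"
        by (simp add: divide_right_mono)
      with 1 show ?thesis
        by (simp only: add_divide_distrib power2_eq_square times_divide_eq_left times_divide_eq_right
            divide_divide_eq_left mult_ac)
    qed
    have ends: "q n = w" "q 0 = x" using n by (simp_all add: q_def h_def)
    have "\<phi> w - \<phi> x = (\<Sum>k<n. \<phi> (q (Suc k)) - \<phi> (q k))"
      by (subst sum_lessThan_telescope) (simp add: ends)
    also have "\<dots> \<le> (\<Sum>k<n. ip (grad x) h / real n + \<tau> * (nrm h)\<^sup>2 / (real n)\<^sup>2 * real (Suc k))"
      by (intro sum_mono step)
    also have "\<dots> = ip (grad x) h + \<tau> * (nrm h)\<^sup>2 / (real n)\<^sup>2 * (\<Sum>k<n. real (Suc k))"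
      using n by (simp add: sum.distrib sum_distrib_left del: of_nat_Suc)
    also have "(\<Sum>k<n. real (Suc k)) = real n * (real n + 1) / 2"
      by (induction n) (simp_all add: field_simps)
    also have "\<tau> * (nrm h)\<^sup>2 / (real n)\<^sup>2 * (real n * (real n + 1) / 2) = \<tau> * (nrm h)\<^sup>2 * ((1 + 1 / real n) / 2)"
      using n by (simp add: field_simps power2_eq_square)
    finally show ?thesis .
  qed
  have "\<phi> w - \<phi> x \<le> ip (grad x) h + \<tau> * (nrm h)\<^sup>2 * ((1 + 0) / 2)"
  proof (rule tendsto_lowerbound)
    show "(\<lambda>n. ip (grad x) h + \<tau> * (nrm h)\<^sup>2 * ((1 + 1 / real n) / 2))
       \<longlonglongrightarrow> ip (grad x) h + \<tau> * (nrm h)\<^sup>2 * ((1 + 0) / 2)"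
      by (intro tendsto_intros lim_1_over_n) simp
    show "\<forall>\<^sub>F n in sequentially. \<phi> w - \<phi> x \<le> ip (grad x) h + \<tau> * (nrm h)\<^sup>2 * ((1 + 1 / real n) / 2)"
      using eventually_gt_at_top[of 0] by eventually_elim (rule *)
  qed simp
  then show ?thesis by (simp add: h_def)
qed

text \<open>
  Cocoercivity comes from adding two copies of a sharpened gradient inequality. The latter follows by
  comparing the lower bound from \<open>u\<close> and the upper bound from \<open>v\<close> at the
  gradient step \<open>v - (1 / \<tau>) (grad v - grad u)\<close>.
\<close>

lemma baillon_haddad:
  assumes x: "x \<in> V" and y: "y \<in> V"
  shows "(nrm (grad x - grad y))\<^sup>2 / \<tau> \<le> ip (grad x - grad y) (x - y)"
proof -
  have half: "\<phi> u + ip (grad u) (v - u) + (nrm (grad v - grad u))\<^sup>2 / (2 * \<tau>) \<le> \<phi> v" if u: "u \<in> V" and v: "v \<in> V" for u v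
  proof -
    define g where "g = grad v - grad u"
    define w where "w = v - (1 / \<tau>) *\<^sub>R g"
    have g: "g \<in> V" and w: "w \<in> V" using u v by (simp_all add: g_def w_def)
    have "\<phi> u + ip (grad u) (w - u) \<le> \<phi> v + ip (grad v) (w - v) + \<tau> / 2 * (nrm (w - v))\<^sup>2"
      using gradient_inequality[OF u w] descent[OF v w] by simp
    moreover have "ip (grad u) (w - u) = ip (grad u) (v - u) - ip (grad u) g / \<tau>"
      using u v g by (simp add: w_def bilinear)
    moreover have "ip (grad v) (w - v) = - ip (grad v) g / \<tau>"
      using v g by (simp add: w_def bilinear minus_right)
    moreover have "\<tau> / 2 * (nrm (w - v))\<^sup>2 = (nrm g)\<^sup>2 / (2 * \<tau>)"
      using nrm_scale[OF g, of "- (1 / \<tau>)"] \<tau>_pos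
      by (simp add: w_def power_mult_distrib power_divide power2_eq_square[of \<tau>])
    moreover have "(nrm g)\<^sup>2 / \<tau> = ip (grad v) g / \<tau> - ip (grad u) g / \<tau>"
      using diff_left[of "grad v" "grad u" g, folded g_def] u v g
      by (simp add: nrm_power2[OF g] diff_divide_distrib)
    moreover have "(nrm g)\<^sup>2 / \<tau> = 2 * ((nrm g)\<^sup>2 / (2 * \<tau>))" by simp
    ultimately show ?thesis unfolding g_def[symmetric] by linarith
  qed
  have "nrm (grad x - grad y) = nrm (grad y - grad x)" using x y by (intro nrm_minus_commute) auto
  then show ?thesis using half[OF x y] half[OF y x] x y by (simp add: bilinear field_simps)
qed

end

section \<open>The forward-backward iteration\<close>

text \<open>
  The derivative of the smooth part at \<open>x\<close> is the linear functional \<open>D x\<close>.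
  The last assumption is cocoercivity: taking the supremum over the unit vectors \<open>h\<close> on
  the left gives \<open>\<beta>\<close> times the square of the dual norm of \<open>D x - D u\<close>.
\<close>

locale smooth_plus_convex = semi_hilbert_space V ip
  for V :: "'v::real_vector set" and ip +
  fixes f :: "'v \<Rightarrow> ereal" and \<Phi> :: "'v \<Rightarrow> real" and D :: "'v \<Rightarrow> 'v \<Rightarrow> real" and \<beta> C :: real
  assumes f_not_minf: "x \<in> V \<Longrightarrow> f x \<noteq> -\<infinity>"
    and f_proper: "\<exists>x\<in>V. f x \<noteq> \<infinity>"
    and f_convex: "x \<in> V \<Longrightarrow> y \<in> V \<Longrightarrow> 0 < t \<Longrightarrow> t < 1 \<Longrightarrow>
      f ((1 - t) *\<^sub>R x + t *\<^sub>R y) \<le> ereal (1 - t) * f x + ereal t * f y"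
    and f_lsc: "x \<in> V \<Longrightarrow> ereal c < f x \<Longrightarrow> \<exists>\<delta>>0. \<forall>y\<in>V. norm_of ip (y - x) < \<delta> \<longrightarrow> ereal c < f y"
    and D_add: "x \<in> V \<Longrightarrow> h \<in> V \<Longrightarrow> k \<in> V \<Longrightarrow> D x (h + k) = D x h + D x k"
    and D_scale: "x \<in> V \<Longrightarrow> h \<in> V \<Longrightarrow> D x (c *\<^sub>R h) = c * D x h"
    and D_bounded: "x \<in> V \<Longrightarrow> \<exists>M\<ge>0. \<forall>h\<in>V. \<bar>D x h\<bar> \<le> M * norm_of ip h"
    and \<Phi>_lower: "x \<in> V \<Longrightarrow> w \<in> V \<Longrightarrow> \<Phi> x + D x (w - x) \<le> \<Phi> w"
    and \<Phi>_upper: "x \<in> V \<Longrightarrow> w \<in> V \<Longrightarrow> \<Phi> w \<le> \<Phi> x + D x (w - x) + C * (norm_of ip (w - x))\<^sup>2"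
    and \<beta>_pos: "0 < \<beta>"
    and D_cocoercive: "x \<in> V \<Longrightarrow> u \<in> V \<Longrightarrow> h \<in> V \<Longrightarrow>
      \<beta> * (D x h - D u h)\<^sup>2 \<le> (D x (x - u) - D u (x - u)) * (norm_of ip h)\<^sup>2"
begin

lemma D_diff: "x \<in> V \<Longrightarrow> h \<in> V \<Longrightarrow> k \<in> V \<Longrightarrow> D x (h - k) = D x h - D x k"
  using D_add[of x h "(-1) *\<^sub>R k"] D_scale[of x k "-1"] scale_mem[of k "-1"] by simp

definition minimizer :: "'v \<Rightarrow> bool" where
  "minimizer s \<longleftrightarrow> s \<in> V \<and> (\<forall>u\<in>V. f s + ereal (\<Phi> s) \<le> f u + ereal (\<Phi> u))"

lemma f_convex_real:
  assumes "x \<in> V" "y \<in> V" "0 < t" "t < 1" "f x = ereal a" "f y = ereal b"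
  obtains d where "f ((1 - t) *\<^sub>R x + t *\<^sub>R y) = ereal d" "d \<le> (1 - t) * a + t * b"
proof -
  let ?v = "(1 - t) *\<^sub>R x + t *\<^sub>R y"
  have "f ?v \<noteq> -\<infinity>" using assms by (intro f_not_minf) simp
  moreover have "f ?v \<le> ereal ((1 - t) * a + t * b)"
    using f_convex[OF assms(1-4)] assms(5,6) by simp
  ultimately show ?thesis using that by (cases "f ?v") auto
qed

lemma segment: "(1 - t) *\<^sub>R x + t *\<^sub>R y = x + t *\<^sub>R (y - x)" for x y :: 'v
  by (simp add: algebra_simps)

lemma minimizer_finite:
  assumes "minimizer s"
  obtains a where "f s = ereal a"
proof -
  obtain u where u: "u \<in> V" "f u \<noteq> \<infinity>" using f_proper by blast
  have "f s + ereal (\<Phi> s) \<le> f u + ereal (\<Phi> u)" using assms u by (simp add: minimizer_def)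
  then have "f s \<noteq> \<infinity>" using u by auto
  moreover have "f s \<noteq> -\<infinity>" using assms f_not_minf by (simp add: minimizer_def)
  ultimately show ?thesis using that by (cases "f s") auto
qed

lemma prox_finite:
  assumes y: "y \<in> V" and g: "0 < \<gamma>"
    and min: "\<And>u. u \<in> V \<Longrightarrow> ereal \<gamma> * f y + ereal (r y) \<le> ereal \<gamma> * f u + ereal (r u)"
  obtains a where "f y = ereal a"
proof -
  obtain u where u: "u \<in> V" "f u \<noteq> \<infinity>" using f_proper by blast
  then obtain a where a: "f u = ereal a" using f_not_minf by (cases "f u") auto
  have "f y \<noteq> \<infinity>" using min[OF u(1)] g a by auto
  then show ?thesis using that f_not_minf[OF y] by (cases "f y") auto
qed

lemma prox_variational_inequality:
  assumes y: "y \<in> V" and w: "w \<in> V" and u: "u \<in> V" and g: "0 < \<gamma>"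
    and min: "\<And>u. u \<in> V \<Longrightarrow> ereal \<gamma> * f y + ereal (1/2 * (nrm (y - w))\<^sup>2) \<le> ereal \<gamma> * f u + ereal (1/2 * (nrm (u - w))\<^sup>2)"
    and fin: "f y = ereal a" "f u = ereal b"
  shows "\<gamma> * a + ip (w - y) (u - y) \<le> \<gamma> * b"
proof -
  have "0 \<le> \<gamma> * (b - a) + ip (y - w) (u - y)"
  proof (rule nonneg_of_quadratic)
    fix t :: real assume t: "0 < t" "t < 1"
    define v where "v = (1 - t) *\<^sub>R y + t *\<^sub>R u"
    have v: "v \<in> V" using y u by (simp add: v_def)
    obtain d where d: "f v = ereal d" "d \<le> (1 - t) * a + t * b"
      unfolding v_def by (rule f_convex_real[OF y u t fin])
    have "\<gamma> * a + 1/2 * (nrm (y - w))\<^sup>2 \<le> \<gamma> * d + 1/2 * (nrm (v - w))\<^sup>2"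
      using min[OF v] fin d by simp
    moreover have "\<gamma> * d \<le> \<gamma> * ((1 - t) * a + t * b)" using d(2) g by (intro mult_left_mono) auto
    ultimately have 1: "\<gamma> * a + 1/2 * (nrm (y - w))\<^sup>2 \<le> \<gamma> * ((1 - t) * a + t * b) + 1/2 * (nrm (v - w))\<^sup>2"
      by linarith
    have "v - w = (y - w) + t *\<^sub>R (u - y)" by (simp add: v_def segment)
    then have 2: "(nrm (v - w))\<^sup>2 = (nrm (y - w))\<^sup>2 + 2 * t * ip (y - w) (u - y) + t\<^sup>2 * (nrm (u - y))\<^sup>2"
      using y u w by (simp only: nrm2_add diff_mem scale_mem) (simp add: nrm_scale scale_right power_mult_distrib)
    show "0 \<le> t * (\<gamma> * (b - a) + ip (y - w) (u - y)) + t\<^sup>2 * ((nrm (u - y))\<^sup>2 / 2)"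
      using 1 unfolding 2 by (simp add: algebra_simps)
  qed
  moreover have "ip (y - w) (u - y) = - ip (w - y) (u - y)" using y w u by (simp add: diff_left)
  ultimately show ?thesis by (simp add: algebra_simps)
qed

lemma minimizer_variational_inequality:
  assumes s: "minimizer s" and u: "u \<in> V" and fin: "f s = ereal a" "f u = ereal b"
  shows "a \<le> b + D s (u - s)"
proof -
  have sV: "s \<in> V" using s by (simp add: minimizer_def)
  have "0 \<le> b - a + D s (u - s)"
  proof (rule nonneg_of_quadratic)
    fix t :: real assume t: "0 < t" "t < 1"
    define v where "v = (1 - t) *\<^sub>R s + t *\<^sub>R u"
    have v: "v \<in> V" using sV u by (simp add: v_def)
    obtain d where d: "f v = ereal d" "d \<le> (1 - t) * a + t * b"
      unfolding v_def by (rule f_convex_real[OF sV u t fin])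
    have "f s + ereal (\<Phi> s) \<le> f v + ereal (\<Phi> v)" using s v by (simp add: minimizer_def)
    then have 1: "a + \<Phi> s \<le> (1 - t) * a + t * b + \<Phi> v" using fin d by simp
    have "v - s = t *\<^sub>R (u - s)" by (simp add: v_def segment)
    then have "\<Phi> v \<le> \<Phi> s + t * D s (u - s) + C * (t\<^sup>2 * (nrm (u - s))\<^sup>2)"
      using \<Phi>_upper[OF sV v] sV u by (simp add: D_scale nrm_scale power_mult_distrib)
    with 1 show "0 \<le> t * (b - a + D s (u - s)) + t\<^sup>2 * (C * (nrm (u - s))\<^sup>2)"
      by (simp add: algebra_simps)
  qed
  then show ?thesis by simp
qed

definition sublevel :: "real \<Rightarrow> 'v set" where
  "sublevel \<alpha> = {u \<in> V. f u + ereal (\<Phi> u) \<le> ereal \<alpha>}"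

lemma sublevelE:
  assumes "u \<in> sublevel \<alpha>"
  obtains a where "u \<in> V" "f u = ereal a" "a + \<Phi> u \<le> \<alpha>"
  using assms f_not_minf[of u] by (cases "f u") (auto simp: sublevel_def)

lemma \<Phi>_convex:
  assumes x: "x \<in> V" and y: "y \<in> V" and t: "0 < t" "t < 1"
  shows "\<Phi> ((1 - t) *\<^sub>R x + t *\<^sub>R y) \<le> (1 - t) * \<Phi> x + t * \<Phi> y"
proof -
  define m where "m = (1 - t) *\<^sub>R x + t *\<^sub>R y"
  have m: "m \<in> V" using x y by (simp add: m_def)
  have e: "x - m = (- t) *\<^sub>R (y - x)" "y - m = (1 - t) *\<^sub>R (y - x)" by (simp_all add: m_def algebra_simps)
  have "\<Phi> m + (- t) * D m (y - x) \<le> \<Phi> x" 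
    using \<Phi>_lower[OF m x] D_scale[OF m diff_mem[OF y x], of "- t"] by (simp only: e)
  then have 1: "(1 - t) * (\<Phi> m + (- t) * D m (y - x)) \<le> (1 - t) * \<Phi> x"
    using t by (intro mult_left_mono) auto
  have "\<Phi> m + (1 - t) * D m (y - x) \<le> \<Phi> y"
    using \<Phi>_lower[OF m y] D_scale[OF m diff_mem[OF y x], of "1 - t"] by (simp only: e)
  then have 2: "t * (\<Phi> m + (1 - t) * D m (y - x)) \<le> t * \<Phi> y"
    using t by (intro mult_left_mono) auto
  from 1 2 show ?thesis unfolding m_def[symmetric] by (simp add: algebra_simps)
qed

lemma convex_sublevel: "convex (sublevel \<alpha>)"
  unfolding convex_alt
proof (intro ballI allI impI)
  fix x y and t :: real assume x: "x \<in> sublevel \<alpha>" and y: "y \<in> sublevel \<alpha>" and t: "0 \<le> t \<and> t \<le> 1"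
  show "(1 - t) *\<^sub>R x + t *\<^sub>R y \<in> sublevel \<alpha>"
  proof (cases "t = 0 \<or> t = 1")
    case True
    then show ?thesis using x y by auto
  next
    case False
    with t have t: "0 < t" "t < 1" by auto
    obtain a where a: "x \<in> V" "f x = ereal a" "a + \<Phi> x \<le> \<alpha>" using x by (rule sublevelE)
    obtain b where b: "y \<in> V" "f y = ereal b" "b + \<Phi> y \<le> \<alpha>" using y by (rule sublevelE)
    let ?v = "(1 - t) *\<^sub>R x + t *\<^sub>R y"
    obtain d where d: "f ?v = ereal d" "d \<le> (1 - t) * a + t * b"
      by (rule f_convex_real[OF a(1) b(1) t a(2) b(2)])
    have "f ?v + ereal (\<Phi> ?v) \<le> ereal ((1 - t) * a + t * b + ((1 - t) * \<Phi> x + t * \<Phi> y))"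
      using d \<Phi>_convex[OF a(1) b(1) t] by simp
    also have "\<dots> = ereal ((1 - t) * (a + \<Phi> x) + t * (b + \<Phi> y))" by (simp add: algebra_simps)
    also have "\<dots> \<le> ereal ((1 - t) * \<alpha> + t * \<alpha>)"
      using a b t unfolding ereal_less_eq by (intro add_mono mult_left_mono) auto
    also have "(1 - t) * \<alpha> + t * \<alpha> = \<alpha>" by (simp add: algebra_simps)
    finally show ?thesis using a b by (simp add: sublevel_def)
  qed
qed

text \<open>
  Near the limit, \<open>f\<close> is bounded below by semicontinuity and \<open>\<Phi>\<close> by its
  tangent, which is continuous.
\<close>

lemma norm_closed_sublevel: "norm_closed (sublevel \<alpha>)"
  unfolding norm_closed_def
proof (intro conjI allI impI)
  show "sublevel \<alpha> \<subseteq> V" by (auto simp: sublevel_def)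
  fix xs x assume xs: "\<forall>n. xs n \<in> sublevel \<alpha>" and x: "x \<in> V" and lim: "(\<lambda>n. nrm (xs n - x)) \<longlonglongrightarrow> 0"
  have xsV [simp]: "xs n \<in> V" for n using xs by (auto simp: sublevel_def)
  show "x \<in> sublevel \<alpha>"
  proof (rule ccontr)
    assume "x \<notin> sublevel \<alpha>"
    then have "ereal \<alpha> < f x + ereal (\<Phi> x)" using x by (simp add: sublevel_def)
    then have "ereal (\<alpha> - \<Phi> x) < f x" by (cases "f x") auto
    then obtain c where c: "\<alpha> - \<Phi> x < c" "ereal c < f x" using ereal_dense2 by (metis less_ereal.simps(1))
    obtain \<delta> where \<delta>: "0 < \<delta>" "\<And>y. y \<in> V \<Longrightarrow> nrm (y - x) < \<delta> \<Longrightarrow> ereal c < f y"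
      using f_lsc[OF x c(2)] by blast
    obtain M where M: "\<And>h. h \<in> V \<Longrightarrow> \<bar>D x h\<bar> \<le> M * nrm h" using D_bounded[OF x] by blast
    have "(\<lambda>n. c + \<Phi> x - M * nrm (xs n - x)) \<longlonglongrightarrow> c + \<Phi> x - M * 0" by (intro tendsto_intros lim)
    then have "\<forall>\<^sub>F n in sequentially. \<alpha> < c + \<Phi> x - M * nrm (xs n - x)"
      using c(1) by (intro order_tendstoD(1)) auto
    moreover have "\<forall>\<^sub>F n in sequentially. nrm (xs n - x) < \<delta>" using \<delta>(1) by (intro order_tendstoD(2)[OF lim])
    ultimately have "\<forall>\<^sub>F n in sequentially. False"
    proof eventually_elim
      case (elim n)
      obtain a where a: "f (xs n) = ereal a" "a + \<Phi> (xs n) \<le> \<alpha>" using xs by (metis sublevelE)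
      have "c < a" using \<delta>(2)[OF xsV elim(2)] a by simp
      moreover have "\<Phi> x + D x (xs n - x) \<le> \<Phi> (xs n)" using x by (intro \<Phi>_lower) auto
      moreover have "\<bar>D x (xs n - x)\<bar> \<le> M * nrm (xs n - x)" using x by (intro M) auto
      ultimately show False using elim(1) a(2) by linarith
    qed
    then show False by simp
  qed
qed

context
  fixes x y z b :: 'v and \<gamma> :: real
  assumes mem: "x \<in> V" "y \<in> V" "z \<in> V" "b \<in> V" and \<gamma>: "0 < \<gamma>"
    and z: "\<And>h. h \<in> V \<Longrightarrow> D x h = ip z h"
    and y: "\<And>u. u \<in> V \<Longrightarrow> ereal \<gamma> * f y + ereal (1/2 * (nrm (y - (x - \<gamma> *\<^sub>R (z + b))))\<^sup>2)
      \<le> ereal \<gamma> * f u + ereal (1/2 * (nrm (u - (x - \<gamma> *\<^sub>R (z + b))))\<^sup>2)"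
begin

lemma step_finite:
  obtains a where "f y = ereal a"
  using prox_finite[OF mem(2) \<gamma> y] by blast

lemma step_variational_inequality:
  assumes u: "u \<in> V" and fin: "f y = ereal a" "f u = ereal c"
  shows "\<gamma> * a + ip (x - y) (u - y) - \<gamma> * D x (u - y) - \<gamma> * ip b (u - y) \<le> \<gamma> * c"
proof -
  have "\<gamma> * a + ip (x - \<gamma> *\<^sub>R (z + b) - y) (u - y) \<le> \<gamma> * c"
    using mem u by (intro prox_variational_inequality[OF mem(2) _ u \<gamma> y fin]) auto
  moreover have "ip (x - \<gamma> *\<^sub>R (z + b) - y) (u - y) = ip (x - y) (u - y) - \<gamma> * D x (u - y) - \<gamma> * ip b (u - y)"
    using mem u z[of "u - y"] by (simp add: diff_left add_left scale_left distrib_left)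
  ultimately show ?thesis by simp
qed

text \<open>
  Adding the variational inequalities of \<open>y\<close> (tested at \<open>s\<close>) and of
  \<open>s\<close> (tested at \<open>y\<close>) bounds \<open>ip (x - y) (y - s)\<close> from below by
  \<open>\<gamma> (E + F)\<close> up to the error \<open>b\<close>, where \<open>E\<close> and
  \<open>F\<close> are \<open>D x - D s\<close> at \<open>x - s\<close> and at \<open>y - x\<close>.
  Cocoercivity makes \<open>E\<close> large enough to absorb \<open>F\<close> up to a multiple of the
  square of \<open>nrm (x - y)\<close>.
\<close>

lemma forward_backward_step:
  assumes s: "minimizer s"
  shows "(nrm (y - s))\<^sup>2 \<le> (nrm (x - s))\<^sup>2 - (1 - \<gamma> / (2 * \<beta>)) * (nrm (x - y))\<^sup>2 + 2 * \<gamma> * nrm b * nrm (y - s)"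
proof -
  have sV: "s \<in> V" using s by (simp add: minimizer_def)
  obtain a where a: "f y = ereal a" by (rule step_finite)
  obtain c where c: "f s = ereal c" using s by (rule minimizer_finite)
  define E where "E = D x (x - s) - D s (x - s)"
  define F where "F = D x (y - x) - D s (y - x)"
  have "\<gamma> * c \<le> \<gamma> * (a + D s (y - s))"
    using minimizer_variational_inequality[OF s mem(2) c a] \<gamma> by (intro mult_left_mono) auto
  with step_variational_inequality[OF sV a c]
  have 1: "ip (x - y) (s - y) - \<gamma> * D x (s - y) - \<gamma> * ip b (s - y) \<le> \<gamma> * D s (y - s)"
    by (simp add: algebra_simps)
  have 2: "D x (s - y) = - D x (x - s) - D x (y - x)" "D s (y - s) = D s (x - s) + D s (y - x)"
    using D_add[OF mem(1), of "x - s" "y - x"] D_add[OF sV, of "x - s" "y - x"] D_diff[OF mem(1), of s y]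
      D_diff[OF mem(1), of y s] mem sV by simp_all
  have 3: "ip (x - y) (s - y) = - ip (x - y) (y - s)" "ip b (s - y) = - ip b (y - s)"
    using mem sV by (simp_all add: bilinear)
  have 4: "\<bar>ip b (y - s)\<bar> \<le> nrm b * nrm (y - s)" using mem sV by (intro cauchy_schwarz) auto
  \<comment> \<open>expand the square of \<open>2 \<beta> F + n2\<close>, with \<open>n2\<close> the square of \<open>nrm (x - y)\<close>, and divide by \<open>n2\<close>\<close>
  have 5: "- (nrm (x - y))\<^sup>2 / (4 * \<beta>) \<le> E + F"
  proof -
    have "\<beta> * F\<^sup>2 \<le> E * (nrm (y - x))\<^sup>2" unfolding E_def F_def using mem sV by (intro D_cocoercive) auto
    moreover have "nrm (y - x) = nrm (x - y)" using mem by (intro nrm_minus_commute) auto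
    ultimately have le: "\<beta> * F\<^sup>2 \<le> E * (nrm (x - y))\<^sup>2" by simp
    show ?thesis
    proof (cases "nrm (x - y) = 0")
      case True
      then have "F\<^sup>2 \<le> 0" using le \<beta>_pos by (simp add: mult_le_0_iff)
      then have "F = 0" by simp
      moreover have "0 \<le> E"
      proof -
        have "\<beta> * E\<^sup>2 \<le> E * (nrm (x - s))\<^sup>2" unfolding E_def using mem sV by (intro D_cocoercive) auto
        moreover have "0 \<le> \<beta> * E\<^sup>2" using \<beta>_pos by simp
        ultimately have "0 \<le> E * (nrm (x - s))\<^sup>2" by linarith
        then show ?thesis using \<open>\<beta> * E\<^sup>2 \<le> E * (nrm (x - s))\<^sup>2\<close> \<beta>_pos
          by (cases "nrm (x - s) = 0") (auto simp: zero_le_mult_iff mult_le_0_iff)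
      qed
      ultimately show ?thesis using True by simp
    next
      case False
      define n2 where "n2 = (nrm (x - y))\<^sup>2"
      have n2: "0 < n2" using False by (simp add: n2_def)
      have "0 \<le> (2 * \<beta> * F + n2)\<^sup>2" by simp
      also have "\<dots> = 4 * \<beta> * (\<beta> * F\<^sup>2) + 4 * \<beta> * F * n2 + n2\<^sup>2" by (simp add: power2_eq_square algebra_simps)
      also have "\<dots> \<le> 4 * \<beta> * (E * n2) + 4 * \<beta> * F * n2 + n2\<^sup>2"
        using le \<beta>_pos by (intro add_right_mono mult_left_mono) (auto simp: n2_def)
      also have "\<dots> = n2 * (4 * \<beta> * (E + F) + n2)" by (simp add: power2_eq_square algebra_simps)
      finally have "0 \<le> 4 * \<beta> * (E + F) + n2" using n2 by (simp add: zero_le_mult_iff)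
      then show ?thesis using \<beta>_pos unfolding n2_def[symmetric] by (simp add: field_simps)
    qed
  qed
  have 6: "- (\<gamma> / (4 * \<beta>)) * (nrm (x - y))\<^sup>2 \<le> \<gamma> * (E + F)"
    using mult_left_mono[OF 5, of \<gamma>] \<gamma> by simp
  have 7: "\<gamma> * \<bar>ip b (y - s)\<bar> \<le> \<gamma> * (nrm b * nrm (y - s))" using 4 \<gamma> by (intro mult_left_mono) auto
  have "(nrm (x - s))\<^sup>2 = (nrm (x - y))\<^sup>2 + 2 * ip (x - y) (y - s) + (nrm (y - s))\<^sup>2"
    using nrm2_add[of "x - y" "y - s"] mem sV by simp
  moreover have "ip (x - y) (y - s) \<ge> \<gamma> * (E + F) - \<gamma> * (nrm b * nrm (y - s))"
  proof -
    have "- ip (x - y) (y - s) + \<gamma> * (D x (x - s) + D x (y - x)) + \<gamma> * ip b (y - s) \<le> \<gamma> * (D s (x - s) + D s (y - x))"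
      using 1 unfolding 2 3 by (simp add: algebra_simps)
    then have "\<gamma> * (E + F) + \<gamma> * ip b (y - s) \<le> ip (x - y) (y - s)" by (simp add: E_def F_def algebra_simps)
    moreover have "- (\<gamma> * ip b (y - s)) \<le> \<gamma> * \<bar>ip b (y - s)\<bar>" 
      using mult_left_mono[OF abs_ge_minus_self[of "ip b (y - s)"], of \<gamma>] \<gamma> by simp
    ultimately show ?thesis using 7 by linarith
  qed
  ultimately show ?thesis using 6 by (simp add: algebra_simps)
qed

text \<open>
  The variational inequality of the proximal point compares the values of \<open>f\<close>, and the
  tangent at \<open>x\<close>, with its quadratic error, those of \<open>\<Phi>\<close>; the terms in
  \<open>D x\<close> cancel. The remaining terms vanish with \<open>x - y\<close> and \<open>b\<close>
  as long as \<open>y\<close> stays bounded.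
\<close>

lemma forward_backward_gap:
  assumes u: "u \<in> V" and fin: "f y = ereal a" "f u = ereal c"
  shows "a + \<Phi> y \<le> c + \<Phi> u + (nrm (x - y) / \<gamma> + nrm b) * nrm (y - u) + C * (nrm (x - y))\<^sup>2"
proof -
  have "\<gamma> * a \<le> \<gamma> * (c - ip (x - y) (u - y) / \<gamma> + D x (u - y) + ip b (u - y))"
    using step_variational_inequality[OF u fin] \<gamma> by (simp add: algebra_simps)
  then have 1: "a \<le> c - ip (x - y) (u - y) / \<gamma> + D x (u - y) + ip b (u - y)" using \<gamma> by simp
  have "\<bar>ip (x - y) (u - y)\<bar> / \<gamma> \<le> (nrm (x - y) * nrm (u - y)) / \<gamma>"
    using \<gamma> mem u by (intro divide_right_mono cauchy_schwarz) auto
  moreover have "- ip (x - y) (u - y) / \<gamma> \<le> \<bar>ip (x - y) (u - y)\<bar> / \<gamma>" using \<gamma> by (intro divide_right_mono) auto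
  moreover have "\<bar>ip b (u - y)\<bar> \<le> nrm b * nrm (u - y)" using mem u by (intro cauchy_schwarz) auto
  moreover have "\<Phi> x + D x (u - x) \<le> \<Phi> u" using mem u by (intro \<Phi>_lower)
  moreover have "\<Phi> y \<le> \<Phi> x + D x (y - x) + C * (nrm (y - x))\<^sup>2" using mem by (intro \<Phi>_upper)
  moreover have "D x (u - x) = D x (u - y) + D x (y - x)" using D_add[OF mem(1), of "u - y" "y - x"] mem u by simp
  moreover have "nrm (y - x) = nrm (x - y)" "nrm (u - y) = nrm (y - u)" using mem u by (auto intro: nrm_minus_commute)
  ultimately show ?thesis using 1 by (simp add: algebra_simps)
qed

end

text \<open>
  The distances to a minimizer satisfy a perturbed recursion and so converge. Telescoping their
  squares shows that \<open>x n - y n\<close> tends to zero, and then the gap estimate puts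
  \<open>y n\<close> eventually in each sublevel set above the minimal value; these sets are closed
  and convex, and their intersection is the set of minimizers.
\<close>

theorem forward_backward_weak_convergence:
  fixes x y z b :: "nat \<Rightarrow> 'v" and \<gamma> \<mu> \<delta> \<eta> :: "nat \<Rightarrow> real" and \<epsilon> :: real
  assumes mem: "\<And>n. x n \<in> V" "\<And>n. y n \<in> V" "\<And>n. z n \<in> V" "\<And>n. b n \<in> V"
    and \<epsilon>: "0 < \<epsilon>" and \<gamma>: "\<And>n. \<gamma> n \<in> {\<epsilon>..2 * \<beta> - \<epsilon>}" and \<mu>: "\<And>n. \<mu> n \<in> {0..1 - \<epsilon>}"
    and z: "\<And>n h. h \<in> V \<Longrightarrow> D (x n) h = ip (z n) h"
    and y: "\<And>n u. u \<in> V \<Longrightarrow> ereal (\<gamma> n) * f (y n) + ereal (1/2 * (nrm (y n - (x n - \<gamma> n *\<^sub>R (z n + b n))))\<^sup>2)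
      \<le> ereal (\<gamma> n) * f u + ereal (1/2 * (nrm (u - (x n - \<gamma> n *\<^sub>R (z n + b n))))\<^sup>2)"
    and step: "\<And>n. nrm (x (Suc n) - (\<mu> n *\<^sub>R x n + (1 - \<mu> n) *\<^sub>R y n)) \<le> \<delta> n * nrm (x n - y n) + \<eta> n"
    and \<delta>: "\<And>n. 0 \<le> \<delta> n" "summable \<delta>" and \<eta>: "\<And>n. 0 \<le> \<eta> n" "summable \<eta>"
    and b: "summable (\<lambda>n. nrm (b n))"
    and ex: "\<exists>s. minimizer s"
  shows "\<exists>c. minimizer c \<and> weakly_converges V ip x c"
proof -
  note [simp] = mem
  have \<gamma>0: "0 < \<gamma> n" for n using \<gamma>[of n] \<epsilon> by simp
  define g where "g n = 4 * \<beta> * nrm (b n)" for n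
  have g0: "0 \<le> g n" for n using \<beta>_pos by (simp add: g_def)
  have gs: "summable g" unfolding g_def by (intro summable_mult b)
  define \<kappa> where "\<kappa> = \<epsilon> / (2 * \<beta>)"
  have \<kappa>: "0 < \<kappa>" using \<epsilon> \<beta>_pos by (simp add: \<kappa>_def)
  define W where "W n = nrm (x n - y n)" for n
  have W0: "0 \<le> W n" for n by (simp add: W_def)
  have Ysq: "(nrm (y n - s))\<^sup>2 \<le> (nrm (x n - s))\<^sup>2 - \<kappa> * (W n)\<^sup>2 + g n * nrm (y n - s)"
    if s: "minimizer s" for s n
  proof -
    have sV: "s \<in> V" using s by (simp add: minimizer_def)
    have "\<kappa> \<le> 1 - \<gamma> n / (2 * \<beta>)" using \<gamma>[of n] \<beta>_pos by (simp add: \<kappa>_def field_simps)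
    then have "\<kappa> * (W n)\<^sup>2 \<le> (1 - \<gamma> n / (2 * \<beta>)) * (W n)\<^sup>2" by (intro mult_right_mono) auto
    moreover have "2 * \<gamma> n * nrm (b n) * nrm (y n - s) \<le> g n * nrm (y n - s)"
      unfolding g_def using \<gamma>[of n] \<epsilon> sV by (intro mult_right_mono) auto
    ultimately show ?thesis
      using forward_backward_step[of "x n" "y n" "z n" "b n" "\<gamma> n", OF mem \<gamma>0 z y s] unfolding W_def[symmetric] by simp
  qed
  have Yle: "nrm (y n - s) \<le> nrm (x n - s) + g n" if s: "minimizer s" for s n
  proof (rule ccontr)
    assume "\<not> ?thesis"
    then have lt: "nrm (x n - s) + g n < nrm (y n - s)" by simp
    have sV: "s \<in> V" using s by (simp add: minimizer_def)
    then have X0: "0 \<le> nrm (x n - s)" by simp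
    have "(nrm (x n - s))\<^sup>2 + g n * nrm (y n - s) \<le> nrm (x n - s) * nrm (y n - s) + g n * nrm (y n - s)"
      using lt X0 g0[of n] by (simp add: power2_eq_square mult_left_mono)
    also have "\<dots> = (nrm (x n - s) + g n) * nrm (y n - s)" by (simp add: algebra_simps)
    also have "\<dots> < nrm (y n - s) * nrm (y n - s)"
      using lt X0 g0[of n] by (intro mult_strict_right_mono) auto
    finally have "(nrm (x n - s))\<^sup>2 + g n * nrm (y n - s) < (nrm (y n - s))\<^sup>2" by (simp add: power2_eq_square)
    moreover have "0 \<le> \<kappa> * (W n)\<^sup>2" using \<kappa> by simp
    ultimately show False using Ysq[OF s, of n] by linarith
  qed
  have Wle: "W n \<le> 2 * nrm (x n - s) + g n" if s: "minimizer s" for s n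
  proof -
    have sV: "s \<in> V" using s by (simp add: minimizer_def)
    then show ?thesis
      using nrm_triangle_via[of "x n" "y n" s] Yle[OF s, of n] nrm_minus_commute[of s "y n"] unfolding W_def by simp
  qed
  have Xle: "nrm (x (Suc n) - s) \<le> nrm (\<mu> n *\<^sub>R (x n - s) + (1 - \<mu> n) *\<^sub>R (y n - s)) + (\<delta> n * W n + \<eta> n)"
    if sV: "s \<in> V" for s n
  proof -
    define m where "m = \<mu> n *\<^sub>R x n + (1 - \<mu> n) *\<^sub>R y n"
    have m: "m \<in> V" by (simp add: m_def)
    have "m - s = \<mu> n *\<^sub>R (x n - s) + (1 - \<mu> n) *\<^sub>R (y n - s)" by (simp add: m_def algebra_simps)
    then show ?thesis using nrm_triangle_via[of "x (Suc n)" s m] sV m step[of n] unfolding m_def[symmetric] W_def by simp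
  qed
  have mid: "nrm (\<mu> n *\<^sub>R (x n - s) + (1 - \<mu> n) *\<^sub>R (y n - s)) \<le> nrm (x n - s) + g n" if s: "minimizer s" for s n
  proof -
    have sV: "s \<in> V" using s by (simp add: minimizer_def)
    have "nrm (\<mu> n *\<^sub>R (x n - s) + (1 - \<mu> n) *\<^sub>R (y n - s)) \<le> \<mu> n * nrm (x n - s) + (1 - \<mu> n) * nrm (y n - s)"
      using nrm_triangle[of "\<mu> n *\<^sub>R (x n - s)" "(1 - \<mu> n) *\<^sub>R (y n - s)"] sV \<mu>[of n] \<epsilon> by (simp add: nrm_scale)
    also have "\<dots> \<le> \<mu> n * (nrm (x n - s) + g n) + (1 - \<mu> n) * (nrm (x n - s) + g n)"
      using \<mu>[of n] \<epsilon> g0[of n] Yle[OF s, of n] by (intro add_mono mult_left_mono) auto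
    also have "\<dots> = nrm (x n - s) + g n" by (simp add: algebra_simps)
    finally show ?thesis .
  qed
  obtain G where G: "\<And>n. g n \<le> G" 
    using summable_imp_Bseq[OF gs] by (auto simp: Bseq_def abs_le_iff)
  have conv: "convergent (\<lambda>n. nrm (x n - s))" if s: "minimizer s" for s
  proof (rule perturbed_recursion_convergent)
    have sV: "s \<in> V" using s by (simp add: minimizer_def)
    show "0 \<le> nrm (x n - s)" for n using sV by simp
    show "0 \<le> 2 * \<delta> n" for n using \<delta> by simp
    show "summable (\<lambda>n. 2 * \<delta> n)" by (intro summable_mult \<delta>)
    show "0 \<le> g n + (\<delta> n * G + \<eta> n)" for n
      using g0[of n] \<delta>(1)[of n] \<eta>(1)[of n] order.trans[OF g0[of n] G[of n]] by simp
    show "summable (\<lambda>n. g n + (\<delta> n * G + \<eta> n))" by (intro summable_add gs summable_mult2 \<delta> \<eta>)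
    fix n
    have "\<delta> n * W n \<le> \<delta> n * (2 * nrm (x n - s) + G)"
      using \<delta>(1)[of n] Wle[OF s, of n] G[of n] by (intro mult_left_mono) auto
    then show "nrm (x (Suc n) - s) \<le> (1 + 2 * \<delta> n) * nrm (x n - s) + (g n + (\<delta> n * G + \<eta> n))"
      using Xle[OF sV, of n] mid[OF s, of n] by (simp add: algebra_simps)
  qed
  obtain s where s: "minimizer s" using ex by blast
  then have sV: "s \<in> V" by (simp add: minimizer_def)
  obtain l where l: "(\<lambda>n. nrm (x n - s)) \<longlonglongrightarrow> l" using conv[OF s] by (auto simp: convergent_def)
  have g_lim: "g \<longlonglongrightarrow> 0" using gs by (rule summable_LIMSEQ_zero)
  obtain B where B: "\<And>n. nrm (x n - s) + g n \<le> B"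
  proof -
    have "(\<lambda>n. nrm (x n - s) + g n) \<longlonglongrightarrow> l + 0" by (intro tendsto_add l g_lim)
    then have "Bseq (\<lambda>n. nrm (x n - s) + g n)" by (intro convergent_imp_Bseq) (auto simp: convergent_def)
    then obtain B where "\<And>n. \<bar>nrm (x n - s) + g n\<bar> \<le> B" by (auto simp: Bseq_def)
    then show ?thesis using that by (meson abs_le_D1)
  qed
  have X0: "0 \<le> nrm (x n - s)" and Y0: "0 \<le> nrm (y n - s)" for n using sV by simp_all
  have B0: "0 \<le> B" using B[of 0] X0[of 0] g0[of 0] by linarith
  have YB: "nrm (y n - s) \<le> B" for n using Yle[OF s, of n] B[of n] by linarith
  have WB: "W n \<le> 2 * B" for n using Wle[OF s, of n] B[of n] X0[of n] g0[of n] by linarith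
  define r where "r n = \<delta> n * (2 * B) + \<eta> n" for n
  have r0: "0 \<le> r n" for n using \<delta>(1)[of n] \<eta>(1)[of n] B0 by (simp add: r_def)
  have "summable r" unfolding r_def by (intro summable_add summable_mult2 \<delta> \<eta>)
  then have r_lim: "r \<longlonglongrightarrow> 0" by (rule summable_LIMSEQ_zero)
  have W_est: "\<epsilon> * \<kappa> * (W n)\<^sup>2 \<le> (nrm (x n - s))\<^sup>2 - (nrm (x (Suc n) - s))\<^sup>2 + (g n * B + (2 * B * r n + (r n)\<^sup>2))" for n
  proof -
    define m where "m = nrm (\<mu> n *\<^sub>R (x n - s) + (1 - \<mu> n) *\<^sub>R (y n - s))"
    have m0: "0 \<le> m" unfolding m_def using sV by simp
    have mB: "m \<le> B" using mid[OF s, of n] B[of n] unfolding m_def by linarith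
    have \<mu>1: "0 \<le> 1 - \<mu> n" "\<epsilon> \<le> 1 - \<mu> n" "1 - \<mu> n \<le> 1" "0 \<le> \<mu> n" using \<mu>[of n] \<epsilon> by auto
    have "m\<^sup>2 \<le> \<mu> n * (nrm (x n - s))\<^sup>2 + (1 - \<mu> n) * (nrm (y n - s))\<^sup>2"
      using nrm2_convex_combination[of "x n - s" "y n - s" "1 - \<mu> n"] sV \<mu>1 unfolding m_def by simp
    also have "\<dots> \<le> \<mu> n * (nrm (x n - s))\<^sup>2 + (1 - \<mu> n) * ((nrm (x n - s))\<^sup>2 - \<kappa> * (W n)\<^sup>2 + g n * nrm (y n - s))"
      using \<mu>1 Ysq[OF s, of n] by (intro add_left_mono mult_left_mono) auto
    also have "\<dots> = (nrm (x n - s))\<^sup>2 - (1 - \<mu> n) * (\<kappa> * (W n)\<^sup>2) + (1 - \<mu> n) * (g n * nrm (y n - s))"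
      by (simp add: algebra_simps)
    also have "(1 - \<mu> n) * (g n * nrm (y n - s)) \<le> 1 * (g n * B)"
      using \<mu>1 g0[of n] YB[of n] Y0[of n] by (intro mult_mono) auto
    finally have 1: "m\<^sup>2 \<le> (nrm (x n - s))\<^sup>2 - (1 - \<mu> n) * (\<kappa> * (W n)\<^sup>2) + g n * B" by simp
    have 2: "\<epsilon> * (\<kappa> * (W n)\<^sup>2) \<le> (1 - \<mu> n) * (\<kappa> * (W n)\<^sup>2)"
      using \<mu>1 \<kappa> by (intro mult_right_mono) auto
    have "\<delta> n * W n \<le> \<delta> n * (2 * B)" using \<delta>(1)[of n] WB[of n] by (intro mult_left_mono)
    then have "nrm (x (Suc n) - s) \<le> m + r n" using Xle[OF sV, of n] unfolding m_def r_def by linarith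
    then have "(nrm (x (Suc n) - s))\<^sup>2 \<le> (m + r n)\<^sup>2" using X0 by (intro power_mono) auto
    also have "\<dots> = m\<^sup>2 + 2 * m * r n + (r n)\<^sup>2" by (simp add: power2_sum)
    also have "\<dots> \<le> m\<^sup>2 + 2 * B * r n + (r n)\<^sup>2" using mB r0[of n] by (intro add_mono mult_right_mono) auto
    finally show ?thesis using 1 2 by (simp add: algebra_simps)
  qed
  have W_lim: "W \<longlonglongrightarrow> 0"
  proof -
    have "(\<lambda>n. (nrm (x n - s))\<^sup>2 - (nrm (x (Suc n) - s))\<^sup>2 + (g n * B + (2 * B * r n + (r n)\<^sup>2)))
        \<longlonglongrightarrow> l\<^sup>2 - l\<^sup>2 + (0 * B + (2 * B * 0 + 0\<^sup>2))"
      by (intro tendsto_intros l LIMSEQ_Suc[OF l] g_lim r_lim)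
    then have lim0: "(\<lambda>n. (nrm (x n - s))\<^sup>2 - (nrm (x (Suc n) - s))\<^sup>2 + (g n * B + (2 * B * r n + (r n)\<^sup>2))) \<longlonglongrightarrow> 0"
      by simp
    have "(\<lambda>n. \<epsilon> * \<kappa> * (W n)\<^sup>2) \<longlonglongrightarrow> 0"
    proof (rule tendsto_sandwich[OF _ _ tendsto_const lim0])
      show "\<forall>\<^sub>F n in sequentially. 0 \<le> \<epsilon> * \<kappa> * (W n)\<^sup>2" using \<epsilon> \<kappa> by simp
    qed (use W_est in auto)
    then have "(\<lambda>n. inverse (\<epsilon> * \<kappa>) * (\<epsilon> * \<kappa> * (W n)\<^sup>2)) \<longlonglongrightarrow> inverse (\<epsilon> * \<kappa>) * 0" by (intro tendsto_intros)
    then have "(\<lambda>n. sqrt ((W n)\<^sup>2)) \<longlonglongrightarrow> sqrt 0" using \<epsilon> \<kappa> by (intro tendsto_intros) (simp add: field_simps)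
    then show ?thesis using W0 by simp
  qed
  obtain \<sigma> where \<sigma>: "f s = ereal \<sigma>" using s by (rule minimizer_finite)
  have in_sub: "\<forall>\<^sub>F n in sequentially. y n \<in> sublevel \<alpha>" if \<alpha>: "\<sigma> + \<Phi> s < \<alpha>" for \<alpha>
  proof -
    have "(\<lambda>n. \<sigma> + \<Phi> s + (W n / \<epsilon> + g n / (4 * \<beta>)) * B + \<bar>C\<bar> * (W n)\<^sup>2) \<longlonglongrightarrow> \<sigma> + \<Phi> s + (0 / \<epsilon> + 0 / (4 * \<beta>)) * B + \<bar>C\<bar> * 0\<^sup>2"
      using \<epsilon> \<beta>_pos by (intro tendsto_intros W_lim g_lim) auto
    then have "\<forall>\<^sub>F n in sequentially. \<sigma> + \<Phi> s + (W n / \<epsilon> + g n / (4 * \<beta>)) * B + \<bar>C\<bar> * (W n)\<^sup>2 < \<alpha>"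
      using \<alpha> by (intro order_tendstoD(2)) auto
    then show ?thesis
    proof eventually_elim
      case (elim n)
      obtain a where a: "f (y n) = ereal a" using prox_finite[OF mem(2) \<gamma>0[of n] y[of _ n]] by blast
      have "a + \<Phi> (y n) \<le> \<sigma> + \<Phi> s + (W n / \<gamma> n + nrm (b n)) * nrm (y n - s) + C * (W n)\<^sup>2"
        using forward_backward_gap[of "x n" "y n" "z n" "b n" "\<gamma> n", OF mem \<gamma>0 z y sV a \<sigma>] unfolding W_def by simp
      also have "\<dots> \<le> \<sigma> + \<Phi> s + (W n / \<epsilon> + g n / (4 * \<beta>)) * B + \<bar>C\<bar> * (W n)\<^sup>2"
        using W0[of n] \<gamma>[of n] \<epsilon> YB[of n] Y0[of n] \<beta>_pos
        by (intro add_mono mult_mono order.refl divide_left_mono) (auto simp: g_def intro: add_nonneg_nonneg divide_nonneg_pos)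
      finally have "a + \<Phi> (y n) \<le> \<alpha>" using elim by linarith
      then show ?case using a by (simp add: sublevel_def)
    qed
  qed
  have min_iff: "minimizer u" if u: "u \<in> V" "\<And>Q. Q \<in> {sublevel \<alpha> | \<alpha>. \<sigma> + \<Phi> s < \<alpha>} \<Longrightarrow> u \<in> Q" for u
  proof -
    have "f u + ereal (\<Phi> u) \<le> ereal (\<sigma> + \<Phi> s)"
    proof (rule ereal_le_epsilon2)
      fix e :: real assume "0 < e"
      then have "u \<in> sublevel (\<sigma> + \<Phi> s + e)" by (intro u(2)) auto
      then show "f u + ereal (\<Phi> u) \<le> ereal (\<sigma> + \<Phi> s) + ereal e" by (simp add: sublevel_def)
    qed
    also have "\<dots> = f s + ereal (\<Phi> s)" by (simp add: \<sigma>)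
    finally show ?thesis using s u by (auto simp: minimizer_def intro: order.trans)
  qed
  have "\<exists>c\<in>V. (\<forall>Q\<in>{sublevel \<alpha> | \<alpha>. \<sigma> + \<Phi> s < \<alpha>}. c \<in> Q) \<and> weakly_converges V ip x c"
  proof (rule weak_limit_in_closed_convex_sets)
    show "x n \<in> V" "y n \<in> V" for n by simp_all
    show "norm_closed Q" "convex Q" "\<forall>\<^sub>F n in sequentially. y n \<in> Q" if "Q \<in> {sublevel \<alpha> | \<alpha>. \<sigma> + \<Phi> s < \<alpha>}" for Q
      using that norm_closed_sublevel convex_sublevel in_sub by auto
    show "(\<lambda>n. nrm (x n - y n)) \<longlonglongrightarrow> 0" using W_lim by (simp add: W_def[abs_def])
    show "convergent (\<lambda>n. nrm (x n - u))" if "u \<in> V" "\<And>Q. Q \<in> {sublevel \<alpha> | \<alpha>. \<sigma> + \<Phi> s < \<alpha>} \<Longrightarrow> u \<in> Q" for u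
      using conv min_iff[OF that] by blast
    show "s \<in> V" by (rule sV)
    show "s \<in> Q" if "Q \<in> {sublevel \<alpha> | \<alpha>. \<sigma> + \<Phi> s < \<alpha>}" for Q
      using that sV \<sigma> by (auto simp: sublevel_def)
  qed
  then obtain c where "c \<in> V" "\<And>Q. Q \<in> {sublevel \<alpha> | \<alpha>. \<sigma> + \<Phi> s < \<alpha>} \<Longrightarrow> c \<in> Q" "weakly_converges V ip x c"
    by auto
  then show ?thesis by (intro exI[of _ c] conjI min_iff)
qed

end

section \<open>Smooth functions of linear maps\<close>

text \<open>
  Maps such as trace operators are linear only up to functions that vanish almost everywhere, so
  additivity and homogeneity are required only for the inner products with members of the target
  space.
\<close>

locale smooth_coupling = semi_inner_space V ip
  for V :: "'v::real_vector set" and ip +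
  fixes K :: "'k set" and W :: "'k \<Rightarrow> ('a \<Rightarrow> real) set" and ipW :: "'k \<Rightarrow> ('a \<Rightarrow> real) \<Rightarrow> ('a \<Rightarrow> real) \<Rightarrow> real"
    and \<phi> :: "'k \<Rightarrow> ('a \<Rightarrow> real) \<Rightarrow> real" and \<tau> :: "'k \<Rightarrow> real" and L :: "'k \<Rightarrow> 'v \<Rightarrow> 'a \<Rightarrow> real" and c :: "'k \<Rightarrow> real"
  assumes finite_K: "finite K"
    and smooth: "k \<in> K \<Longrightarrow> smooth_convex_function (W k) (ipW k) (\<phi> k) (\<tau> k)"
    and L_mem: "k \<in> K \<Longrightarrow> x \<in> V \<Longrightarrow> L k x \<in> W k"
    and L_add: "k \<in> K \<Longrightarrow> x \<in> V \<Longrightarrow> y \<in> V \<Longrightarrow> w \<in> W k \<Longrightarrow> ipW k w (L k (x + y)) = ipW k w (L k x) + ipW k w (L k y)"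
    and L_scale: "k \<in> K \<Longrightarrow> x \<in> V \<Longrightarrow> w \<in> W k \<Longrightarrow> ipW k w (L k (r *\<^sub>R x)) = r * ipW k w (L k x)"
    and L_bound: "k \<in> K \<Longrightarrow> x \<in> V \<Longrightarrow> norm_of (ipW k) (L k x) \<le> c k * norm_of ip x"
    and c_nonneg: "k \<in> K \<Longrightarrow> 0 \<le> c k"
begin

definition coupling :: "'v \<Rightarrow> real" where
  "coupling x = (\<Sum>k\<in>K. \<phi> k (L k x))"

definition coupling_derivative :: "'v \<Rightarrow> 'v \<Rightarrow> real" where
  "coupling_derivative x h = (\<Sum>k\<in>K. ipW k (gradient (W k) (ipW k) (\<phi> k) (L k x)) (L k h))"

text \<open>
  The vectors \<open>L k w - L k x\<close> and \<open>L k (w - x)\<close> may differ, but their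
  difference has norm zero.
\<close>

lemma coupling_term:
  assumes k: "k \<in> K" and x: "x \<in> V" and w: "w \<in> V"
  defines "g \<equiv> gradient (W k) (ipW k) (\<phi> k)"
  shows "g (L k x) \<in> W k"
    and "\<phi> k (L k x) + ipW k (g (L k x)) (L k (w - x)) \<le> \<phi> k (L k w)"
    and "\<phi> k (L k w) \<le> \<phi> k (L k x) + ipW k (g (L k x)) (L k (w - x)) + \<tau> k / 2 * (c k * nrm (w - x))\<^sup>2"
    and "(norm_of (ipW k) (g (L k x) - g (L k w)))\<^sup>2 / \<tau> k \<le> ipW k (g (L k x) - g (L k w)) (L k (x - w))"
proof -
  interpret G: smooth_convex_function "W k" "ipW k" "\<phi> k" "\<tau> k" using smooth[OF k] .
  let ?N = "norm_of (ipW k)"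
  have Lx: "L k x \<in> W k" and Lw: "L k w \<in> W k" using L_mem k x w by auto
  have diff: "ipW k v (L k y - L k y') = ipW k v (L k (y - y'))" if "v \<in> W k" "y \<in> V" "y' \<in> V" for v y y'
    using L_add[OF k, of "y - y'" y' v] that L_mem[OF k] by (simp add: G.diff_right)
  have norm: "?N (L k w - L k x) = ?N (L k (w - x))"
  proof (rule G.nrm_congruent)
    let ?e = "L k w - L k x - L k (w - x)"
    show mem: "L k w - L k x \<in> W k" "L k (w - x) \<in> W k" using Lx Lw L_mem[OF k] x w by auto
    have "ipW k ?e ?e = 0"
      using diff[of ?e w x] mem x w by (simp add: G.diff_right)
    then show "?N ?e = 0" by (simp add: norm_of_def)
  qed
  show g: "g (L k x) \<in> W k" unfolding g_def using Lx by simp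
  show "\<phi> k (L k x) + ipW k (g (L k x)) (L k (w - x)) \<le> \<phi> k (L k w)"
    using G.gradient_inequality[OF Lx Lw] diff[OF g w x] by (simp add: g_def)
  have "\<tau> k / 2 * (?N (L k (w - x)))\<^sup>2 \<le> \<tau> k / 2 * (c k * nrm (w - x))\<^sup>2"
    using L_bound[OF k, of "w - x"] x w G.\<tau>_pos L_mem[OF k]
    by (intro mult_left_mono power_mono) auto
  then show "\<phi> k (L k w) \<le> \<phi> k (L k x) + ipW k (g (L k x)) (L k (w - x)) + \<tau> k / 2 * (c k * nrm (w - x))\<^sup>2"
    using G.descent[OF Lx Lw] diff[OF g w x] unfolding norm by (simp add: g_def)
  have g': "g (L k x) - g (L k w) \<in> W k" unfolding g_def using Lx Lw by simp
  show "(norm_of (ipW k) (g (L k x) - g (L k w)))\<^sup>2 / \<tau> k \<le> ipW k (g (L k x) - g (L k w)) (L k (x - w))"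
    using G.baillon_haddad[OF Lx Lw] diff[OF g' x w] by (simp add: g_def)
qed

lemma coupling_derivative_add:
  "x \<in> V \<Longrightarrow> h \<in> V \<Longrightarrow> h' \<in> V \<Longrightarrow> coupling_derivative x (h + h') = coupling_derivative x h + coupling_derivative x h'"
  unfolding coupling_derivative_def sum.distrib[symmetric]
  by (intro sum.cong refl L_add coupling_term(1))

lemma coupling_derivative_scale:
  "x \<in> V \<Longrightarrow> h \<in> V \<Longrightarrow> coupling_derivative x (r *\<^sub>R h) = r * coupling_derivative x h"
  unfolding coupling_derivative_def sum_distrib_left
  by (intro sum.cong refl L_scale coupling_term(1))

lemma ipW_L_le:
  assumes k: "k \<in> K" and v: "v \<in> W k" and h: "h \<in> V"
  shows "\<bar>ipW k v (L k h)\<bar> \<le> norm_of (ipW k) v * c k * nrm h"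
proof -
  interpret G: smooth_convex_function "W k" "ipW k" "\<phi> k" "\<tau> k" using smooth[OF k] .
  have "\<bar>ipW k v (L k h)\<bar> \<le> norm_of (ipW k) v * norm_of (ipW k) (L k h)"
    using L_mem[OF k h] v by (intro G.cauchy_schwarz) auto
  also have "\<dots> \<le> norm_of (ipW k) v * (c k * nrm h)"
    using L_bound[OF k h] v by (intro mult_left_mono) auto
  finally show ?thesis by (simp add: mult.assoc)
qed

lemma coupling_derivative_bounded:
  assumes x: "x \<in> V"
  shows "\<exists>M\<ge>0. \<forall>h\<in>V. \<bar>coupling_derivative x h\<bar> \<le> M * nrm h"
proof (intro exI conjI ballI)
  let ?M = "\<Sum>k\<in>K. norm_of (ipW k) (gradient (W k) (ipW k) (\<phi> k) (L k x)) * c k"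
  show "0 \<le> ?M"
  proof (rule sum_nonneg)
    fix k assume k: "k \<in> K"
    interpret G: smooth_convex_function "W k" "ipW k" "\<phi> k" "\<tau> k" using smooth[OF k] .
    show "0 \<le> norm_of (ipW k) (gradient (W k) (ipW k) (\<phi> k) (L k x)) * c k"
      using L_mem[OF k x] c_nonneg[OF k] by simp
  qed
  fix h assume h: "h \<in> V"
  show "\<bar>coupling_derivative x h\<bar> \<le> ?M * nrm h"
    unfolding coupling_derivative_def sum_distrib_right
    using coupling_term(1)[OF _ x x] h by (intro order.trans[OF sum_abs] sum_mono ipW_L_le)
qed

lemma coupling_lower:
  assumes "x \<in> V" "w \<in> V"
  shows "coupling x + coupling_derivative x (w - x) \<le> coupling w"
  unfolding coupling_def coupling_derivative_def sum.distrib[symmetric]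
  using assms by (intro sum_mono coupling_term(2))

lemma coupling_upper:
  assumes "x \<in> V" "w \<in> V"
  shows "coupling w \<le> coupling x + coupling_derivative x (w - x) + (\<Sum>k\<in>K. \<tau> k / 2 * (c k)\<^sup>2) * (nrm (w - x))\<^sup>2"
proof -
  have "coupling w \<le> (\<Sum>k\<in>K. \<phi> k (L k x) + ipW k (gradient (W k) (ipW k) (\<phi> k) (L k x)) (L k (w - x)) +
      \<tau> k / 2 * (c k * nrm (w - x))\<^sup>2)"
    unfolding coupling_def using assms by (intro sum_mono coupling_term(3))
  then show ?thesis
    by (simp add: coupling_def coupling_derivative_def sum.distrib sum_distrib_right power_mult_distrib mult.assoc)
qed

text \<open>
  With \<open>d k\<close> the difference of the gradients, the difference of the derivatives at
  \<open>h\<close> is at most \<open>nrm h\<close> times the sum of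
  \<open>(norm (d k) / sqrt (\<tau> k)) * (sqrt (\<tau> k) * c k)\<close>. The Cauchy-Schwarz
  inequality for sums bounds its square by the sum of \<open>(norm (d k))\<^sup>2 / \<tau> k\<close>,
  which the Baillon-Haddad inequalities control, times \<open>card K * m\<close>.
\<close>

lemma coupling_derivative_cocoercive:
  assumes x: "x \<in> V" and u: "u \<in> V" and h: "h \<in> V" and m: "0 < m" "\<And>k. k \<in> K \<Longrightarrow> \<tau> k * (c k)\<^sup>2 \<le> m"
  shows "1 / (real (card K) * m) * (coupling_derivative x h - coupling_derivative u h)\<^sup>2
    \<le> (coupling_derivative x (x - u) - coupling_derivative u (x - u)) * (nrm h)\<^sup>2"
proof -
  define g where "g k = gradient (W k) (ipW k) (\<phi> k)" for k
  define d where "d k = g k (L k x) - g k (L k u)" for k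
  define n where "n k = norm_of (ipW k) (d k)" for k
  have \<tau>: "0 < \<tau> k" if "k \<in> K" for k using smooth_convex_function.\<tau>_pos[OF smooth[OF that]] .
  have gW: "g k (L k y) \<in> W k" if "k \<in> K" "y \<in> V" for k y
    using coupling_term(1)[of k y y] that by (simp add: g_def)
  have dW: "d k \<in> W k" and d: "ipW k (d k) (L k y) = ipW k (g k (L k x)) (L k y) - ipW k (g k (L k u)) (L k y)"
    and n0: "0 \<le> n k" if k: "k \<in> K" and y: "y \<in> V" for k y
  proof -
    interpret G: smooth_convex_function "W k" "ipW k" "\<phi> k" "\<tau> k" using smooth[OF k] .
    show "d k \<in> W k" using gW[OF k] x u by (simp add: d_def)
    then show "0 \<le> n k" by (simp add: n_def)
    show "ipW k (d k) (L k y) = ipW k (g k (L k x)) (L k y) - ipW k (g k (L k u)) (L k y)"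
      using gW[OF k] x u L_mem[OF k y] by (simp add: d_def G.diff_left)
  qed
  have D: "coupling_derivative x y - coupling_derivative u y = (\<Sum>k\<in>K. ipW k (d k) (L k y))" if "y \<in> V" for y
    unfolding coupling_derivative_def sum_subtractf[symmetric] g_def[symmetric] using d that by (intro sum.cong) auto
  let ?E = "\<Sum>k\<in>K. (n k)\<^sup>2 / \<tau> k"
  have E: "?E \<le> coupling_derivative x (x - u) - coupling_derivative u (x - u)"
    unfolding D[OF diff_mem[OF x u]] n_def d_def g_def using x u by (intro sum_mono coupling_term(4))
  have E0: "0 \<le> ?E" using \<tau> by (intro sum_nonneg) (simp add: less_imp_le)
  have "\<bar>coupling_derivative x h - coupling_derivative u h\<bar> \<le> (\<Sum>k\<in>K. n k * c k * nrm h)"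
    unfolding D[OF h] n_def using dW h by (intro order.trans[OF sum_abs] sum_mono ipW_L_le)
  then have "(coupling_derivative x h - coupling_derivative u h)\<^sup>2 \<le> (\<Sum>k\<in>K. n k * c k * nrm h)\<^sup>2"
    by (metis abs_ge_zero power2_abs power_mono)
  also have "(\<Sum>k\<in>K. n k * c k * nrm h) = (\<Sum>k\<in>K. (n k / sqrt (\<tau> k)) * (sqrt (\<tau> k) * c k)) * nrm h"
    unfolding sum_distrib_right using \<tau> by (intro sum.cong) (auto simp: less_imp_neq[THEN not_sym])
  also have "\<dots>\<^sup>2 = (\<Sum>k\<in>K. (n k / sqrt (\<tau> k)) * (sqrt (\<tau> k) * c k))\<^sup>2 * (nrm h)\<^sup>2" by (simp add: power_mult_distrib)
  also have "\<dots> \<le> ((\<Sum>k\<in>K. (n k / sqrt (\<tau> k))\<^sup>2) * (\<Sum>k\<in>K. (sqrt (\<tau> k) * c k)\<^sup>2)) * (nrm h)\<^sup>2"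
    by (intro mult_right_mono Cauchy_Schwarz_ineq_sum) simp
  also have "(\<Sum>k\<in>K. (n k / sqrt (\<tau> k))\<^sup>2) = ?E" using \<tau> by (intro sum.cong) (auto simp: power_divide less_imp_le)
  also have "?E * (\<Sum>k\<in>K. (sqrt (\<tau> k) * c k)\<^sup>2) * (nrm h)\<^sup>2 \<le> ?E * (real (card K) * m) * (nrm h)\<^sup>2"
  proof (intro mult_right_mono mult_left_mono E0)
    have "(\<Sum>k\<in>K. (sqrt (\<tau> k) * c k)\<^sup>2) \<le> (\<Sum>k\<in>K. m)"
      using \<tau> m by (intro sum_mono) (auto simp: power_mult_distrib less_imp_le)
    then show "(\<Sum>k\<in>K. (sqrt (\<tau> k) * c k)\<^sup>2) \<le> real (card K) * m" by simp
  qed simp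
  finally have le: "(coupling_derivative x h - coupling_derivative u h)\<^sup>2 \<le> ?E * (real (card K) * m) * (nrm h)\<^sup>2" .
  show ?thesis
  proof (cases "card K = 0")
    case True
    then have "K = {}" using finite_K by simp
    then have "coupling_derivative y k = 0" for y k unfolding coupling_derivative_def by simp
    then show ?thesis using True by simp
  next
    case False
    then have pos: "0 < real (card K) * m" using m by simp
    then have "1 / (real (card K) * m) * (coupling_derivative x h - coupling_derivative u h)\<^sup>2 \<le> ?E * (nrm h)\<^sup>2"
      using le by (simp add: divide_le_eq mult_ac)
    also have "\<dots> \<le> (coupling_derivative x (x - u) - coupling_derivative u (x - u)) * (nrm h)\<^sup>2"
      using E by (intro mult_right_mono) auto
    finally show ?thesis .
  qed
qed

end

section \<open>Square-integrable functions\<close>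

lemma L2_measurable [measurable_dest]: "u \<in> L2 M \<Longrightarrow> u \<in> borel_measurable M"
  by (simp add: L2_def)

lemma L2_square_integrable: "u \<in> L2 M \<Longrightarrow> integrable M (\<lambda>\<omega>. (u \<omega>)\<^sup>2)"
  by (simp add: L2_def)

lemma L2_mult_integrable:
  assumes "u \<in> L2 M" "v \<in> L2 M"
  shows "integrable M (\<lambda>\<omega>. u \<omega> * v \<omega>)"
proof (rule Bochner_Integration.integrable_bound)
  show "integrable M (\<lambda>\<omega>. (u \<omega>)\<^sup>2 + (v \<omega>)\<^sup>2)" using assms by (simp add: L2_def)
  show "(\<lambda>\<omega>. u \<omega> * v \<omega>) \<in> borel_measurable M" using assms by measurable
  have "\<bar>a * b\<bar> \<le> a\<^sup>2 + b\<^sup>2" for a b :: real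
  proof -
    have "0 \<le> (\<bar>a\<bar> - \<bar>b\<bar>)\<^sup>2 + \<bar>a\<bar>\<^sup>2 + \<bar>b\<bar>\<^sup>2" by simp
    then show ?thesis by (simp add: abs_mult power2_diff)
  qed
  then show "AE \<omega> in M. norm (u \<omega> * v \<omega>) \<le> norm ((u \<omega>)\<^sup>2 + (v \<omega>)\<^sup>2)" by simp
qed

lemma L2_add: "u \<in> L2 M \<Longrightarrow> v \<in> L2 M \<Longrightarrow> (\<lambda>\<omega>. u \<omega> + v \<omega>) \<in> L2 M"
  using L2_mult_integrable[of u M v] by (auto simp: L2_def power2_sum mult.assoc)

lemma L2_scale: "u \<in> L2 M \<Longrightarrow> (\<lambda>\<omega>. c * u \<omega>) \<in> L2 M"
  by (auto simp: L2_def power_mult_distrib)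

lemma L2_abs: "u \<in> L2 M \<Longrightarrow> (\<lambda>\<omega>. \<bar>u \<omega>\<bar>) \<in> L2 M"
  by (auto simp: L2_def)

lemma L2_zero: "(\<lambda>\<omega>. 0) \<in> L2 M"
  by (simp add: L2_def)

lemma semi_inner_space_L2: "semi_inner_space (L2 M) (L2_inner M)"
proof
  show "subspace (L2 M)"
    unfolding subspace_def by (simp add: plus_fun_def scaleR_fun_def zero_fun_def L2_add L2_scale L2_zero)
  fix x y w assume x: "x \<in> L2 M"
  show "0 \<le> L2_inner M x x" by (simp add: L2_inner_def)
  assume y: "y \<in> L2 M"
  show "L2_inner M x y = L2_inner M y x" by (simp add: L2_inner_def mult.commute)
  assume w: "w \<in> L2 M"
  show "L2_inner M (x + y) w = L2_inner M x w + L2_inner M y w"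
    using x y w by (simp add: L2_inner_def algebra_simps L2_mult_integrable)
next
  fix x w c assume "x \<in> L2 M" "w \<in> L2 M"
  show "L2_inner M (c *\<^sub>R x) w = c * L2_inner M x w"
    by (simp add: L2_inner_def algebra_simps)
qed

lemma L2_cong_AE:
  assumes "u \<in> L2 M" "v \<in> borel_measurable M" "AE \<omega> in M. u \<omega> = v \<omega>"
  shows "v \<in> L2 M"
proof -
  have "AE \<omega> in M. (u \<omega>)\<^sup>2 = (v \<omega>)\<^sup>2" using assms(3) by eventually_elim simp
  then have "integrable M (\<lambda>\<omega>. (u \<omega>)\<^sup>2) \<longleftrightarrow> integrable M (\<lambda>\<omega>. (v \<omega>)\<^sup>2)"
    using L2_measurable[OF assms(1)] assms(2) by (intro integrable_cong_AE borel_measurable_power)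
  then show ?thesis using assms by (simp add: L2_def)
qed

lemma L2_inner_cong_AE:
  assumes "u \<in> borel_measurable M" "v \<in> borel_measurable M" "w \<in> borel_measurable M" "AE \<omega> in M. u \<omega> = v \<omega>"
  shows "L2_inner M u w = L2_inner M v w" "L2_inner M w u = L2_inner M w v"
  unfolding L2_inner_def using assms by (auto intro!: integral_cong_AE)

lemma L2_norm_cong_AE:
  assumes "u \<in> borel_measurable M" "v \<in> borel_measurable M" "AE \<omega> in M. u \<omega> = v \<omega>"
  shows "norm_of (L2_inner M) u = norm_of (L2_inner M) v"
  using assms by (simp add: norm_of_def L2_inner_def) (auto intro!: integral_cong_AE)

lemma L2_norm_power2: "(norm_of (L2_inner M) u)\<^sup>2 = (\<integral>\<omega>. (u \<omega>)\<^sup>2 \<partial>M)"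
  by (simp add: norm_of_def L2_inner_def power2_eq_square)

text \<open>
  The theorem of Riesz and Fischer for absolutely convergent series. Monotone convergence applied to
  the squares of the partial sums of \<open>\<bar>u k\<bar>\<close>, whose integrals are bounded by
  Minkowski's inequality, shows that these partial sums are bounded almost everywhere.
\<close>

lemma L2_series:
  assumes u: "\<And>k. u k \<in> L2 M" and s: "summable (\<lambda>k. norm_of (L2_inner M) (u k))"
  shows "AE \<omega> in M. summable (\<lambda>k. \<bar>u k \<omega>\<bar>)"
    and "(\<lambda>\<omega>. \<Sum>k. u k \<omega>) \<in> L2 M"
    and "norm_of (L2_inner M) (\<lambda>\<omega>. \<Sum>k. u k \<omega>) \<le> (\<Sum>k. norm_of (L2_inner M) (u k))"
proof -
  interpret L: semi_inner_space "L2 M" "L2_inner M" by (rule semi_inner_space_L2)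
  let ?N = "norm_of (L2_inner M)"
  define S where "S = (\<Sum>k. ?N (u k))"
  have um [measurable]: "u k \<in> borel_measurable M" for k using u by (simp add: L2_def)
  define W where "W n = (\<Sum>k<n. (\<lambda>\<omega>. \<bar>u k \<omega>\<bar>))" for n
  have W_apply: "W n \<omega> = (\<Sum>k<n. \<bar>u k \<omega>\<bar>)" for n \<omega>
    unfolding W_def by (induction n) auto
  have WL: "W n \<in> L2 M" for n unfolding W_def by (intro L.sum_mem L2_abs u)
  have S0: "0 \<le> S" unfolding S_def using s u by (intro suminf_nonneg) auto
  have WS: "(\<integral>\<omega>. (W n \<omega>)\<^sup>2 \<partial>M) \<le> S\<^sup>2" for n
  proof -
    have "?N (W n) \<le> (\<Sum>k<n. ?N (\<lambda>\<omega>. \<bar>u k \<omega>\<bar>))"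
      unfolding W_def by (intro L.nrm_sum_le L2_abs u)
    also have "\<dots> = (\<Sum>k<n. ?N (u k))" by (simp add: norm_of_def L2_inner_def abs_mult_self_eq)
    also have "\<dots> \<le> S" unfolding S_def using s u by (intro sum_le_suminf) auto
    finally have "(?N (W n))\<^sup>2 \<le> S\<^sup>2" using WL by (intro power_mono) auto
    then show ?thesis by (simp add: L2_norm_power2)
  qed
  define Z where "Z \<omega> = (SUP n. ennreal ((W n \<omega>)\<^sup>2))" for \<omega>
  have Wm [measurable]: "W n \<in> borel_measurable M" for n using WL by (simp add: L2_def)
  have Zm [measurable]: "Z \<in> borel_measurable M" unfolding Z_def by measurable
  have W0: "0 \<le> W n \<omega>" for n \<omega> by (simp add: W_apply sum_nonneg)
  have Wmono: "W n \<omega> \<le> W (Suc n) \<omega>" for n \<omega> by (simp add: W_apply)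
  have "(\<integral>\<^sup>+\<omega>. Z \<omega> \<partial>M) = (SUP n. \<integral>\<^sup>+\<omega>. ennreal ((W n \<omega>)\<^sup>2) \<partial>M)"
    unfolding Z_def using W0 Wmono
    by (intro nn_integral_monotone_convergence_SUP incseq_SucI le_funI ennreal_leI power_mono) auto
  also have "\<dots> \<le> ennreal (S\<^sup>2)"
  proof (rule SUP_least)
    fix n
    have "(\<integral>\<^sup>+\<omega>. ennreal ((W n \<omega>)\<^sup>2) \<partial>M) = ennreal (\<integral>\<omega>. (W n \<omega>)\<^sup>2 \<partial>M)"
      using WL[of n] by (intro nn_integral_eq_integral) (auto simp: L2_def)
    then show "(\<integral>\<^sup>+\<omega>. ennreal ((W n \<omega>)\<^sup>2) \<partial>M) \<le> ennreal (S\<^sup>2)" using WS[of n] by (simp add: ennreal_leI)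
  qed
  finally have Zint: "(\<integral>\<^sup>+\<omega>. Z \<omega> \<partial>M) \<le> ennreal (S\<^sup>2)" .
  then have "(\<integral>\<^sup>+\<omega>. Z \<omega> \<partial>M) \<noteq> \<infinity>" by (auto simp: top_unique)
  then have "AE \<omega> in M. Z \<omega> \<noteq> \<infinity>" by (intro nn_integral_PInf_AE Zm)
  then show ae: "AE \<omega> in M. summable (\<lambda>k. \<bar>u k \<omega>\<bar>)"
  proof (rule AE_mp, intro AE_I2 impI)
    fix \<omega> assume "Z \<omega> \<noteq> \<infinity>"
    then obtain z where z: "Z \<omega> = ennreal z" "0 \<le> z" by (cases "Z \<omega>") auto
    have "ennreal ((W n \<omega>)\<^sup>2) \<le> ennreal z" for n unfolding z(1)[symmetric] Z_def by (intro SUP_upper) simp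
    then have "(W n \<omega>)\<^sup>2 \<le> z" for n using z(2) by simp
    then have "W n \<omega> \<le> sqrt z" for n by (intro real_le_rsqrt)
    then show "summable (\<lambda>k. \<bar>u k \<omega>\<bar>)" by (intro summableI_nonneg_bounded[where x = "sqrt z"]) (auto simp: W_apply)
  qed
  define v where "v \<omega> = (\<Sum>k. u k \<omega>)" for \<omega>
  have vm [measurable]: "v \<in> borel_measurable M" unfolding v_def by measurable
  have vZ: "AE \<omega> in M. ennreal ((v \<omega>)\<^sup>2) \<le> Z \<omega>"
    using ae
  proof (rule AE_mp, intro AE_I2 impI)
    fix \<omega> assume sm: "summable (\<lambda>k. \<bar>u k \<omega>\<bar>)"
    have "(\<lambda>n. W n \<omega>) \<longlonglongrightarrow> (\<Sum>k. \<bar>u k \<omega>\<bar>)" unfolding W_apply using sm by (rule summable_LIMSEQ)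
    then have "(\<lambda>n. ennreal ((W n \<omega>)\<^sup>2)) \<longlonglongrightarrow> ennreal ((\<Sum>k. \<bar>u k \<omega>\<bar>)\<^sup>2)" by (intro tendsto_ennrealI tendsto_intros)
    then have "ennreal ((\<Sum>k. \<bar>u k \<omega>\<bar>)\<^sup>2) \<le> Z \<omega>"
      unfolding Z_def by (rule LIMSEQ_le_const2) (intro exI allI impI SUP_upper UNIV_I)
    moreover have "(v \<omega>)\<^sup>2 \<le> (\<Sum>k. \<bar>u k \<omega>\<bar>)\<^sup>2"
      using summable_rabs[OF sm] unfolding v_def by (metis abs_ge_zero power2_abs power_mono)
    ultimately show "ennreal ((v \<omega>)\<^sup>2) \<le> Z \<omega>" by (meson ennreal_leI order.trans)
  qed
  have vint: "(\<integral>\<^sup>+\<omega>. ennreal ((v \<omega>)\<^sup>2) \<partial>M) \<le> ennreal (S\<^sup>2)"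
    using nn_integral_mono_AE[OF vZ] Zint by (rule order.trans)
  have int: "integrable M (\<lambda>\<omega>. (v \<omega>)\<^sup>2)"
    using vint by (intro integrableI_nonneg) (auto simp: top_unique less_top[symmetric])
  then show "v \<in> L2 M" by (simp add: L2_def)
  have "ennreal (\<integral>\<omega>. (v \<omega>)\<^sup>2 \<partial>M) \<le> ennreal (S\<^sup>2)"
    using vint nn_integral_eq_integral[OF int] by simp
  then have "(?N v)\<^sup>2 \<le> S\<^sup>2" by (simp add: L2_norm_power2)
  then show "?N v \<le> S" using S0 by (rule power2_le_imp_le)
qed

lemma L2_series_tendsto:
  assumes u: "\<And>k. u k \<in> L2 M" and s: "summable (\<lambda>k. norm_of (L2_inner M) (u k))"
  shows "(\<lambda>n. norm_of (L2_inner M) (\<lambda>\<omega>. (\<Sum>k. u k \<omega>) - (\<Sum>k<n. u k \<omega>))) \<longlonglongrightarrow> 0"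
proof -
  interpret L: semi_inner_space "L2 M" "L2_inner M" by (rule semi_inner_space_L2)
  let ?N = "norm_of (L2_inner M)"
  have um [measurable]: "u k \<in> borel_measurable M" for k using u by (simp add: L2_def)
  have vm [measurable]: "(\<lambda>\<omega>. \<Sum>k. u k \<omega>) \<in> borel_measurable M" using L2_series(2)[OF u s] by (simp add: L2_def)
  have le: "?N (\<lambda>\<omega>. (\<Sum>k. u k \<omega>) - (\<Sum>k<n. u k \<omega>)) \<le> (\<Sum>k. ?N (u (k + n)))" for n
  proof -
    have sn: "summable (\<lambda>k. ?N (u (k + n)))" using s by (rule summable_ignore_initial_segment)
    have um' [measurable]: "(\<lambda>\<omega>. \<Sum>k. u (k + n) \<omega>) \<in> borel_measurable M"
      using L2_series(2)[OF u sn] by (simp add: L2_def)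
    have "?N (\<lambda>\<omega>. (\<Sum>k. u k \<omega>) - (\<Sum>k<n. u k \<omega>)) = ?N (\<lambda>\<omega>. \<Sum>k. u (k + n) \<omega>)"
    proof (rule L2_norm_cong_AE)
      show "AE \<omega> in M. (\<Sum>k. u k \<omega>) - (\<Sum>k<n. u k \<omega>) = (\<Sum>k. u (k + n) \<omega>)"
        using L2_series(1)[OF u s] by eventually_elim (rule suminf_minus_initial_segment[symmetric, OF summable_rabs_cancel])
    qed measurable
    also have "\<dots> \<le> (\<Sum>k. ?N (u (k + n)))" by (rule L2_series(3)[OF u sn])
    finally show ?thesis .
  qed
  have lim: "(\<lambda>n. \<Sum>k. ?N (u (k + n))) \<longlonglongrightarrow> 0" using s by (rule suminf_exist_split2)
  have ge: "0 \<le> ?N (\<lambda>\<omega>. (\<Sum>k. u k \<omega>) - (\<Sum>k<n. u k \<omega>))" for n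
    by (simp add: norm_of_def L2_inner_def)
  show ?thesis
    by (rule tendsto_sandwich[OF always_eventually always_eventually tendsto_const lim]) (use ge le in blast)+
qed

section \<open>Smooth bumps and the fundamental lemma\<close>

text \<open>
  The polynomial factor makes the family closed under differentiation, so that one computation of the
  derivative gives smoothness.
\<close>

definition flat_exp :: "real poly \<Rightarrow> real \<Rightarrow> real" where
  "flat_exp P t = (if 0 < t then poly P (inverse t) * exp (- inverse t) else 0)"

lemma poly_times_exp_neg_tendsto_0: "((\<lambda>s. poly P s * exp (- s)) \<longlongrightarrow> (0::real)) at_top"
proof -
  have "((\<lambda>s. \<Sum>i\<le>degree P. coeff P i * (s ^ i / exp s)) \<longlongrightarrow> (\<Sum>i\<le>degree P. coeff P i * 0)) at_top"
    by (intro tendsto_intros tendsto_power_div_exp_0)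
  moreover have "(\<lambda>s. \<Sum>i\<le>degree P. coeff P i * (s ^ i / exp s)) = (\<lambda>s. poly P s * exp (- s))"
    by (auto simp: fun_eq_iff poly_altdef sum_distrib_right exp_minus divide_inverse mult.assoc)
  ultimately show ?thesis by simp
qed

lemma DERIV_flat_exp:
  "(flat_exp P has_real_derivative flat_exp ([:0, 0, 1:] * (P - pderiv P)) t) (at t)"
proof -
  consider "t < 0" | "t = 0" | "0 < t" by linarith
  then show ?thesis
  proof cases
    case 1
    have "((\<lambda>_. 0) has_real_derivative 0) (at t)" by simp
    then have "(flat_exp P has_real_derivative 0) (at t)"
      by (rule has_field_derivative_transform_within_open[where S = "{..<0}"]) (use 1 in \<open>auto simp: flat_exp_def\<close>)
    then show ?thesis using 1 by (simp add: flat_exp_def)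
  next
    case 2
    have "((\<lambda>h. (flat_exp P (0 + h) - flat_exp P 0) / h) \<longlongrightarrow> 0) (at 0)"
    proof (rule filterlim_split_at)
      have "\<forall>\<^sub>F h in at_left 0. (0::real) = (flat_exp P (0 + h) - flat_exp P 0) / h"
        by (rule eventually_at_leftI[of "-1"]) (auto simp: flat_exp_def)
      then show "((\<lambda>h. (flat_exp P (0 + h) - flat_exp P 0) / h) \<longlongrightarrow> 0) (at_left 0)"
        by (rule Lim_transform_eventually[rotated]) simp
      have "((\<lambda>s. poly (P * [:0, 1:]) s * exp (- s)) \<longlongrightarrow> (0::real)) at_top"
        by (rule poly_times_exp_neg_tendsto_0)
      then have "((\<lambda>h. poly (P * [:0, 1:]) (inverse h) * exp (- inverse h)) \<longlongrightarrow> (0::real)) (at_right 0)"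
        by (rule filterlim_compose[OF _ filterlim_inverse_at_top_right])
      moreover have "\<forall>\<^sub>F h in at_right 0. poly (P * [:0, 1:]) (inverse h) * exp (- inverse h) = (flat_exp P (0 + h) - flat_exp P 0) / h"
        by (rule eventually_at_rightI[of 0 1]) (auto simp: flat_exp_def field_simps)
      ultimately show "((\<lambda>h. (flat_exp P (0 + h) - flat_exp P 0) / h) \<longlongrightarrow> 0) (at_right 0)"
        by (rule Lim_transform_eventually)
    qed
    then have "(flat_exp P has_real_derivative 0) (at 0)" by (simp add: DERIV_def)
    then show ?thesis using 2 by (simp add: flat_exp_def)
  next
    case 3
    have "((\<lambda>t. poly P (inverse t) * exp (- inverse t)) has_real_derivative
        poly ([:0, 0, 1:] * (P - pderiv P)) (inverse t) * exp (- inverse t)) (at t)"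
      using 3 by (auto intro!: derivative_eq_intros poly_DERIV[THEN DERIV_chain2] simp: power2_eq_square algebra_simps divide_simps)
    then have "(flat_exp P has_real_derivative poly ([:0, 0, 1:] * (P - pderiv P)) (inverse t) * exp (- inverse t)) (at t)"
      by (rule has_field_derivative_transform_within_open[where S = "{0<..}"]) (use 3 in \<open>auto simp: flat_exp_def\<close>)
    then show ?thesis using 3 by (simp add: flat_exp_def)
  qed
qed

lemma C_k_Suc_has_derivative:
  assumes "\<And>\<omega>. (f has_derivative f' \<omega>) (at \<omega>)" "\<And>b. b \<in> Basis \<Longrightarrow> C_k k (\<lambda>\<omega>. f' \<omega> b)"
  shows "C_k (Suc k) f"
proof -
  have "frechet_derivative f (at \<omega>) = f' \<omega>" for \<omega> using frechet_derivative_at[OF assms(1)] by simp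
  then show ?thesis using assms by (auto simp: differentiable_def)
qed

lemma C_k_SucD: "C_k (Suc k) f \<Longrightarrow> C_k k f"
proof (induction k arbitrary: f)
  case 0
  then show ?case by (auto intro!: continuous_at_imp_continuous_on differentiable_imp_continuous_within)
next
  case (Suc k)
  then show ?case by (metis C_k.simps(2))
qed

lemma C_k_has_derivative: "C_k (Suc k) f \<Longrightarrow> (f has_derivative frechet_derivative f (at \<omega>)) (at \<omega>)"
  by (simp add: frechet_derivative_works)

lemma C_k_add: "C_k k f \<Longrightarrow> C_k k g \<Longrightarrow> C_k k (\<lambda>\<omega>. f \<omega> + g \<omega>)"
proof (induction k arbitrary: f g)
  case 0
  then show ?case by (simp add: continuous_on_add)
next
  case (Suc k)
  show ?case
  proof (rule C_k_Suc_has_derivative)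
    show "((\<lambda>\<omega>. f \<omega> + g \<omega>) has_derivative (\<lambda>h. frechet_derivative f (at \<omega>) h + frechet_derivative g (at \<omega>) h)) (at \<omega>)" for \<omega>
      using Suc.prems by (intro has_derivative_add C_k_has_derivative)
    show "C_k k (\<lambda>\<omega>. frechet_derivative f (at \<omega>) b + frechet_derivative g (at \<omega>) b)" if "b \<in> Basis" for b
      using Suc that by simp
  qed
qed

lemma C_k_mult: "C_k k f \<Longrightarrow> C_k k g \<Longrightarrow> C_k k (\<lambda>\<omega>. f \<omega> * g \<omega>)"
proof (induction k arbitrary: f g)
  case 0
  then show ?case by (simp add: continuous_on_mult)
next
  case (Suc k)
  show ?case
  proof (rule C_k_Suc_has_derivative)
    show "((\<lambda>\<omega>. f \<omega> * g \<omega>) has_derivative (\<lambda>h. f \<omega> * frechet_derivative g (at \<omega>) h + frechet_derivative f (at \<omega>) h * g \<omega>)) (at \<omega>)" for \<omega>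
      using Suc.prems by (intro has_derivative_mult C_k_has_derivative)
    show "C_k k (\<lambda>\<omega>. f \<omega> * frechet_derivative g (at \<omega>) b + frechet_derivative f (at \<omega>) b * g \<omega>)" if "b \<in> Basis" for b
      using Suc.prems C_k_SucD that by (intro C_k_add Suc.IH) (auto simp del: C_k.simps(1))
  qed
qed

lemma C_k_const: "C_k k (\<lambda>\<omega>. c)"
proof (induction k arbitrary: c)
  case (Suc k)
  show ?case by (rule C_k_Suc_has_derivative[where f' = "\<lambda>_ _. 0"]) (use Suc in auto)
qed simp

lemma C_k_prod: "(\<And>i. i \<in> I \<Longrightarrow> C_k k (f i)) \<Longrightarrow> C_k k (\<lambda>\<omega>. \<Prod>i\<in>I. f i \<omega>)"
  by (induction I rule: infinite_finite_induct) (auto intro: C_k_const C_k_mult)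

lemma C_k_flat_exp: "C_k k (\<lambda>\<omega>. flat_exp P (\<omega> \<bullet> v + c))"
proof (induction k arbitrary: P)
  case 0
  have "continuous_on UNIV (flat_exp P)"
    using DERIV_flat_exp by (meson DERIV_isCont continuous_at_imp_continuous_on)
  then show ?case by (auto intro!: continuous_intros continuous_on_compose2[where f = "\<lambda>\<omega>. \<omega> \<bullet> v + c"])
next
  case (Suc k)
  let ?P' = "[:0, 0, 1:] * (P - pderiv P)"
  show ?case
  proof (rule C_k_Suc_has_derivative)
    show "((\<lambda>\<omega>. flat_exp P (\<omega> \<bullet> v + c)) has_derivative (\<lambda>h. flat_exp ?P' (\<omega> \<bullet> v + c) * (h \<bullet> v))) (at \<omega>)" for \<omega>
    proof -
      have "((\<lambda>\<omega>. \<omega> \<bullet> v + c) has_derivative (\<lambda>h. h \<bullet> v)) (at \<omega>)" by (auto intro!: derivative_eq_intros)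
      moreover have "(flat_exp P has_derivative (*) (flat_exp ?P' (\<omega> \<bullet> v + c))) (at (\<omega> \<bullet> v + c))"
        using DERIV_flat_exp[of P] by (simp add: has_field_derivative_def)
      ultimately show ?thesis using has_derivative_compose by blast
    qed
    show "C_k k (\<lambda>\<omega>. flat_exp ?P' (\<omega> \<bullet> v + c) * (b \<bullet> v))" for b by (intro C_k_mult Suc.IH C_k_const)
  qed
qed

text \<open>
  The powers \<open>exp (- 1 / (n t))\<close> of \<open>exp (- 1 / t)\<close> increase to 1 for
  \<open>t > 0\<close>, so these products are smooth functions, positive exactly on the box, that tend
  to its indicator. The arguments are in the form \<open>\<omega> \<bullet> v + c\<close> in which
  smoothness is known.
\<close>

definition box_bump :: "nat \<Rightarrow> 'a::euclidean_space \<Rightarrow> 'a \<Rightarrow> 'a \<Rightarrow> real" where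
  "box_bump n a c \<omega> = (\<Prod>b\<in>Basis. flat_exp 1 (\<omega> \<bullet> (real (Suc n) *\<^sub>R b) + - real (Suc n) * (a \<bullet> b)) *
    flat_exp 1 (\<omega> \<bullet> (- real (Suc n) *\<^sub>R b) + real (Suc n) * (c \<bullet> b)))"

lemma flat_exp_1: "flat_exp 1 t = (if 0 < t then exp (- inverse t) else 0)"
  by (simp add: flat_exp_def)

lemma box_bump_altdef: "box_bump n a c \<omega> = (\<Prod>b\<in>Basis. flat_exp 1 (real (Suc n) * ((\<omega> - a) \<bullet> b)) * flat_exp 1 (real (Suc n) * ((c - \<omega>) \<bullet> b)))"
  unfolding box_bump_def by (simp add: algebra_simps)

lemma box_bump_outside: "\<omega> \<notin> box a c \<Longrightarrow> box_bump n a c \<omega> = 0"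
  unfolding box_bump_altdef by (auto simp: mem_box flat_exp_1 inner_diff_left zero_less_mult_iff)

lemma box_bump_bounds: "0 \<le> box_bump n a c \<omega>" "box_bump n a c \<omega> \<le> 1"
proof -
  have "0 \<le> flat_exp 1 t" "flat_exp 1 t \<le> 1" for t by (auto simp: flat_exp_1)
  then show "0 \<le> box_bump n a c \<omega>" "box_bump n a c \<omega> \<le> 1"
    unfolding box_bump_altdef by (auto intro!: prod_nonneg prod_le_1 mult_le_one)
qed

lemma box_bump_tendsto: "(\<lambda>n. box_bump n a c \<omega>) \<longlonglongrightarrow> indicator (box a c) \<omega>"
proof (cases "\<omega> \<in> box a c")
  case True
  have *: "(\<lambda>n. flat_exp 1 (real (Suc n) * t)) \<longlonglongrightarrow> 1" if t: "0 < t" for t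
  proof -
    have "(\<lambda>n. exp (- (inverse t * (1 / real (Suc n))))) \<longlonglongrightarrow> exp (- (inverse t * 0))"
      by (intro tendsto_intros LIMSEQ_Suc lim_1_over_n)
    moreover have "(\<lambda>n. exp (- (inverse t * (1 / real (Suc n))))) = (\<lambda>n. flat_exp 1 (real (Suc n) * t))"
      using t by (auto simp: flat_exp_1 fun_eq_iff field_simps zero_less_mult_iff add_pos_nonneg)
    ultimately show ?thesis by simp
  qed
  have "(\<lambda>n. box_bump n a c \<omega>) \<longlonglongrightarrow> (\<Prod>b\<in>(Basis::'a set). 1 * 1)"
    unfolding box_bump_altdef using True by (intro tendsto_prod tendsto_mult *) (auto simp: mem_box inner_diff_left)
  then show ?thesis using True by simp
qed (simp add: box_bump_outside)

lemma box_bump_test_function: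
  fixes a c :: "'a::euclidean_space"
  assumes "cbox a c \<subseteq> \<Omega>"
  shows "box_bump n a c \<in> test_functions \<Omega>"
proof -
  have "{\<omega>. box_bump n a c \<omega> \<noteq> 0} \<subseteq> cbox a c"
    using box_bump_outside[of _ a c n] box_subset_cbox[of a c] by blast
  then have sub: "closure {\<omega>. box_bump n a c \<omega> \<noteq> 0} \<subseteq> cbox a c" by (intro closure_minimal closed_cbox)
  then have "compact (closure {\<omega>. box_bump n a c \<omega> \<noteq> 0})"
    by (meson bounded_cbox bounded_subset closed_closure compact_eq_bounded_closed)
  moreover have "C_k k (box_bump n a c)" for k
    unfolding box_bump_def by (intro C_k_prod C_k_mult C_k_flat_exp)
  ultimately show ?thesis using sub assms unfolding test_functions_def by blast
qed

lemma test_function_C_k: "\<psi> \<in> test_functions \<Omega> \<Longrightarrow> C_k k \<psi>"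
  by (simp add: test_functions_def)

lemma continuous_compact_support_L2:
  fixes \<psi> :: "'a::euclidean_space \<Rightarrow> real"
  assumes "continuous_on UNIV \<psi>" "compact S" "\<And>\<omega>. \<omega> \<notin> S \<Longrightarrow> \<psi> \<omega> = 0" "\<Omega> \<in> sets lebesgue"
  shows "\<psi> \<in> L2 (lebesgue_on \<Omega>)"
proof -
  have m: "\<psi> \<in> borel_measurable (lebesgue_on \<Omega>)"
    using assms(1) by (intro measurable_restrict_space1 measurable_completion) (simp add: borel_measurable_continuous_onI)
  obtain B where B: "\<And>\<omega>. \<omega> \<in> S \<Longrightarrow> (\<psi> \<omega>)\<^sup>2 \<le> B"
  proof -
    have "compact ((\<lambda>\<omega>. (\<psi> \<omega>)\<^sup>2) ` S)" using assms
      by (intro compact_continuous_image continuous_intros) (auto intro: continuous_on_subset)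
    then obtain B where "\<And>\<omega>. \<omega> \<in> S \<Longrightarrow> \<bar>(\<psi> \<omega>)\<^sup>2\<bar> \<le> B"
      by (metis bounded_iff compact_imp_bounded imageI real_norm_def)
    then show ?thesis using that[of B] by simp
  qed
  have "integrable (lebesgue_on \<Omega>) (\<lambda>\<omega>. B * indicator S \<omega>)"
  proof -
    have "S \<in> lmeasurable" using assms(2) by (rule lmeasurable_compact)
    then have fm: "S \<inter> \<Omega> \<in> lmeasurable" using assms(4) by (rule fmeasurable_Int_fmeasurable)
    have "integrable lebesgue (indicator (S \<inter> \<Omega>) :: 'a \<Rightarrow> real)"
      using fm by (intro integrable_real_indicator) (simp_all only: fmeasurable_def mem_Collect_eq)
    also have "indicator (S \<inter> \<Omega>) = (\<lambda>\<omega>. indicator \<Omega> \<omega> *\<^sub>R (indicator S \<omega> :: real))"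
      by (auto simp: indicator_def fun_eq_iff)
    finally have "integrable lebesgue (\<lambda>\<omega>. indicator \<Omega> \<omega> *\<^sub>R (indicator S \<omega> :: real))" .
    then have "integrable (lebesgue_on \<Omega>) (indicator S :: 'a \<Rightarrow> real)"
      using assms(4) by (subst integrable_restrict_space) auto
    then show ?thesis by simp
  qed
  then have "integrable (lebesgue_on \<Omega>) (\<lambda>\<omega>. (\<psi> \<omega>)\<^sup>2)"
  proof (rule Bochner_Integration.integrable_bound)
    show "AE \<omega> in lebesgue_on \<Omega>. norm ((\<psi> \<omega>)\<^sup>2) \<le> norm (B * indicator S \<omega>)"
    proof (rule AE_I2)
      fix \<omega>
      show "norm ((\<psi> \<omega>)\<^sup>2) \<le> norm (B * indicator S \<omega>)"
        using B[of \<omega>] assms(3)[of \<omega>] by (cases "\<omega> \<in> S") (auto intro: order.trans[OF _ abs_ge_self])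
    qed
  qed (use m in measurable)
  with m show ?thesis by (simp add: L2_def)
qed

lemma test_function_L2:
  fixes \<psi> :: "'a::euclidean_space \<Rightarrow> real"
  assumes \<psi>: "\<psi> \<in> test_functions \<Omega>" and \<Omega>: "\<Omega> \<in> sets lebesgue"
  shows "\<psi> \<in> L2 (lebesgue_on \<Omega>)"
    and "b \<in> Basis \<Longrightarrow> (\<lambda>\<omega>. frechet_derivative \<psi> (at \<omega>) b) \<in> L2 (lebesgue_on \<Omega>)"
proof -
  let ?S = "closure {\<omega>. \<psi> \<omega> \<noteq> 0}"
  have S: "compact ?S" using \<psi> by (simp add: test_functions_def)
  have out: "\<psi> \<omega> = 0" if "\<omega> \<notin> ?S" for \<omega> using that closure_subset[of "{\<omega>. \<psi> \<omega> \<noteq> 0}"] by auto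
  have "continuous_on UNIV \<psi>" using test_function_C_k[OF \<psi>, of 0] by simp
  then show "\<psi> \<in> L2 (lebesgue_on \<Omega>)" using S out \<Omega> by (rule continuous_compact_support_L2)
  assume b: "b \<in> Basis"
  have "continuous_on UNIV (\<lambda>\<omega>. frechet_derivative \<psi> (at \<omega>) b)" using test_function_C_k[OF \<psi>, of 1] b by simp
  then show "(\<lambda>\<omega>. frechet_derivative \<psi> (at \<omega>) b) \<in> L2 (lebesgue_on \<Omega>)"
  proof (rule continuous_compact_support_L2[OF _ S _ \<Omega>])
    fix \<omega> assume \<omega>: "\<omega> \<notin> ?S"
    have "(\<psi> has_derivative (\<lambda>h. 0)) (at \<omega>)"
    proof (rule has_derivative_transform_within_open[OF has_derivative_const])
      show "open (- ?S)" by (intro open_Compl closed_closure)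
      show "\<omega> \<in> - ?S" using \<omega> by simp
      show "0 = \<psi> w" if "w \<in> - ?S" for w using that by (intro out[symmetric]) simp
    qed
    then have "frechet_derivative \<psi> (at \<omega>) = (\<lambda>h. 0)" by (rule frechet_derivative_at[symmetric])
    then show "frechet_derivative \<psi> (at \<omega>) b = 0" by simp
  qed
qed

text \<open>
  Testing with the bumps and passing to the limit shows that the integral of \<open>g\<close> vanishes
  over all boxes inside the open set; by Lebesgue's differentiation theorem \<open>g\<close> is almost
  everywhere a limit of averages over small boxes.
\<close>

lemma fundamental_lemma:
  fixes g :: "'a::euclidean_space \<Rightarrow> real"
  assumes \<Omega>: "open \<Omega>" and g: "g \<in> L2 (lebesgue_on \<Omega>)"
    and orth: "\<And>\<psi>. \<psi> \<in> test_functions \<Omega> \<Longrightarrow> (\<integral>\<omega>. g \<omega> * \<psi> \<omega> \<partial>(lebesgue_on \<Omega>)) = 0"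
  shows "AE \<omega> in lebesgue_on \<Omega>. g \<omega> = 0"
proof -
  have \<Omega>s: "\<Omega> \<in> sets lebesgue" using \<Omega> by simp
  have gm [measurable]: "g \<in> borel_measurable (lebesgue_on \<Omega>)" using g by (rule L2_measurable)
  define F where "F \<omega> = indicator \<Omega> \<omega> * g \<omega>" for \<omega>
  have Fm: "F \<in> borel_measurable lebesgue"
    using gm \<Omega>s borel_measurable_restrict_space_iff[of \<Omega> lebesgue g] by (simp add: F_def[abs_def])
  have F2: "F \<in> L2 lebesgue"
  proof -
    have "integrable lebesgue (\<lambda>\<omega>. indicator \<Omega> \<omega> *\<^sub>R (g \<omega>)\<^sup>2)"
      using L2_square_integrable[OF g] \<Omega>s by (subst (asm) integrable_restrict_space) auto
    moreover have "(\<lambda>\<omega>. indicator \<Omega> \<omega> *\<^sub>R (g \<omega>)\<^sup>2) = (\<lambda>\<omega>. (F \<omega>)\<^sup>2)"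
      by (auto simp: F_def fun_eq_iff indicator_def)
    ultimately show ?thesis using Fm by (simp add: L2_def)
  qed
  have ind: "(indicator (cbox a c) :: 'a \<Rightarrow> real) \<in> L2 lebesgue" for a c :: 'a
  proof -
    have "integrable lebesgue (indicator (cbox a c) :: 'a \<Rightarrow> real)"
      using lmeasurable_cbox[of a c] by (intro integrable_real_indicator) (auto simp: fmeasurable_def)
    moreover have "(\<lambda>\<omega>. (indicator (cbox a c) \<omega> :: real)\<^sup>2) = indicator (cbox a c)" by (auto simp: indicator_def)
    ultimately show ?thesis by (simp add: L2_def)
  qed
  have abs: "set_integrable lebesgue (cbox a c) F" for a c
    using L2_mult_integrable[OF ind F2, of a c] by (simp add: set_integrable_def)
  have Fint: "F integrable_on cbox a c" for a c
    using abs by (simp add: set_lebesgue_integral_eq_integral(1))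
  have zero: "integral (cbox a c) F = 0" if ac: "cbox a c \<subseteq> \<Omega>" for a c
  proof -
    let ?I = "\<lambda>n. \<integral>\<omega>. F \<omega> * box_bump n a c \<omega> \<partial>lebesgue"
    have In: "?I n = 0" for n
    proof -
      have "(\<integral>\<omega>. g \<omega> * box_bump n a c \<omega> \<partial>(lebesgue_on \<Omega>)) = ?I n"
        using \<Omega>s by (subst integral_restrict_space) (auto simp: F_def mult.assoc)
      then show ?thesis using orth[OF box_bump_test_function[OF ac]] by simp
    qed
    have bm: "box_bump n a c \<in> borel_measurable lebesgue" for n
    proof -
      have "continuous_on UNIV (box_bump n a c)"
        using test_function_C_k[OF box_bump_test_function[OF ac], of 0] by simp
      then show ?thesis by (intro measurable_completion) (simp add: borel_measurable_continuous_onI)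
    qed
    have "?I \<longlonglongrightarrow> (\<integral>\<omega>. F \<omega> * indicator (box a c) \<omega> \<partial>lebesgue)"
    proof (rule integral_dominated_convergence)
      show "integrable lebesgue (\<lambda>\<omega>. \<bar>indicator (cbox a c) \<omega> * F \<omega>\<bar>)"
        using L2_mult_integrable[OF ind F2] by (rule integrable_abs)
      show "AE \<omega> in lebesgue. (\<lambda>n. F \<omega> * box_bump n a c \<omega>) \<longlonglongrightarrow> F \<omega> * indicator (box a c) \<omega>"
        by (intro AE_I2 tendsto_intros box_bump_tendsto)
      show "AE \<omega> in lebesgue. norm (F \<omega> * box_bump n a c \<omega>) \<le> \<bar>indicator (cbox a c) \<omega> * F \<omega>\<bar>" for n
      proof (rule AE_I2)
        fix \<omega>
        show "norm (F \<omega> * box_bump n a c \<omega>) \<le> \<bar>indicator (cbox a c) \<omega> * F \<omega>\<bar>"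
        proof (cases "\<omega> \<in> box a c")
          case True
          then have "\<omega> \<in> cbox a c" using box_subset_cbox by blast
          then show ?thesis using box_bump_bounds[of n a c \<omega>] by (simp add: abs_mult mult_left_le)
        qed (simp add: box_bump_outside)
      qed
      show "(\<lambda>\<omega>. F \<omega> * box_bump n a c \<omega>) \<in> borel_measurable lebesgue" for n
        using Fm bm by (intro borel_measurable_times)
      show "(\<lambda>\<omega>. F \<omega> * indicator (box a c) \<omega>) \<in> borel_measurable lebesgue"
        using Fm by (intro borel_measurable_times borel_measurable_indicator) auto
    qed
    then have "(\<integral>\<omega>. F \<omega> * indicator (box a c) \<omega> \<partial>lebesgue) = 0"
      unfolding In by (simp add: LIMSEQ_const_iff)
    moreover have "set_integrable lebesgue (box a c) F"
      using abs[of a c] by (rule set_integrable_subset) (auto simp: box_subset_cbox)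
    then have "set_lebesgue_integral lebesgue (box a c) F = integral (box a c) F"
      by (rule set_lebesgue_integral_eq_integral(2))
    ultimately have "integral (box a c) F = 0" by (simp add: set_lebesgue_integral_def mult.commute)
    then show ?thesis by (simp add: integral_open_interval)
  qed
  obtain N where N: "negligible N" and av: "\<And>x e. x \<notin> N \<Longrightarrow> 0 < e \<Longrightarrow>
      \<exists>d>0. \<forall>h. 0 < h \<and> h < d \<longrightarrow> norm (integral (cbox x (x + h *\<^sub>R One)) F /\<^sub>R h ^ DIM('a) - F x) < e"
    using integrable_ccontinuous_explicit[OF Fint] by metis
  have "F x = 0" if x: "x \<in> \<Omega>" "x \<notin> N" for x
  proof (rule ccontr)
    assume "F x \<noteq> 0"
    then obtain d where d: "0 < d" "\<And>h. 0 < h \<Longrightarrow> h < d \<Longrightarrow>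
        norm (integral (cbox x (x + h *\<^sub>R One)) F /\<^sub>R h ^ DIM('a) - F x) < \<bar>F x\<bar>"
      using av[OF x(2), of "\<bar>F x\<bar>"] by auto
    obtain r where r: "0 < r" "ball x r \<subseteq> \<Omega>" using \<Omega> x(1) by (meson openE)
    \<comment> \<open>so small that the box with side \<open>h\<close> lies in the ball with radius \<open>r\<close>\<close>
    define h where "h = min (d / 2) (r / (2 * (real DIM('a) + 1)))"
    have h: "0 < h" "h < d" using d r by (auto simp: h_def)
    have "cbox x (x + h *\<^sub>R One) \<subseteq> ball x r"
    proof
      fix w assume w: "w \<in> cbox x (x + h *\<^sub>R One)"
      have "norm (w - x) \<le> (\<Sum>b\<in>Basis. \<bar>(w - x) \<bullet> b\<bar>)" by (rule norm_le_l1)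
      also have "\<dots> \<le> (\<Sum>b\<in>(Basis::'a set). h)"
        using w by (intro sum_mono) (auto simp: mem_box inner_simps)
      also have "\<dots> = real DIM('a) * h" by simp
      also have "\<dots> \<le> real DIM('a) * (r / (2 * (real DIM('a) + 1)))" by (intro mult_left_mono) (auto simp: h_def)
      also have "\<dots> < r" using r(1) by (simp add: field_simps add_pos_nonneg)
      finally show "w \<in> ball x r" by (simp add: dist_norm norm_minus_commute)
    qed
    then have "integral (cbox x (x + h *\<^sub>R One)) F = 0" using r(2) by (intro zero) auto
    then show False using d(2)[OF h] by simp
  qed
  then have "{\<omega> \<in> \<Omega>. g \<omega> \<noteq> 0} \<subseteq> N" by (auto simp: F_def)
  then have "{\<omega> \<in> \<Omega>. g \<omega> \<noteq> 0} \<in> null_sets lebesgue" using N by (meson negligible_subset negligible_iff_null_sets)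
  then have "AE \<omega> in lebesgue. \<omega> \<in> \<Omega> \<longrightarrow> g \<omega> = 0" by (rule AE_I') auto
  then show ?thesis using \<Omega>s by (subst AE_restrict_space_iff) auto
qed

lemma sum_fun_apply: "(\<Sum>k\<in>A. u k) \<omega> = (\<Sum>k\<in>A. u k \<omega>)"
  for u :: "'k \<Rightarrow> 'a \<Rightarrow> 'b::comm_monoid_add"
  by (induction A rule: infinite_finite_induct) auto

lemma L2_inner_tendsto:
  assumes v: "\<And>n. v n \<in> L2 M" "v' \<in> L2 M" "w \<in> L2 M"
    and lim: "(\<lambda>n. norm_of (L2_inner M) (v' - v n)) \<longlonglongrightarrow> 0"
  shows "(\<lambda>n. L2_inner M (v n) w) \<longlonglongrightarrow> L2_inner M v' w"
proof -
  interpret L: semi_inner_space "L2 M" "L2_inner M" by (rule semi_inner_space_L2)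
  have "(\<lambda>n. L2_inner M (v' - v n) w) \<longlonglongrightarrow> 0"
  proof (rule Lim_null_comparison)
    show "\<forall>\<^sub>F n in sequentially. norm (L2_inner M (v' - v n) w) \<le> L.nrm (v' - v n) * L.nrm w"
      using v L.cauchy_schwarz by simp
    show "(\<lambda>n. L.nrm (v' - v n) * L.nrm w) \<longlonglongrightarrow> 0" using tendsto_mult_right[OF lim, of "L.nrm w"] by simp
  qed
  then have "(\<lambda>n. L2_inner M v' w - L2_inner M (v' - v n) w) \<longlonglongrightarrow> L2_inner M v' w - 0"
    by (intro tendsto_intros)
  then show ?thesis using v by (simp add: L.diff_left)
qed

section \<open>Weak gradients\<close>

definition L2_weak_gradient :: "'a::euclidean_space set \<Rightarrow> ('a \<Rightarrow> real) \<Rightarrow> ('a \<Rightarrow> 'a) \<Rightarrow> bool" where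
  "L2_weak_gradient \<Omega> x g \<longleftrightarrow>
    (\<forall>b \<in> Basis. (\<lambda>\<omega>. g \<omega> \<bullet> b) \<in> L2 (lebesgue_on \<Omega>)) \<and> is_weak_gradient \<Omega> x g"

lemma H1_iff: "x \<in> H1 \<Omega> \<longleftrightarrow> x \<in> L2 (lebesgue_on \<Omega>) \<and> (\<exists>g. L2_weak_gradient \<Omega> x g)"
  by (simp add: H1_def L2_weak_gradient_def)

lemma H1_L2: "x \<in> H1 \<Omega> \<Longrightarrow> x \<in> L2 (lebesgue_on \<Omega>)"
  by (simp add: H1_iff)

lemma weak_grad: "x \<in> H1 \<Omega> \<Longrightarrow> L2_weak_gradient \<Omega> x (weak_grad \<Omega> x)"
  using someI_ex[of "L2_weak_gradient \<Omega> x"]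
  unfolding H1_iff weak_grad_def L2_weak_gradient_def[symmetric] by blast

lemma L2_weak_gradient_component:
  "L2_weak_gradient \<Omega> x g \<Longrightarrow> b \<in> Basis \<Longrightarrow> (\<lambda>\<omega>. g \<omega> \<bullet> b) \<in> L2 (lebesgue_on \<Omega>)"
  by (simp add: L2_weak_gradient_def)

lemma L2_weak_gradient_test:
  assumes "L2_weak_gradient \<Omega> x g" "\<psi> \<in> test_functions \<Omega>" "b \<in> Basis"
  shows "L2_inner (lebesgue_on \<Omega>) x (\<lambda>\<omega>. frechet_derivative \<psi> (at \<omega>) b) = - L2_inner (lebesgue_on \<Omega>) (\<lambda>\<omega>. g \<omega> \<bullet> b) \<psi>"
  using assms by (simp add: L2_weak_gradient_def is_weak_gradient_def L2_inner_def)

lemma L2_weak_gradientI: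
  assumes "\<And>b. b \<in> Basis \<Longrightarrow> (\<lambda>\<omega>. g \<omega> \<bullet> b) \<in> L2 (lebesgue_on \<Omega>)"
    and "\<And>\<psi> b. \<psi> \<in> test_functions \<Omega> \<Longrightarrow> b \<in> Basis \<Longrightarrow>
      L2_inner (lebesgue_on \<Omega>) x (\<lambda>\<omega>. frechet_derivative \<psi> (at \<omega>) b) = - L2_inner (lebesgue_on \<Omega>) (\<lambda>\<omega>. g \<omega> \<bullet> b) \<psi>"
  shows "L2_weak_gradient \<Omega> x g"
  using assms by (simp add: L2_weak_gradient_def is_weak_gradient_def L2_inner_def)

lemma L2_weak_gradient_combination:
  fixes \<Omega> :: "'a::euclidean_space set"
  assumes \<Omega>: "\<Omega> \<in> sets lebesgue" and x: "x \<in> L2 (lebesgue_on \<Omega>)" "L2_weak_gradient \<Omega> x g"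
    and y: "y \<in> L2 (lebesgue_on \<Omega>)" "L2_weak_gradient \<Omega> y k"
  shows "L2_weak_gradient \<Omega> (x + c *\<^sub>R y) (g + c *\<^sub>R k)"
proof -
  interpret L: semi_inner_space "L2 (lebesgue_on \<Omega>)" "L2_inner (lebesgue_on \<Omega>)" by (rule semi_inner_space_L2)
  have eq: "(\<lambda>\<omega>. (g + c *\<^sub>R k) \<omega> \<bullet> b) = (\<lambda>\<omega>. g \<omega> \<bullet> b) + c *\<^sub>R (\<lambda>\<omega>. k \<omega> \<bullet> b)" for b
    by (simp add: fun_eq_iff inner_add_left)
  note gb = L2_weak_gradient_component[OF x(2)] and kb = L2_weak_gradient_component[OF y(2)]
  show ?thesis
  proof (rule L2_weak_gradientI, unfold eq)
    show "(\<lambda>\<omega>. g \<omega> \<bullet> b) + c *\<^sub>R (\<lambda>\<omega>. k \<omega> \<bullet> b) \<in> L2 (lebesgue_on \<Omega>)" if "b \<in> Basis" for b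
      using gb kb that by simp
    fix \<psi> and b :: 'a assume \<psi>: "\<psi> \<in> test_functions \<Omega>" and b: "b \<in> Basis"
    note T = test_function_L2[OF \<psi> \<Omega>]
    show "L2_inner (lebesgue_on \<Omega>) (x + c *\<^sub>R y) (\<lambda>\<omega>. frechet_derivative \<psi> (at \<omega>) b)
        = - L2_inner (lebesgue_on \<Omega>) ((\<lambda>\<omega>. g \<omega> \<bullet> b) + c *\<^sub>R (\<lambda>\<omega>. k \<omega> \<bullet> b)) \<psi>"
      using L2_weak_gradient_test[OF x(2) \<psi> b] L2_weak_gradient_test[OF y(2) \<psi> b] T(1) T(2)[OF b] x(1) y(1) gb[OF b] kb[OF b]
      by (simp add: L.add_left L.scale_left)
  qed
qed

text \<open>
  The function chosen by \<open>weak_grad\<close> may differ from a given weak gradient, and integrals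
  of weak gradients can be computed from any representative only because of this uniqueness.
\<close>

lemma L2_weak_gradient_unique:
  fixes \<Omega> :: "'a::euclidean_space set"
  assumes \<Omega>: "open \<Omega>" and g: "L2_weak_gradient \<Omega> x g" and k: "L2_weak_gradient \<Omega> x k"
  shows "AE \<omega> in lebesgue_on \<Omega>. g \<omega> = k \<omega>"
proof -
  interpret L: semi_inner_space "L2 (lebesgue_on \<Omega>)" "L2_inner (lebesgue_on \<Omega>)" by (rule semi_inner_space_L2)
  have "AE \<omega> in lebesgue_on \<Omega>. \<forall>b\<in>Basis. (g \<omega> - k \<omega>) \<bullet> b = 0"
  proof (rule AE_finite_allI)
    fix b :: 'a assume b: "b \<in> Basis"
    let ?g = "\<lambda>\<omega>. g \<omega> \<bullet> b" and ?k = "\<lambda>\<omega>. k \<omega> \<bullet> b"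
    have L: "?g \<in> L2 (lebesgue_on \<Omega>)" "?k \<in> L2 (lebesgue_on \<Omega>)"
      using L2_weak_gradient_component[OF g b] L2_weak_gradient_component[OF k b] .
    have "AE \<omega> in lebesgue_on \<Omega>. (?g - ?k) \<omega> = 0"
    proof (rule fundamental_lemma[OF \<Omega>])
      show "?g - ?k \<in> L2 (lebesgue_on \<Omega>)" using L by simp
      fix \<psi> assume \<psi>: "\<psi> \<in> test_functions \<Omega>"
      have "L2_inner (lebesgue_on \<Omega>) (?g - ?k) \<psi> = 0"
        using L2_weak_gradient_test[OF g \<psi> b] L2_weak_gradient_test[OF k \<psi> b] L test_function_L2(1)[OF \<psi>] \<Omega>
        by (simp add: L.diff_left)
      then show "(\<integral>\<omega>. (?g - ?k) \<omega> * \<psi> \<omega> \<partial>lebesgue_on \<Omega>) = 0" by (simp add: L2_inner_def)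
    qed
    then show "AE \<omega> in lebesgue_on \<Omega>. (g \<omega> - k \<omega>) \<bullet> b = 0" by (simp add: inner_diff_left)
  qed simp
  then show ?thesis by eventually_elim (rule euclidean_eqI, simp add: inner_diff_left)
qed

lemma L2_fields_inner:
  fixes g k :: "'b \<Rightarrow> 'a::euclidean_space"
  assumes "\<And>b. b \<in> Basis \<Longrightarrow> (\<lambda>\<omega>. g \<omega> \<bullet> b) \<in> L2 M" "\<And>b. b \<in> Basis \<Longrightarrow> (\<lambda>\<omega>. k \<omega> \<bullet> b) \<in> L2 M"
  shows "integrable M (\<lambda>\<omega>. g \<omega> \<bullet> k \<omega>)"
    and "(\<integral>\<omega>. g \<omega> \<bullet> k \<omega> \<partial>M) = (\<Sum>b\<in>Basis. L2_inner M (\<lambda>\<omega>. g \<omega> \<bullet> b) (\<lambda>\<omega>. k \<omega> \<bullet> b))"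
proof -
  have eq: "(\<lambda>\<omega>. g \<omega> \<bullet> k \<omega>) = (\<lambda>\<omega>. \<Sum>b\<in>Basis. (g \<omega> \<bullet> b) * (k \<omega> \<bullet> b))"
    by (rule ext) (rule euclidean_inner)
  have int: "integrable M (\<lambda>\<omega>. (g \<omega> \<bullet> b) * (k \<omega> \<bullet> b))" if "b \<in> Basis" for b
    using assms that by (intro L2_mult_integrable) auto
  show "integrable M (\<lambda>\<omega>. g \<omega> \<bullet> k \<omega>)" unfolding eq using int by (intro Bochner_Integration.integrable_sum)
  show "(\<integral>\<omega>. g \<omega> \<bullet> k \<omega> \<partial>M) = (\<Sum>b\<in>Basis. L2_inner M (\<lambda>\<omega>. g \<omega> \<bullet> b) (\<lambda>\<omega>. k \<omega> \<bullet> b))"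
    unfolding eq L2_inner_def using int by (intro Bochner_Integration.integral_sum)
qed

lemma grad_inner_eq:
  fixes \<Omega> :: "'a::euclidean_space set"
  assumes \<Omega>: "open \<Omega>" and x: "x \<in> L2 (lebesgue_on \<Omega>)" "L2_weak_gradient \<Omega> x g"
    and y: "y \<in> L2 (lebesgue_on \<Omega>)" "L2_weak_gradient \<Omega> y k"
  shows "grad_inner \<Omega> x y = (\<Sum>b\<in>Basis. L2_inner (lebesgue_on \<Omega>) (\<lambda>\<omega>. g \<omega> \<bullet> b) (\<lambda>\<omega>. k \<omega> \<bullet> b))"
proof -
  have H: "x \<in> H1 \<Omega>" "y \<in> H1 \<Omega>" using x y by (auto simp: H1_iff)
  note wx = weak_grad[OF H(1)] and wy = weak_grad[OF H(2)]
  have "grad_inner \<Omega> x y = (\<Sum>b\<in>Basis. L2_inner (lebesgue_on \<Omega>) (\<lambda>\<omega>. weak_grad \<Omega> x \<omega> \<bullet> b) (\<lambda>\<omega>. weak_grad \<Omega> y \<omega> \<bullet> b))"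
    unfolding grad_inner_def by (intro L2_fields_inner(2) L2_weak_gradient_component[OF wx] L2_weak_gradient_component[OF wy])
  also have "\<dots> = (\<Sum>b\<in>Basis. L2_inner (lebesgue_on \<Omega>) (\<lambda>\<omega>. g \<omega> \<bullet> b) (\<lambda>\<omega>. k \<omega> \<bullet> b))"
  proof (intro sum.cong refl)
    fix b :: 'a assume b: "b \<in> Basis"
    note [intro] = L2_measurable[OF L2_weak_gradient_component[OF wx b]] L2_measurable[OF L2_weak_gradient_component[OF wy b]]
      L2_measurable[OF L2_weak_gradient_component[OF x(2) b]] L2_measurable[OF L2_weak_gradient_component[OF y(2) b]]
    have "AE \<omega> in lebesgue_on \<Omega>. weak_grad \<Omega> x \<omega> \<bullet> b = g \<omega> \<bullet> b" "AE \<omega> in lebesgue_on \<Omega>. weak_grad \<Omega> y \<omega> \<bullet> b = k \<omega> \<bullet> b"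
      using L2_weak_gradient_unique[OF \<Omega> wx x(2)] L2_weak_gradient_unique[OF \<Omega> wy y(2)] by (auto elim: eventually_mono)
    then show "L2_inner (lebesgue_on \<Omega>) (\<lambda>\<omega>. weak_grad \<Omega> x \<omega> \<bullet> b) (\<lambda>\<omega>. weak_grad \<Omega> y \<omega> \<bullet> b) =
       L2_inner (lebesgue_on \<Omega>) (\<lambda>\<omega>. g \<omega> \<bullet> b) (\<lambda>\<omega>. k \<omega> \<bullet> b)"
      by (intro trans[OF L2_inner_cong_AE(1) L2_inner_cong_AE(2)]) auto
  qed
  finally show ?thesis .
qed

lemma H1_combination:
  fixes \<Omega> :: "'a::euclidean_space set"
  assumes "\<Omega> \<in> sets lebesgue" "x \<in> H1 \<Omega>" "y \<in> H1 \<Omega>"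
  shows "x + c *\<^sub>R y \<in> H1 \<Omega>"
proof -
  interpret L: semi_inner_space "L2 (lebesgue_on \<Omega>)" "L2_inner (lebesgue_on \<Omega>)" by (rule semi_inner_space_L2)
  show ?thesis
    using L2_weak_gradient_combination[OF assms(1) H1_L2[OF assms(2)] weak_grad[OF assms(2)] H1_L2[OF assms(3)] weak_grad[OF assms(3)], of c]
      H1_L2[OF assms(2)] H1_L2[OF assms(3)] by (auto simp: H1_iff)
qed

lemma L2_weak_gradient_zero: "L2_weak_gradient \<Omega> 0 0"
  by (simp add: L2_weak_gradient_def is_weak_gradient_def L2_zero)

lemma subspace_H1:
  fixes \<Omega> :: "'a::euclidean_space set"
  assumes "\<Omega> \<in> sets lebesgue" shows "subspace (H1 \<Omega>)"
proof -
  have z: "0 \<in> H1 \<Omega>" using L2_weak_gradient_zero L2_zero by (auto simp: H1_iff zero_fun_def)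
  show ?thesis unfolding subspace_def
    using z H1_combination[OF assms, of _ _ 1] H1_combination[OF assms z] by auto
qed

lemma semi_inner_space_grad_inner:
  fixes \<Omega> :: "'a::euclidean_space set"
  assumes \<Omega>: "open \<Omega>" shows "semi_inner_space (H1 \<Omega>) (grad_inner \<Omega>)"
proof
  have \<Omega>s: "\<Omega> \<in> sets lebesgue" using \<Omega> by simp
  interpret L: semi_inner_space "L2 (lebesgue_on \<Omega>)" "L2_inner (lebesgue_on \<Omega>)" by (rule semi_inner_space_L2)
  show "subspace (H1 \<Omega>)" using subspace_H1[OF \<Omega>s] .
  have comb: "grad_inner \<Omega> (x + c *\<^sub>R y) w = grad_inner \<Omega> x w + c * grad_inner \<Omega> y w"
    if x: "x \<in> H1 \<Omega>" and y: "y \<in> H1 \<Omega>" and w: "w \<in> H1 \<Omega>" for x y w c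
  proof -
    note gx = weak_grad[OF x] and gy = weak_grad[OF y] and gw = weak_grad[OF w]
    note cx = L2_weak_gradient_component[OF gx] and cy = L2_weak_gradient_component[OF gy] and cw = L2_weak_gradient_component[OF gw]
    have eq: "(\<lambda>\<omega>. (weak_grad \<Omega> x + c *\<^sub>R weak_grad \<Omega> y) \<omega> \<bullet> b) = (\<lambda>\<omega>. weak_grad \<Omega> x \<omega> \<bullet> b) + c *\<^sub>R (\<lambda>\<omega>. weak_grad \<Omega> y \<omega> \<bullet> b)" for b
      by (simp add: fun_eq_iff inner_add_left)
    have "grad_inner \<Omega> (x + c *\<^sub>R y) w = (\<Sum>b\<in>Basis. L2_inner (lebesgue_on \<Omega>) (\<lambda>\<omega>. (weak_grad \<Omega> x + c *\<^sub>R weak_grad \<Omega> y) \<omega> \<bullet> b) (\<lambda>\<omega>. weak_grad \<Omega> w \<omega> \<bullet> b))"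
      using x y w H1_combination[OF \<Omega>s x y] by (intro grad_inner_eq[OF \<Omega>] L2_weak_gradient_combination \<Omega>s H1_L2 weak_grad)
    also have "\<dots> = (\<Sum>b\<in>Basis. L2_inner (lebesgue_on \<Omega>) (\<lambda>\<omega>. weak_grad \<Omega> x \<omega> \<bullet> b) (\<lambda>\<omega>. weak_grad \<Omega> w \<omega> \<bullet> b)
        + c * L2_inner (lebesgue_on \<Omega>) (\<lambda>\<omega>. weak_grad \<Omega> y \<omega> \<bullet> b) (\<lambda>\<omega>. weak_grad \<Omega> w \<omega> \<bullet> b))"
      unfolding eq using cx cy cw by (intro sum.cong refl) (simp add: L.add_left L.scale_left)
    finally show ?thesis
      using x y w by (simp add: grad_inner_eq[OF \<Omega> H1_L2 weak_grad H1_L2 weak_grad] sum.distrib sum_distrib_left)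
  qed
  fix x y w assume x: "x \<in> H1 \<Omega>"
  show "0 \<le> grad_inner \<Omega> x x" by (simp add: grad_inner_def)
  assume y: "y \<in> H1 \<Omega>"
  show "grad_inner \<Omega> x y = grad_inner \<Omega> y x" by (simp add: grad_inner_def inner_commute)
  assume w: "w \<in> H1 \<Omega>"
  show "grad_inner \<Omega> (x + y) w = grad_inner \<Omega> x w + grad_inner \<Omega> y w" using comb[OF x y w, of 1] by simp
  show "grad_inner \<Omega> (c *\<^sub>R x) w = c * grad_inner \<Omega> x w" for c
    using comb[OF subspace_0[OF subspace_H1[OF \<Omega>s]] x w, of c] comb[OF subspace_0[OF subspace_H1[OF \<Omega>s]] subspace_0[OF subspace_H1[OF \<Omega>s]] w, of 1]
    by simp
qed

text \<open>
  Functions that agree almost everywhere have the same weak gradients, so the choice made by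
  \<open>weak_grad\<close> is the same function for both.
\<close>

lemma weak_grad_cong_AE:
  fixes \<Omega> :: "'a::euclidean_space set"
  assumes \<Omega>: "\<Omega> \<in> sets lebesgue" and x: "x \<in> L2 (lebesgue_on \<Omega>)" and y: "y \<in> L2 (lebesgue_on \<Omega>)"
    and ae: "AE \<omega> in lebesgue_on \<Omega>. x \<omega> = y \<omega>"
  shows "weak_grad \<Omega> x = weak_grad \<Omega> y" and "x \<in> H1 \<Omega> \<longleftrightarrow> y \<in> H1 \<Omega>"
proof -
  have eq: "is_weak_gradient \<Omega> x g \<longleftrightarrow> is_weak_gradient \<Omega> y g" for g
  proof -
    have "L2_inner (lebesgue_on \<Omega>) x (\<lambda>\<omega>. frechet_derivative \<psi> (at \<omega>) b) = L2_inner (lebesgue_on \<Omega>) y (\<lambda>\<omega>. frechet_derivative \<psi> (at \<omega>) b)"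
      if "\<psi> \<in> test_functions \<Omega>" "b \<in> Basis" for \<psi> b
      using that x y ae test_function_L2(2)[OF that(1) \<Omega> that(2)] by (intro L2_inner_cong_AE L2_measurable)
    then show ?thesis unfolding is_weak_gradient_def L2_inner_def by simp
  qed
  show "weak_grad \<Omega> x = weak_grad \<Omega> y" unfolding weak_grad_def eq ..
  show "x \<in> H1 \<Omega> \<longleftrightarrow> y \<in> H1 \<Omega>" using x y unfolding H1_def by (simp add: eq)
qed

text \<open>
  Completeness of \<open>H1\<close> for absolutely convergent series: the functions and the components
  of their gradients are summed separately in \<open>L2\<close>, and the defining identity of the weak
  gradient, which is continuous in \<open>L2\<close>, passes to the limit.
\<close>

lemma H1_series:
  fixes \<Omega> :: "'a::euclidean_space set"
  assumes \<Omega>: "open \<Omega>" and u: "\<And>k. u k \<in> H1 \<Omega>"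
    and s0: "summable (\<lambda>k. norm_of (L2_inner (lebesgue_on \<Omega>)) (u k))"
    and s1: "summable (\<lambda>k. norm_of (grad_inner \<Omega>) (u k))"
  defines "s \<equiv> \<lambda>\<omega>. \<Sum>k. u k \<omega>"
  shows "s \<in> H1 \<Omega>"
    and "(\<lambda>n. norm_of (L2_inner (lebesgue_on \<Omega>)) (s - (\<Sum>k<n. u k))) \<longlonglongrightarrow> 0"
    and "(\<lambda>n. norm_of (grad_inner \<Omega>) (s - (\<Sum>k<n. u k))) \<longlonglongrightarrow> 0"
proof -
  let ?M = "lebesgue_on \<Omega>"
  have \<Omega>s: "\<Omega> \<in> sets lebesgue" using \<Omega> by simp
  interpret L: semi_inner_space "L2 ?M" "L2_inner ?M" by (rule semi_inner_space_L2)
  interpret H: semi_inner_space "H1 \<Omega>" "grad_inner \<Omega>" by (rule semi_inner_space_grad_inner[OF \<Omega>])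
  note uL = H1_L2[OF u]
  define g where "g k = weak_grad \<Omega> (u k)" for k
  have g: "L2_weak_gradient \<Omega> (u k) (g k)" for k unfolding g_def by (rule weak_grad[OF u])
  define gb where "gb b k = (\<lambda>\<omega>. g k \<omega> \<bullet> b)" for b k
  have gbL: "gb b k \<in> L2 ?M" if "b \<in> Basis" for b k unfolding gb_def using L2_weak_gradient_component[OF g that] .
  have gbs: "summable (\<lambda>k. L.nrm (gb b k))" if b: "b \<in> Basis" for b
  proof (rule summable_comparison_test[OF _ s1])
    have "L.nrm (gb b k) \<le> H.nrm (u k)" for k
    proof (rule power2_le_imp_le)
      have "(L.nrm (gb b k))\<^sup>2 \<le> (\<Sum>b\<in>Basis. (L.nrm (gb b k))\<^sup>2)"
        using b by (intro member_le_sum) auto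
      also have "\<dots> = (H.nrm (u k))\<^sup>2"
        using gbL by (simp add: H.nrm_power2[OF u] L.nrm_power2 grad_inner_eq[OF \<Omega> uL g uL g] gb_def)
      finally show "(L.nrm (gb b k))\<^sup>2 \<le> (H.nrm (u k))\<^sup>2" .
    qed (use u in simp)
    then show "\<exists>N. \<forall>n\<ge>N. norm (L.nrm (gb b n)) \<le> H.nrm (u n)" using gbL[OF b] by auto
  qed
  define Gb where "Gb b = (\<lambda>\<omega>. \<Sum>k. gb b k \<omega>)" for b
  define G where "G \<omega> = (\<Sum>b\<in>Basis. Gb b \<omega> *\<^sub>R b)" for \<omega>
  have G_comp: "(\<lambda>\<omega>. G \<omega> \<bullet> b) = Gb b" if "b \<in> Basis" for b
    using that by (simp add: G_def fun_eq_iff inner_sum_left inner_Basis if_distrib sum.delta cong: if_cong)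
  have GbL: "Gb b \<in> L2 ?M" if "b \<in> Basis" for b unfolding Gb_def using gbL[OF that] gbs[OF that] by (rule L2_series(2))
  have sL: "s \<in> L2 ?M" unfolding s_def using uL s0 by (rule L2_series(2))
  have sum_lim: "(\<lambda>n. L.nrm (s - (\<Sum>k<n. u k))) \<longlonglongrightarrow> 0"
    using L2_series_tendsto[OF uL s0] by (simp add: s_def fun_diff_def sum_fun_apply)
  have Gb_lim: "(\<lambda>n. L.nrm (Gb b - (\<Sum>k<n. gb b k))) \<longlonglongrightarrow> 0" if b: "b \<in> Basis" for b
    using L2_series_tendsto[OF gbL[OF b] gbs[OF b]] by (simp add: Gb_def fun_diff_def sum_fun_apply)
  have part: "L2_weak_gradient \<Omega> (\<Sum>k<n. u k) (\<Sum>k<n. g k)" for n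
  proof (induction n)
    case 0
    then show ?case using L2_weak_gradient_zero[of \<Omega>] by (simp add: zero_fun_def)
  next
    case (Suc n)
    have "L2_weak_gradient \<Omega> ((\<Sum>k<n. u k) + 1 *\<^sub>R u n) ((\<Sum>k<n. g k) + 1 *\<^sub>R g n)"
      using uL by (intro L2_weak_gradient_combination \<Omega>s Suc g) auto
    then show ?case by (simp only: sum.lessThan_Suc scaleR_one)
  qed
  have part_comp: "(\<lambda>\<omega>. (\<Sum>k<n. g k) \<omega> \<bullet> b) = (\<Sum>k<n. gb b k)" for n b
    by (simp add: fun_eq_iff sum_fun_apply inner_sum_left gb_def)
  have sG: "L2_weak_gradient \<Omega> s G"
  proof (rule L2_weak_gradientI)
    show "(\<lambda>\<omega>. G \<omega> \<bullet> b) \<in> L2 ?M" if "b \<in> Basis" for b using GbL[OF that] by (simp add: G_comp[OF that])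
    fix \<psi> and b :: 'a assume \<psi>: "\<psi> \<in> test_functions \<Omega>" and b: "b \<in> Basis"
    note T = test_function_L2(1)[OF \<psi> \<Omega>s] test_function_L2(2)[OF \<psi> \<Omega>s b]
    have 1: "(\<lambda>n. L2_inner ?M (\<Sum>k<n. u k) (\<lambda>\<omega>. frechet_derivative \<psi> (at \<omega>) b)) \<longlonglongrightarrow> L2_inner ?M s (\<lambda>\<omega>. frechet_derivative \<psi> (at \<omega>) b)"
      using uL by (intro L2_inner_tendsto sL T sum_lim) simp
    have 2: "(\<lambda>n. L2_inner ?M (\<Sum>k<n. gb b k) \<psi>) \<longlonglongrightarrow> L2_inner ?M (Gb b) \<psi>"
      using gbL[OF b] by (intro L2_inner_tendsto GbL[OF b] T Gb_lim[OF b]) simp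
    have "L2_inner ?M (\<Sum>k<n. u k) (\<lambda>\<omega>. frechet_derivative \<psi> (at \<omega>) b) = - L2_inner ?M (\<Sum>k<n. gb b k) \<psi>" for n
      using L2_weak_gradient_test[OF part \<psi> b, of n] unfolding part_comp .
    then show "L2_inner ?M s (\<lambda>\<omega>. frechet_derivative \<psi> (at \<omega>) b) = - L2_inner ?M (\<lambda>\<omega>. G \<omega> \<bullet> b) \<psi>"
      using LIMSEQ_unique[OF 1] tendsto_minus[OF 2] unfolding G_comp[OF b] by simp
  qed
  show "s \<in> H1 \<Omega>" using sL sG by (auto simp: H1_iff)
  show "(\<lambda>n. L.nrm (s - (\<Sum>k<n. u k))) \<longlonglongrightarrow> 0" by (rule sum_lim)
  have "H.nrm (s - (\<Sum>k<n. u k)) = sqrt (\<Sum>b\<in>Basis. (L.nrm (Gb b - (\<Sum>k<n. gb b k)))\<^sup>2)" for n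
  proof -
    have w: "L2_weak_gradient \<Omega> (s + (-1) *\<^sub>R (\<Sum>k<n. u k)) (G + (-1) *\<^sub>R (\<Sum>k<n. g k))"
      using uL by (intro L2_weak_gradient_combination \<Omega>s sL sG part) auto
    have mem: "s + (-1) *\<^sub>R (\<Sum>k<n. u k) \<in> L2 ?M" using sL uL by simp
    have comp: "(\<lambda>\<omega>. (G + (-1) *\<^sub>R (\<Sum>k<n. g k)) \<omega> \<bullet> b) = Gb b - (\<Sum>k<n. gb b k)" if "b \<in> Basis" for b
      using G_comp[OF that] part_comp[of n b] by (simp add: fun_eq_iff inner_diff_left)
    have "grad_inner \<Omega> (s + (-1) *\<^sub>R (\<Sum>k<n. u k)) (s + (-1) *\<^sub>R (\<Sum>k<n. u k)) = (\<Sum>b\<in>Basis. (L.nrm (Gb b - (\<Sum>k<n. gb b k)))\<^sup>2)"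
      unfolding grad_inner_eq[OF \<Omega> mem w mem w] using GbL gbL by (intro sum.cong refl) (simp only: comp L.nrm_power2 L.diff_mem L.sum_mem)
    then show ?thesis by (simp add: norm_of_def)
  qed
  moreover have "(\<lambda>n. sqrt (\<Sum>b\<in>(Basis::'a set). (L.nrm (Gb b - (\<Sum>k<n. gb b k)))\<^sup>2)) \<longlonglongrightarrow> sqrt (\<Sum>b\<in>(Basis::'a set). 0\<^sup>2)"
    by (intro tendsto_intros Gb_lim)
  ultimately show "(\<lambda>n. H.nrm (s - (\<Sum>k<n. u k))) \<longlonglongrightarrow> 0" by simp
qed

section \<open>Traces\<close>

lemma hilbert_space_imp_semi_hilbert_space:
  assumes "hilbert_space M V ip"
  shows "semi_hilbert_space V ip"
proof
  have fs: "\<And>x y :: 'a \<Rightarrow> real. (\<lambda>\<omega>. x \<omega> + y \<omega>) = x + y" "\<And>x y :: 'a \<Rightarrow> real. (\<lambda>\<omega>. x \<omega> - y \<omega>) = x - y"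
    "\<And>c. \<And>x :: 'a \<Rightarrow> real. (\<lambda>\<omega>. c * x \<omega>) = c *\<^sub>R x" "(\<lambda>\<omega>::'a. 0::real) = 0"
    by (simp_all add: fun_eq_iff)
  note H = assms[unfolded hilbert_space_def fs]
  show "subspace V" using H unfolding subspace_def by blast
  show "\<And>x y. x \<in> V \<Longrightarrow> y \<in> V \<Longrightarrow> ip x y = ip y x" using H by blast
  show "\<And>x y w. x \<in> V \<Longrightarrow> y \<in> V \<Longrightarrow> w \<in> V \<Longrightarrow> ip (x + y) w = ip x w + ip y w" using H by blast
  show "\<And>x w c. x \<in> V \<Longrightarrow> w \<in> V \<Longrightarrow> ip (c *\<^sub>R x) w = c * ip x w" using H by blast
  show "\<And>x. x \<in> V \<Longrightarrow> 0 \<le> ip x x" using H by blast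
  fix xs :: "nat \<Rightarrow> 'a \<Rightarrow> real"
  assume "\<And>n. xs n \<in> V" "\<And>e. 0 < e \<Longrightarrow> \<exists>n0. \<forall>k\<ge>n0. \<forall>n\<ge>n0. norm_of ip (xs k - xs n) < e"
  then have "range xs \<subseteq> V \<and> (\<forall>e>0. \<exists>n0. \<forall>k\<ge>n0. \<forall>n\<ge>n0. norm_of ip (xs k - xs n) < e)" by blast
  then show "\<exists>x\<in>V. (\<lambda>n. norm_of ip (xs n - x)) \<longlonglongrightarrow> 0" using H by blast
qed

lemma hilbert_space_null_AE:
  assumes "hilbert_space M V ip" "x \<in> V" "ip x x = 0"
  shows "AE \<omega> in M. x \<omega> = 0"
  using assms unfolding hilbert_space_def by blast

context
  fixes M :: "'a measure" and A B :: "'a set"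
  assumes A: "A \<inter> space M \<in> sets M" and B: "B \<inter> space M \<in> sets M" and AB: "A \<subseteq> B"
begin

lemma restrict_space_AE_subset:
  assumes "AE \<omega> in restrict_space M B. P \<omega>"
  shows "AE \<omega> in restrict_space M A. P \<omega>"
proof -
  have "AE \<omega> in M. \<omega> \<in> B \<longrightarrow> P \<omega>" using assms by (simp add: AE_restrict_space_iff[OF B])
  then have "AE \<omega> in M. \<omega> \<in> A \<longrightarrow> P \<omega>" by eventually_elim (use AB in blast)
  then show ?thesis by (simp add: AE_restrict_space_iff[OF A])
qed

lemma L2_restrict_subset:
  assumes "u \<in> L2 (restrict_space M B)"
  shows "u \<in> L2 (restrict_space M A)"
    and "norm_of (L2_inner (restrict_space M A)) u \<le> norm_of (L2_inner (restrict_space M B)) u"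
proof -
  have iB: "integrable M (\<lambda>\<omega>. indicator B \<omega> *\<^sub>R (u \<omega>)\<^sup>2)"
    using L2_square_integrable[OF assms] by (simp add: integrable_restrict_space[OF B])
  have eq: "(\<lambda>\<omega>. indicator A \<omega> *\<^sub>R (u \<omega>)\<^sup>2) = (\<lambda>\<omega>. indicator A \<omega> * (indicator B \<omega> *\<^sub>R (u \<omega>)\<^sup>2))"
    using AB by (auto simp: fun_eq_iff indicator_def)
  have iA: "integrable M (\<lambda>\<omega>. indicator A \<omega> *\<^sub>R (u \<omega>)\<^sup>2)"
  proof -
    have "integrable M (\<lambda>\<omega>. indicator (A \<inter> space M) \<omega> *\<^sub>R (indicator B \<omega> *\<^sub>R (u \<omega>)\<^sup>2))"
      by (rule integrable_mult_indicator[OF A iB])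
    then show ?thesis by (rule Bochner_Integration.integrable_cong[THEN iffD1, rotated 2]) (use AB in \<open>auto simp: indicator_def\<close>)
  qed
  have "u \<in> borel_measurable (restrict_space (restrict_space M B) A)"
    using assms by (intro measurable_restrict_space1 L2_measurable)
  also have "restrict_space (restrict_space M B) A = restrict_space M A"
    using A B AB by (subst restrict_restrict_space) (auto simp: Int_absorb1)
  finally have um: "u \<in> borel_measurable (restrict_space M A)" .
  with iA show "u \<in> L2 (restrict_space M A)" by (simp add: L2_def integrable_restrict_space[OF A])
  have "(\<integral>\<omega>. (u \<omega>)\<^sup>2 \<partial>restrict_space M A) = (\<integral>\<omega>. indicator A \<omega> *\<^sub>R (u \<omega>)\<^sup>2 \<partial>M)"
    by (rule integral_restrict_space[OF A])
  also have "\<dots> \<le> (\<integral>\<omega>. indicator B \<omega> *\<^sub>R (u \<omega>)\<^sup>2 \<partial>M)"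
    using iA iB AB by (intro integral_mono) (auto simp: indicator_def)
  also have "\<dots> = (\<integral>\<omega>. (u \<omega>)\<^sup>2 \<partial>restrict_space M B)"
    by (rule integral_restrict_space[OF B, symmetric])
  finally show "norm_of (L2_inner (restrict_space M A)) u \<le> norm_of (L2_inner (restrict_space M B)) u"
    by (simp add: norm_of_def L2_inner_def power2_eq_square)
qed

end

lemma borel_measurable_lebesgue_on_cong_AE:
  fixes x w :: "'a::euclidean_space \<Rightarrow> real"
  assumes \<Omega>: "\<Omega> \<in> sets lebesgue" and x: "x \<in> borel_measurable (lebesgue_on \<Omega>)"
    and ae: "AE \<omega> in lebesgue_on \<Omega>. w \<omega> = x \<omega>"
  shows "w \<in> borel_measurable (lebesgue_on \<Omega>)"
proof -
  have \<Omega>': "\<Omega> \<inter> space lebesgue \<in> sets lebesgue" using \<Omega> by simp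
  have "(\<lambda>\<omega>. indicator \<Omega> \<omega> *\<^sub>R x \<omega>) \<in> borel_measurable lebesgue"
    using x by (simp add: borel_measurable_restrict_space_iff[OF \<Omega>'])
  moreover have "AE \<omega> in lebesgue. indicator \<Omega> \<omega> *\<^sub>R x \<omega> = indicator \<Omega> \<omega> *\<^sub>R w \<omega>"
    using ae unfolding AE_restrict_space_iff[OF \<Omega>'] by eventually_elim (auto simp: indicator_def)
  ultimately have "(\<lambda>\<omega>. indicator \<Omega> \<omega> *\<^sub>R w \<omega>) \<in> borel_measurable lebesgue" by (rule borel_measurable_AE)
  then show ?thesis by (simp add: borel_measurable_restrict_space_iff[OF \<Omega>'])
qed

text \<open>
  The assumption that the gradient norm makes \<open>V\<close> a Hilbert space is what replaces a
  geometric condition on \<open>\<Omega>\<close> and \<open>\<Upsilon>\<close>.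
\<close>

locale trace_space =
  fixes \<Omega> :: "'a::euclidean_space set" and T :: "('a \<Rightarrow> real) \<Rightarrow> 'a \<Rightarrow> real" and \<Upsilon> :: "'a set"
  assumes \<Omega>: "open \<Omega>" and T: "is_trace_operator \<Omega> T"
    and \<Upsilon>: "\<Upsilon> \<in> sets borel" "\<Upsilon> \<subseteq> frontier \<Omega>"
    and hilbert: "hilbert_space (lebesgue_on \<Omega>) (H1_vanishing_on \<Omega> T \<Upsilon>) (grad_inner \<Omega>)"
begin

abbreviation "V \<equiv> H1_vanishing_on \<Omega> T \<Upsilon>"
abbreviation "vol \<equiv> lebesgue_on \<Omega>"
abbreviation "bdry \<equiv> surface_on (frontier \<Omega>)"

sublocale semi_hilbert_space V "grad_inner \<Omega>"
  by (rule hilbert_space_imp_semi_hilbert_space[OF hilbert])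

lemma V_H1: "x \<in> V \<Longrightarrow> x \<in> H1 \<Omega>"
  by (simp add: H1_vanishing_on_def)

lemma \<Omega>_lebesgue: "\<Omega> \<in> sets lebesgue"
  using \<Omega> by simp

lemma subset_boundary:
  assumes "A \<in> sets borel" "A \<subseteq> frontier \<Omega>"
  shows "A \<inter> space surface_measure \<in> sets surface_measure"
    "frontier \<Omega> \<inter> space surface_measure \<in> sets surface_measure" "A \<subseteq> frontier \<Omega>"
  using assms by auto

lemma trace_L2: "x \<in> H1 \<Omega> \<Longrightarrow> T x \<in> L2 bdry"
  using T by (simp add: is_trace_operator_def)

lemma trace_add: "x \<in> H1 \<Omega> \<Longrightarrow> y \<in> H1 \<Omega> \<Longrightarrow> AE \<omega> in bdry. T (x + y) \<omega> = T x \<omega> + T y \<omega>"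
  using T by (simp add: is_trace_operator_def plus_fun_def)

lemma trace_scale: "x \<in> H1 \<Omega> \<Longrightarrow> AE \<omega> in bdry. T (c *\<^sub>R x) \<omega> = c * T x \<omega>"
  using T by (simp add: is_trace_operator_def scaleR_fun_def)

lemma trace_norm: "\<exists>K\<ge>0. \<forall>x\<in>H1 \<Omega>. norm_of (L2_inner bdry) (T x) \<le> K * norm_of (H1_inner \<Omega>) x"
proof -
  interpret H: semi_inner_space "H1 \<Omega>" "grad_inner \<Omega>" by (rule semi_inner_space_grad_inner[OF \<Omega>])
  interpret L: semi_inner_space "L2 vol" "L2_inner vol" by (rule semi_inner_space_L2)
  obtain K where K: "\<forall>x\<in>H1 \<Omega>. norm_of (L2_inner bdry) (T x) \<le> K * norm_of (H1_inner \<Omega>) x"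
    using T unfolding is_trace_operator_def by blast
  have "K * norm_of (H1_inner \<Omega>) x \<le> \<bar>K\<bar> * norm_of (H1_inner \<Omega>) x" if "x \<in> H1 \<Omega>" for x
    using H.nonneg[OF that] L.nonneg[OF H1_L2[OF that]]
    by (intro mult_right_mono) (auto simp: norm_of_def H1_inner_def)
  with K show ?thesis by (intro exI[of _ "\<bar>K\<bar>"]) (auto intro: order.trans)
qed

lemma H1_norm_le:
  assumes "x \<in> H1 \<Omega>"
  shows "norm_of (H1_inner \<Omega>) x \<le> norm_of (L2_inner vol) x + norm_of (grad_inner \<Omega>) x"
proof -
  interpret H: semi_inner_space "H1 \<Omega>" "grad_inner \<Omega>" by (rule semi_inner_space_grad_inner[OF \<Omega>])
  interpret L: semi_inner_space "L2 vol" "L2_inner vol" by (rule semi_inner_space_L2)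
  show ?thesis unfolding norm_of_def H1_inner_def
    using H.nonneg[OF assms] L.nonneg[OF H1_L2[OF assms]] by (rule sqrt_add_le_add_sqrt[rotated])
qed

text \<open>
  On \<open>\<Upsilon>\<close> the trace of \<open>s\<close> agrees with that of
  \<open>s - x n\<close>, whose norm tends to zero by the continuity of the trace operator.
\<close>

lemma H1_limit_in_V:
  assumes x: "\<And>n. x n \<in> V" and s: "s \<in> H1 \<Omega>"
    and lim: "(\<lambda>n. norm_of (L2_inner vol) (s - x n)) \<longlonglongrightarrow> 0" "(\<lambda>n. norm_of (grad_inner \<Omega>) (s - x n)) \<longlonglongrightarrow> 0"
  shows "s \<in> V"
proof -
  interpret H: semi_inner_space "H1 \<Omega>" "grad_inner \<Omega>" by (rule semi_inner_space_grad_inner[OF \<Omega>])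
  note sub = subset_boundary[OF \<Upsilon>]
  let ?Y = "surface_on \<Upsilon>"
  have e: "s - x n \<in> H1 \<Omega>" for n using s V_H1[OF x] by simp
  obtain K where K: "0 \<le> K" "\<And>x. x \<in> H1 \<Omega> \<Longrightarrow> norm_of (L2_inner bdry) (T x) \<le> K * norm_of (H1_inner \<Omega>) x"
    using trace_norm by blast
  have TY: "T y \<in> L2 ?Y" if "y \<in> H1 \<Omega>" for y using L2_restrict_subset(1)[OF sub trace_L2[OF that]] .
  have le: "norm_of (L2_inner ?Y) (T s) \<le> K * (norm_of (L2_inner vol) (s - x n) + norm_of (grad_inner \<Omega>) (s - x n))" for n
  proof -
    have "AE \<omega> in ?Y. T (s - x n + x n) \<omega> = T (s - x n) \<omega> + T (x n) \<omega>"
      by (rule restrict_space_AE_subset[OF sub trace_add[OF e V_H1[OF x]]])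
    moreover have "AE \<omega> in ?Y. T (x n) \<omega> = 0" using x[of n] by (simp add: H1_vanishing_on_def)
    ultimately have "AE \<omega> in ?Y. T s \<omega> = T (s - x n) \<omega>" by eventually_elim simp
    then have "norm_of (L2_inner ?Y) (T s) = norm_of (L2_inner ?Y) (T (s - x n))"
      using TY[OF s] TY[OF e] by (intro L2_norm_cong_AE L2_measurable)
    also have "\<dots> \<le> norm_of (L2_inner bdry) (T (s - x n))" by (rule L2_restrict_subset(2)[OF sub trace_L2[OF e]])
    also have "\<dots> \<le> K * norm_of (H1_inner \<Omega>) (s - x n)" by (rule K(2)[OF e])
    also have "\<dots> \<le> K * (norm_of (L2_inner vol) (s - x n) + norm_of (grad_inner \<Omega>) (s - x n))"
      by (intro mult_left_mono H1_norm_le e K(1))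
    finally show ?thesis .
  qed
  have "(\<lambda>n. K * (norm_of (L2_inner vol) (s - x n) + norm_of (grad_inner \<Omega>) (s - x n))) \<longlonglongrightarrow> K * (0 + 0)"
    by (intro tendsto_intros lim)
  then have "norm_of (L2_inner ?Y) (T s) \<le> K * (0 + 0)" using le by (intro LIMSEQ_le_const) auto
  then have "(\<integral>\<omega>. (T s \<omega>)\<^sup>2 \<partial>?Y) \<le> 0" by (simp add: norm_of_def L2_inner_def power2_eq_square)
  moreover have "0 \<le> (\<integral>\<omega>. (T s \<omega>)\<^sup>2 \<partial>?Y)" by simp
  ultimately have "(\<integral>\<omega>. (T s \<omega>)\<^sup>2 \<partial>?Y) = 0" by linarith
  then have "AE \<omega> in ?Y. (T s \<omega>)\<^sup>2 = 0"
    using L2_square_integrable[OF TY[OF s]] by (subst (asm) integral_nonneg_eq_0_iff_AE) auto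
  then show ?thesis using s by (simp add: H1_vanishing_on_def)
qed

text \<open>
  A series that converges absolutely for both norms converges in \<open>H1\<close>, its sum has trace
  zero on \<open>\<Upsilon>\<close>, and this sum agrees almost everywhere with any limit for the
  gradient norm, since that norm is definite on \<open>V\<close>. Hence the \<open>L2\<close> norm is
  countably subadditive.
\<close>

lemma poincare_inequality: "\<exists>C\<ge>0. \<forall>x\<in>V. norm_of (L2_inner vol) x \<le> C * nrm x"
proof (rule countably_subadditive_seminorm_bounded)
  interpret L: semi_inner_space "L2 vol" "L2_inner vol" by (rule semi_inner_space_L2)
  interpret H: semi_inner_space "H1 \<Omega>" "grad_inner \<Omega>" by (rule semi_inner_space_grad_inner[OF \<Omega>])
  have VL: "x \<in> L2 vol" if "x \<in> V" for x using H1_L2[OF V_H1[OF that]] .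
  show "0 \<le> L.nrm x" if "x \<in> V" for x using VL[OF that] by simp
  show "L.nrm (x + y) \<le> L.nrm x + L.nrm y" if "x \<in> V" "y \<in> V" for x y using VL that by (intro L.nrm_triangle)
  show "L.nrm (c *\<^sub>R x) = \<bar>c\<bar> * L.nrm x" if "x \<in> V" for c x using VL[OF that] by (rule L.nrm_scale)
  fix u x assume u: "\<And>k. u k \<in> V" and x: "x \<in> V" and s1: "summable (\<lambda>k. nrm (u k))"
    and s0: "summable (\<lambda>k. L.nrm (u k))" and lim: "(\<lambda>n. nrm (x - (\<Sum>k<n. u k))) \<longlonglongrightarrow> 0"
  define s where "s = (\<lambda>\<omega>. \<Sum>k. u k \<omega>)"
  note S = H1_series[OF \<Omega> V_H1[OF u] s0 s1, folded s_def]
  have part: "(\<Sum>k<n. u k) \<in> V" for n using u by simp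
  have sV: "s \<in> V" by (rule H1_limit_in_V[OF part S])
  have "(\<lambda>n. nrm (x - (\<Sum>k<n. u k)) + nrm (s - (\<Sum>k<n. u k))) \<longlonglongrightarrow> 0 + 0" by (intro tendsto_add lim S(3))
  moreover have "nrm (x - s) \<le> nrm (x - (\<Sum>k<n. u k)) + nrm (s - (\<Sum>k<n. u k))" for n
    using nrm_triangle_via[OF x sV part] nrm_minus_commute[OF sV part] by metis
  ultimately have "nrm (x - s) \<le> 0 + 0" by (intro LIMSEQ_le_const) auto
  then have "nrm (x - s) = 0" using nrm_nonneg[OF diff_mem[OF x sV]] by simp
  then have "grad_inner \<Omega> (x - s) (x - s) = 0" by (simp add: norm_of_def)
  then have "AE \<omega> in vol. (x - s) \<omega> = 0" by (rule hilbert_space_null_AE[OF hilbert diff_mem[OF x sV]])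
  then have "L.nrm x = L.nrm s"
    using VL[OF x] VL[OF sV] by (intro L2_norm_cong_AE L2_measurable) (auto elim: eventually_mono)
  also have "\<dots> \<le> (\<Sum>k. L.nrm (u k))" unfolding s_def using VL[OF u] s0 by (rule L2_series(3))
  finally show "L.nrm x \<le> (\<Sum>k. L.nrm (u k))" .
qed

lemma trace_bounded:
  assumes A: "A \<in> sets borel" "A \<subseteq> frontier \<Omega>"
  shows "\<exists>C\<ge>0. \<forall>x\<in>V. norm_of (L2_inner (surface_on A)) (T x) \<le> C * nrm x"
proof -
  obtain C where C: "0 \<le> C" "\<And>x. x \<in> V \<Longrightarrow> norm_of (L2_inner vol) x \<le> C * nrm x"
    using poincare_inequality by blast
  obtain K where K: "0 \<le> K" "\<And>x. x \<in> H1 \<Omega> \<Longrightarrow> norm_of (L2_inner bdry) (T x) \<le> K * norm_of (H1_inner \<Omega>) x"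
    using trace_norm by blast
  show ?thesis
  proof (intro exI[of _ "K * (C + 1)"] conjI ballI)
    fix x assume x: "x \<in> V"
    have "norm_of (L2_inner (surface_on A)) (T x) \<le> norm_of (L2_inner bdry) (T x)"
      by (rule L2_restrict_subset(2)[OF subset_boundary[OF A] trace_L2[OF V_H1[OF x]]])
    also have "\<dots> \<le> K * norm_of (H1_inner \<Omega>) x" by (rule K(2)[OF V_H1[OF x]])
    also have "\<dots> \<le> K * (C * nrm x + nrm x)"
      using H1_norm_le[OF V_H1[OF x]] C(2)[OF x] K(1) by (intro mult_left_mono) auto
    finally show "norm_of (L2_inner (surface_on A)) (T x) \<le> K * (C + 1) * nrm x" by (simp add: algebra_simps)
  qed (use K C in simp)
qed

lemma trace_restrict_L2:
  assumes "A \<in> sets borel" "A \<subseteq> frontier \<Omega>" "x \<in> H1 \<Omega>"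
  shows "T x \<in> L2 (surface_on A)"
  using L2_restrict_subset(1)[OF subset_boundary[OF assms(1,2)] trace_L2[OF assms(3)]] .

text \<open>
  Iterates are only determined almost everywhere, and this lemma shows that they remain in the space.
\<close>

lemma V_cong_AE:
  assumes x: "x \<in> V" and ae: "AE \<omega> in vol. w \<omega> = x \<omega>"
  shows "w \<in> V" and "nrm (w - x) = 0"
proof -
  interpret H: semi_inner_space "H1 \<Omega>" "grad_inner \<Omega>" by (rule semi_inner_space_grad_inner[OF \<Omega>])
  interpret L: semi_inner_space "L2 vol" "L2_inner vol" by (rule semi_inner_space_L2)
  have xL: "x \<in> L2 vol" using H1_L2[OF V_H1[OF x]] .
  have w: "w \<in> borel_measurable vol"
    by (rule borel_measurable_lebesgue_on_cong_AE[OF \<Omega>_lebesgue L2_measurable[OF xL] ae])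
  have wL: "w \<in> L2 vol" by (rule L2_cong_AE[OF xL w]) (use ae in \<open>auto elim: eventually_mono\<close>)
  have wH: "w \<in> H1 \<Omega>" using weak_grad_cong_AE(2)[OF \<Omega>_lebesgue wL xL ae] V_H1[OF x] by simp
  have ae0: "AE \<omega> in vol. (w - x) \<omega> = 0 \<omega>" using ae by eventually_elim simp
  have "weak_grad \<Omega> (w - x) = weak_grad \<Omega> 0"
    by (rule weak_grad_cong_AE(1)[OF \<Omega>_lebesgue L.diff_mem[OF wL xL] L.zero_mem ae0])
  then have "grad_inner \<Omega> (w - x) (w - x) = grad_inner \<Omega> 0 0" by (simp add: grad_inner_def)
  also have "\<dots> = 0" by simp
  finally show n0: "nrm (w - x) = 0" by (simp add: norm_of_def)
  have "norm_of (L2_inner vol) (w - x) = norm_of (L2_inner vol) 0"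
    using wL xL ae0 by (intro L2_norm_cong_AE L2_measurable) auto
  then have "norm_of (L2_inner vol) (w - x) = 0" by simp
  with n0 wH show "w \<in> V" using H1_limit_in_V[of "\<lambda>_. x" w] x by simp
qed

end

section \<open>Products of Hilbert spaces\<close>

lemma ereal_split_less:
  fixes a b :: ereal
  assumes "ereal c < a + b" "a \<noteq> -\<infinity>" "b \<noteq> -\<infinity>"
  obtains c1 c2 where "c = c1 + c2" "ereal c1 < a" "ereal c2 < b"
proof (cases a)
  case (real r)
  show ?thesis
  proof (cases b)
    case (real s)
    define d where "d = (r + s - c) / 2"
    have "0 < d" using assms \<open>a = ereal r\<close> real by (simp add: d_def)
    then show ?thesis using that[of "r - d" "s - d"] \<open>a = ereal r\<close> real by (simp add: d_def)
  next
    case PInf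
    then show ?thesis using that[of "r - 1" "c - (r - 1)"] real by simp
  qed (use assms in simp)
next
  case PInf
  show ?thesis
  proof (cases b)
    case (real s)
    then show ?thesis using that[of "c - (s - 1)" "s - 1"] PInf by simp
  next
    case PInf
    then show ?thesis using that[of c 0] \<open>a = \<infinity>\<close> by simp
  qed (use assms in simp)
qed (use assms in simp)

lemma ereal_sum_distrib_left:
  fixes g :: "'i \<Rightarrow> ereal"
  assumes "0 < c"
  shows "ereal c * (\<Sum>i\<in>A. g i) = (\<Sum>i\<in>A. ereal c * g i)"
proof (induction A rule: infinite_finite_induct)
  case (insert i A)
  have "ereal c * (x + y) = ereal c * x + ereal c * y" for x y :: ereal
    using assms by (cases x; cases y) (auto simp: algebra_simps)
  then show ?case using insert by simp
qed simp_all

lemma ereal_sum_not_minf: "(\<And>i. i \<in> A \<Longrightarrow> g i \<noteq> -\<infinity>) \<Longrightarrow> (\<Sum>i\<in>A. g i :: ereal) \<noteq> -\<infinity>"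
  by (induction A rule: infinite_finite_induct) auto

text \<open>
  A strict lower bound for the sum splits into strict lower bounds for the terms. Here
  \<open>Q i w \<delta>\<close> says that \<open>w\<close> lies in the neighbourhood of
  \<open>x i\<close> with radius \<open>\<delta>\<close>.
\<close>

lemma ereal_sum_lsc:
  assumes "finite A" and lsc: "\<And>i c. i \<in> A \<Longrightarrow> ereal c < g i (x i) \<Longrightarrow> \<exists>\<delta>>0. \<forall>w. Q i w \<delta> \<longrightarrow> ereal c < g i w"
    and mono: "\<And>i w \<delta> \<delta>'. Q i w \<delta> \<Longrightarrow> \<delta> \<le> \<delta>' \<Longrightarrow> Q i w \<delta>'"
    and minf: "\<And>i. i \<in> A \<Longrightarrow> g i (x i) \<noteq> -\<infinity>"
    and c: "ereal c < (\<Sum>i\<in>A. g i (x i))"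
  shows "\<exists>\<delta>>0::real. \<forall>y. (\<forall>i\<in>A. Q i (y i) \<delta>) \<longrightarrow> ereal c < (\<Sum>i\<in>A. g i (y i))"
  using assms(1) lsc minf c
proof (induction A arbitrary: c rule: finite_induct)
  case empty
  then show ?case by (auto intro: exI[of _ 1])
next
  case (insert j A)
  have "ereal c < g j (x j) + (\<Sum>i\<in>A. g i (x i))" using insert.prems(3) insert.hyps by simp
  moreover have "(\<Sum>i\<in>A. g i (x i)) \<noteq> -\<infinity>" using insert.prems(2) by (intro ereal_sum_not_minf) simp
  moreover have "g j (x j) \<noteq> -\<infinity>" using insert.prems(2) by simp
  ultimately obtain c1 c2 where cc: "c = c1 + c2" "ereal c1 < g j (x j)" "ereal c2 < (\<Sum>i\<in>A. g i (x i))"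
    using ereal_split_less by metis
  obtain d1 where d1: "0 < d1" "\<And>w. Q j w d1 \<Longrightarrow> ereal c1 < g j w" using insert.prems(1)[of j c1] cc(2) by auto
  obtain d2 where d2: "0 < d2" "\<And>y. (\<And>i. i \<in> A \<Longrightarrow> Q i (y i) d2) \<Longrightarrow> ereal c2 < (\<Sum>i\<in>A. g i (y i))"
    using insert.IH[OF _ _ cc(3)] insert.prems(1,2) by (metis insertCI)
  show ?case
  proof (intro exI[of _ "min d1 d2"] conjI allI impI)
    show "0 < min d1 d2" using d1 d2 by simp
    fix y assume y: "\<forall>i\<in>insert j A. Q i (y i) (min d1 d2)"
    have "ereal c1 < g j (y j)" using y by (intro d1(2)) (auto intro: mono)
    moreover have "ereal c2 < (\<Sum>i\<in>A. g i (y i))" using y by (intro d2(2)) (auto intro: mono)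
    ultimately have "ereal c1 + ereal c2 < g j (y j) + (\<Sum>i\<in>A. g i (y i))" by (rule ereal_add_strict_mono2)
    then show "ereal c < (\<Sum>i\<in>insert j A. g i (y i))" using insert.hyps cc(1) by simp
  qed
qed

locale hilbert_family =
  fixes I :: "'i set" and \<H> :: "'i \<Rightarrow> 'v::real_vector set" and ip :: "'i \<Rightarrow> 'v \<Rightarrow> 'v \<Rightarrow> real"
  assumes finite_I: "finite I"
    and component: "i \<in> I \<Longrightarrow> semi_hilbert_space (\<H> i) (ip i)"
begin

definition product_space :: "('i \<Rightarrow> 'v) set" where
  "product_space = {u. \<forall>i\<in>I. u i \<in> \<H> i}"

definition product_inner :: "('i \<Rightarrow> 'v) \<Rightarrow> ('i \<Rightarrow> 'v) \<Rightarrow> real" where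
  "product_inner u v = (\<Sum>i\<in>I. ip i (u i) (v i))"

lemma component_inner: "i \<in> I \<Longrightarrow> semi_inner_space (\<H> i) (ip i)"
  using component by (simp add: semi_hilbert_space_def)

lemma product_spaceD: "u \<in> product_space \<Longrightarrow> i \<in> I \<Longrightarrow> u i \<in> \<H> i"
  by (simp add: product_space_def)

lemma semi_inner_space_product: "semi_inner_space product_space product_inner"
proof
  note component_rules = semi_inner_space.zero_mem[OF component_inner] semi_inner_space.add_mem[OF component_inner]
    semi_inner_space.scale_mem[OF component_inner]
  show "subspace product_space"
    unfolding subspace_def product_space_def by (auto intro: component_rules)
  fix x y w assume x: "x \<in> product_space"
  show "0 \<le> product_inner x x"
    unfolding product_inner_def using x
    by (intro sum_nonneg) (auto intro: semi_inner_space.nonneg[OF component_inner] product_spaceD)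
  show "product_inner (c *\<^sub>R x) w = c * product_inner x w" if "w \<in> product_space" for c w
    unfolding product_inner_def sum_distrib_left using x that
    by (intro sum.cong) (auto simp: semi_inner_space.scale_left[OF component_inner] product_spaceD)
  assume y: "y \<in> product_space"
  show "product_inner x y = product_inner y x"
    unfolding product_inner_def using x y
    by (intro sum.cong) (auto intro: semi_inner_space.sym[OF component_inner] product_spaceD)
  assume w: "w \<in> product_space"
  show "product_inner (x + y) w = product_inner x w + product_inner y w"
    unfolding product_inner_def sum.distrib[symmetric] using x y w
    by (intro sum.cong) (auto simp: semi_inner_space.add_left[OF component_inner] product_spaceD)
qed

lemma product_norm: "norm_of product_inner u = sqrt (\<Sum>i\<in>I. ip i (u i) (u i))"
  by (simp add: norm_of_def product_inner_def)

lemma product_norm_L2_set: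
  assumes "u \<in> product_space"
  shows "norm_of product_inner u = L2_set (\<lambda>i. norm_of (ip i) (u i)) I"
  unfolding product_norm L2_set_def using assms
  by (intro arg_cong[where f = sqrt] sum.cong) (auto simp: semi_inner_space.nrm_power2[OF component_inner] product_spaceD)

lemma component_norm_nonneg: "u \<in> product_space \<Longrightarrow> i \<in> I \<Longrightarrow> 0 \<le> norm_of (ip i) (u i)"
  by (simp add: semi_inner_space.nrm_nonneg[OF component_inner] product_spaceD)

lemma component_norm_le: "u \<in> product_space \<Longrightarrow> i \<in> I \<Longrightarrow> norm_of (ip i) (u i) \<le> norm_of product_inner u"
  unfolding product_norm_L2_set by (rule member_le_L2_set[OF finite_I])

lemma product_norm_le: "u \<in> product_space \<Longrightarrow> norm_of product_inner u \<le> (\<Sum>i\<in>I. norm_of (ip i) (u i))"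
  unfolding product_norm_L2_set by (rule L2_set_le_sum) (rule component_norm_nonneg)

sublocale P: semi_hilbert_space product_space product_inner
proof (intro semi_hilbert_space.intro semi_inner_space_product semi_hilbert_space_axioms.intro)
  interpret S: semi_inner_space product_space product_inner by (rule semi_inner_space_product)
  fix xs :: "nat \<Rightarrow> 'i \<Rightarrow> 'v" assume xs: "\<And>n. xs n \<in> product_space"
    and cauchy: "\<And>e. 0 < e \<Longrightarrow> \<exists>n0. \<forall>k\<ge>n0. \<forall>n\<ge>n0. norm_of product_inner (xs k - xs n) < e"
  have "\<exists>x\<in>\<H> i. (\<lambda>n. norm_of (ip i) (xs n i - x)) \<longlonglongrightarrow> 0" if i: "i \<in> I" for i
  proof (rule semi_hilbert_space.complete[OF component[OF i]])
    show "xs n i \<in> \<H> i" for n using product_spaceD[OF xs i] .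
    fix e :: real assume "0 < e"
    from cauchy[OF this] obtain n0 where n0: "\<And>k n. n0 \<le> k \<Longrightarrow> n0 \<le> n \<Longrightarrow> norm_of product_inner (xs k - xs n) < e" by blast
    have "norm_of (ip i) (xs k i - xs n i) \<le> norm_of product_inner (xs k - xs n)" for k n
      using component_norm_le[OF S.diff_mem[OF xs xs] i, of k n] by simp
    then show "\<exists>n0. \<forall>k\<ge>n0. \<forall>n\<ge>n0. norm_of (ip i) (xs k i - xs n i) < e" using n0 by (meson le_less_trans)
  qed
  then obtain x where x: "\<And>i. i \<in> I \<Longrightarrow> x i \<in> \<H> i" "\<And>i. i \<in> I \<Longrightarrow> (\<lambda>n. norm_of (ip i) (xs n i - x i)) \<longlonglongrightarrow> 0"
    by metis
  have xP: "x \<in> product_space" using x by (simp add: product_space_def)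
  have le: "norm_of product_inner (xs n - x) \<le> (\<Sum>i\<in>I. norm_of (ip i) (xs n i - x i))" for n
    using product_norm_le[OF S.diff_mem[OF xs xP], of n] by simp
  have lim: "(\<lambda>n. \<Sum>i\<in>I. norm_of (ip i) (xs n i - x i)) \<longlonglongrightarrow> (\<Sum>i\<in>I. 0)" using x by (intro tendsto_sum)
  have "(\<lambda>n. norm_of product_inner (xs n - x)) \<longlonglongrightarrow> 0"
  proof (rule Lim_null_comparison)
    show "(\<lambda>n. \<Sum>i\<in>I. norm_of (ip i) (xs n i - x i)) \<longlonglongrightarrow> 0" using lim by simp
    show "\<forall>\<^sub>F n in sequentially. norm (norm_of product_inner (xs n - x)) \<le> (\<Sum>i\<in>I. norm_of (ip i) (xs n i - x i))"
      using le S.nrm_nonneg[OF S.diff_mem[OF xs xP]] by simp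
  qed
  with xP show "\<exists>x\<in>product_space. (\<lambda>n. norm_of product_inner (xs n - x)) \<longlonglongrightarrow> 0" by blast
qed

lemma weakly_converges_component:
  assumes x: "\<And>n. x n \<in> product_space" and c: "c \<in> product_space"
    and lim: "weakly_converges product_space product_inner x c" and i: "i \<in> I"
  shows "weakly_converges (\<H> i) (ip i) (\<lambda>n. x n i) (c i)"
  unfolding weakly_converges_def
proof
  fix h assume h: "h \<in> \<H> i"
  define e where "e j = (if j = i then h else 0)" for j
  have eP: "e \<in> product_space"
    using h semi_inner_space.zero_mem[OF component_inner] by (auto simp: product_space_def e_def)
  have pick: "product_inner u e = ip i (u i) h" if u: "u \<in> product_space" for u
  proof -
    have "product_inner u e = (\<Sum>j\<in>I. if j = i then ip i (u i) h else 0)"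
      unfolding product_inner_def
    proof (rule sum.cong)
      fix j assume j: "j \<in> I"
      interpret J: semi_inner_space "\<H> j" "ip j" by (rule component_inner[OF j])
      show "ip j (u j) (e j) = (if j = i then ip i (u i) h else 0)"
        using J.scale_right[of "u j" "u j" 0] product_spaceD[OF u j] by (simp add: e_def)
    qed simp
    then show ?thesis using finite_I i by simp
  qed
  have "(\<lambda>n. product_inner (x n) e) \<longlonglongrightarrow> product_inner c e"
    using lim eP by (simp add: weakly_converges_def)
  then show "(\<lambda>n. ip i (x n i) h) \<longlonglongrightarrow> ip i (c i) h" by (simp add: pick x c)
qed

context
  fixes f :: "'i \<Rightarrow> 'v \<Rightarrow> ereal"
  assumes not_minf: "\<And>i x. i \<in> I \<Longrightarrow> x \<in> \<H> i \<Longrightarrow> f i x \<noteq> -\<infinity>"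
begin

lemma separable_not_minf: "x \<in> product_space \<Longrightarrow> (\<Sum>i\<in>I. f i (x i)) \<noteq> -\<infinity>"
  by (intro ereal_sum_not_minf not_minf product_spaceD)

lemma separable_proper:
  assumes "\<And>i. i \<in> I \<Longrightarrow> \<exists>x\<in>\<H> i. f i x \<noteq> \<infinity>"
  shows "\<exists>x\<in>product_space. (\<Sum>i\<in>I. f i (x i)) \<noteq> \<infinity>"
proof -
  obtain x where "\<And>i. i \<in> I \<Longrightarrow> x i \<in> \<H> i \<and> f i (x i) \<noteq> \<infinity>" using assms by metis
  then show ?thesis by (intro bexI[of _ x]) (auto simp: product_space_def sum_Pinfty)
qed

lemma separable_convex:
  assumes "\<And>i x y. i \<in> I \<Longrightarrow> x \<in> \<H> i \<Longrightarrow> y \<in> \<H> i \<Longrightarrow> f i ((1 - t) *\<^sub>R x + t *\<^sub>R y) \<le> ereal (1 - t) * f i x + ereal t * f i y"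
    and x: "x \<in> product_space" and y: "y \<in> product_space" and t: "0 < t" "t < 1"
  shows "(\<Sum>i\<in>I. f i (((1 - t) *\<^sub>R x + t *\<^sub>R y) i)) \<le> ereal (1 - t) * (\<Sum>i\<in>I. f i (x i)) + ereal t * (\<Sum>i\<in>I. f i (y i))"
proof -
  have "(\<Sum>i\<in>I. f i (((1 - t) *\<^sub>R x + t *\<^sub>R y) i)) \<le> (\<Sum>i\<in>I. ereal (1 - t) * f i (x i) + ereal t * f i (y i))"
    using assms(1) product_spaceD[OF x] product_spaceD[OF y] by (intro sum_mono) simp
  also have "\<dots> = ereal (1 - t) * (\<Sum>i\<in>I. f i (x i)) + ereal t * (\<Sum>i\<in>I. f i (y i))"
    using t by (simp only: sum.distrib ereal_sum_distrib_left diff_gt_0_iff_gt)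
  finally show ?thesis .
qed

lemma separable_lsc:
  assumes lsc: "\<And>i x c. i \<in> I \<Longrightarrow> x \<in> \<H> i \<Longrightarrow> ereal c < f i x \<Longrightarrow>
      \<exists>\<delta>>0. \<forall>y\<in>\<H> i. norm_of (ip i) (y - x) < \<delta> \<longrightarrow> ereal c < f i y"
    and x: "x \<in> product_space" and c: "ereal c < (\<Sum>i\<in>I. f i (x i))"
  shows "\<exists>\<delta>>0. \<forall>y\<in>product_space. norm_of product_inner (y - x) < \<delta> \<longrightarrow> ereal c < (\<Sum>i\<in>I. f i (y i))"
proof -
  define Q where "Q i w \<delta> \<longleftrightarrow> w \<in> \<H> i \<and> norm_of (ip i) (w - x i) < \<delta>" for i w \<delta>
  have "\<exists>\<delta>>0. \<forall>y. (\<forall>i\<in>I. Q i (y i) \<delta>) \<longrightarrow> ereal c < (\<Sum>i\<in>I. f i (y i))"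
  proof (rule ereal_sum_lsc[where g = f and x = x and Q = Q, OF finite_I _ _ _ c])
    fix i c assume i: "i \<in> I" "ereal c < f i (x i)"
    then show "\<exists>\<delta>>0. \<forall>w. Q i w \<delta> \<longrightarrow> ereal c < f i w"
      using lsc[OF i(1) product_spaceD[OF x i(1)] i(2)] by (auto simp: Q_def)
  next
    fix i assume "i \<in> I"
    then show "f i (x i) \<noteq> -\<infinity>" by (intro not_minf product_spaceD[OF x])
  qed (auto simp: Q_def)
  then obtain \<delta> where \<delta>: "0 < \<delta>" "\<And>y. (\<And>i. i \<in> I \<Longrightarrow> Q i (y i) \<delta>) \<Longrightarrow> ereal c < (\<Sum>i\<in>I. f i (y i))" by blast
  show ?thesis
  proof (intro exI[of _ \<delta>] conjI ballI impI \<delta>)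
    fix y i assume y: "y \<in> product_space" "norm_of product_inner (y - x) < \<delta>" and i: "i \<in> I"
    then show "Q i (y i) \<delta>"
      using component_norm_le[OF P.diff_mem[OF y(1) x] i] product_spaceD[OF y(1) i] by (simp add: Q_def)
  qed
qed

lemma separable_prox:
  assumes g: "0 < \<gamma>" and w: "w \<in> product_space" and y: "y \<in> product_space" and u: "u \<in> product_space"
    and min: "\<And>i h. i \<in> I \<Longrightarrow> h \<in> \<H> i \<Longrightarrow> ereal \<gamma> * f i (y i) + ereal (1/2 * (norm_of (ip i) (y i - w i))\<^sup>2)
      \<le> ereal \<gamma> * f i h + ereal (1/2 * (norm_of (ip i) (h - w i))\<^sup>2)"
  shows "ereal \<gamma> * (\<Sum>i\<in>I. f i (y i)) + ereal (1/2 * (norm_of product_inner (y - w))\<^sup>2)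
    \<le> ereal \<gamma> * (\<Sum>i\<in>I. f i (u i)) + ereal (1/2 * (norm_of product_inner (u - w))\<^sup>2)"
proof -
  have split: "ereal \<gamma> * (\<Sum>i\<in>I. f i (v i)) + ereal (1/2 * (norm_of product_inner (v - w))\<^sup>2)
      = (\<Sum>i\<in>I. ereal \<gamma> * f i (v i) + ereal (1/2 * (norm_of (ip i) (v i - w i))\<^sup>2))" if v: "v \<in> product_space" for v
  proof -
    have "(norm_of product_inner (v - w))\<^sup>2 = (\<Sum>i\<in>I. (norm_of (ip i) (v i - w i))\<^sup>2)"
      using P.diff_mem[OF v w] by (simp add: product_norm_L2_set L2_set_def sum_nonneg)
    then show ?thesis
      by (simp add: sum.distrib ereal_sum_distrib_left[OF g] sum_divide_distrib flip: sum_ereal)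
  qed
  show ?thesis
    unfolding split[OF y] split[OF u] by (intro sum_mono min product_spaceD[OF u])
qed

end

end

text \<open>
  Boundedness is needed for the supremum in \<open>op_norm\<close> to be an upper bound at all, as it
  is a supremum of real numbers.
\<close>

lemma (in semi_inner_space) op_norm_bound:
  assumes bound: "\<And>x. x \<in> V \<Longrightarrow> norm_of ipW (L x) \<le> C * nrm x"
    and pos: "\<And>x. x \<in> V \<Longrightarrow> 0 \<le> norm_of ipW (L x)"
    and scale: "\<And>c x. x \<in> V \<Longrightarrow> norm_of ipW (L (c *\<^sub>R x)) = \<bar>c\<bar> * norm_of ipW (L x)"
  shows "0 \<le> op_norm V ip ipW L" and "x \<in> V \<Longrightarrow> norm_of ipW (L x) \<le> op_norm V ip ipW L * nrm x"
proof -
  have bdd: "bdd_above ((\<lambda>x. norm_of ipW (L x)) ` {x \<in> V. nrm x \<le> 1})"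
  proof (rule bdd_aboveI2)
    fix x assume x: "x \<in> {x \<in> V. nrm x \<le> 1}"
    then have "norm_of ipW (L x) \<le> C * nrm x" by (intro bound) simp
    also have "\<dots> \<le> \<bar>C\<bar> * 1" using x by (intro mult_mono) auto
    finally show "norm_of ipW (L x) \<le> \<bar>C\<bar> * 1" .
  qed
  have upper: "norm_of ipW (L x) \<le> op_norm V ip ipW L" if "x \<in> V" "nrm x \<le> 1" for x
    unfolding op_norm_def using that bdd by (intro cSUP_upper) auto
  show "0 \<le> op_norm V ip ipW L" using upper[of 0] pos[of 0] by simp
  assume x: "x \<in> V"
  show "norm_of ipW (L x) \<le> op_norm V ip ipW L * nrm x"
  proof (cases "nrm x = 0")
    case True
    then show ?thesis using bound[OF x] by simp
  next
    case False
    then have p: "0 < nrm x" using nrm_nonneg[OF x] by linarith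
    have "norm_of ipW (L ((1 / nrm x) *\<^sub>R x)) \<le> op_norm V ip ipW L"
      using x p by (intro upper) (auto simp: nrm_scale)
    then show ?thesis using p by (simp add: scale[OF x] field_simps)
  qed
qed

lemma L2_cong: "(\<And>\<omega>. \<omega> \<in> space M \<Longrightarrow> u \<omega> = v \<omega>) \<Longrightarrow> u \<in> L2 M \<longleftrightarrow> v \<in> L2 M"
  by (simp add: L2_def cong: measurable_cong Bochner_Integration.integrable_cong)

text \<open>
  The left side combines three separately chosen weak gradients; the combination is a weak gradient of
  the combined function.
\<close>

lemma grad_inner_distance:
  fixes \<Omega> :: "'a::euclidean_space set"
  assumes \<Omega>: "open \<Omega>" and u: "u \<in> H1 \<Omega>" and x: "x \<in> H1 \<Omega>" and w: "w \<in> H1 \<Omega>"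
  shows "(\<integral>\<omega>. (norm (weak_grad \<Omega> u \<omega> - weak_grad \<Omega> x \<omega> + \<gamma> *\<^sub>R weak_grad \<Omega> w \<omega>))\<^sup>2 \<partial>(lebesgue_on \<Omega>))
    = (norm_of (grad_inner \<Omega>) (u - (x - \<gamma> *\<^sub>R w)))\<^sup>2"
proof -
  have \<Omega>s: "\<Omega> \<in> sets lebesgue" using \<Omega> by simp
  interpret H: semi_inner_space "H1 \<Omega>" "grad_inner \<Omega>" by (rule semi_inner_space_grad_inner[OF \<Omega>])
  interpret L: semi_inner_space "L2 (lebesgue_on \<Omega>)" "L2_inner (lebesgue_on \<Omega>)" by (rule semi_inner_space_L2)
  define g where "g = weak_grad \<Omega> u + (-1) *\<^sub>R weak_grad \<Omega> x + \<gamma> *\<^sub>R weak_grad \<Omega> w"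
  define d where "d = u + (-1) *\<^sub>R x + \<gamma> *\<^sub>R w"
  have d: "d \<in> L2 (lebesgue_on \<Omega>)" using H1_L2[OF u] H1_L2[OF x] H1_L2[OF w] by (simp add: d_def)
  have g: "L2_weak_gradient \<Omega> d g"
    unfolding d_def g_def using H1_L2[OF u] H1_L2[OF x] H1_L2[OF w]
    by (intro L2_weak_gradient_combination \<Omega>s weak_grad u x w) simp_all
  have "(\<integral>\<omega>. g \<omega> \<bullet> g \<omega> \<partial>(lebesgue_on \<Omega>)) = grad_inner \<Omega> d d"
    unfolding grad_inner_eq[OF \<Omega> d g d g] by (intro L2_fields_inner(2) L2_weak_gradient_component[OF g])
  moreover have "g \<omega> = weak_grad \<Omega> u \<omega> - weak_grad \<Omega> x \<omega> + \<gamma> *\<^sub>R weak_grad \<Omega> w \<omega>" for \<omega> by (simp add: g_def)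
  moreover have "d = u - (x - \<gamma> *\<^sub>R w)" by (simp add: d_def)
  ultimately show ?thesis using u x w by (simp add: H.nrm_power2 power2_norm_eq_inner)
qed

lemma Gamma0D:
  assumes "Gamma0 V ip f"
  shows "x \<in> V \<Longrightarrow> f x \<noteq> -\<infinity>" "\<exists>x\<in>V. f x \<noteq> \<infinity>"
    "x \<in> V \<Longrightarrow> y \<in> V \<Longrightarrow> 0 < t \<Longrightarrow> t < 1 \<Longrightarrow> f ((1 - t) *\<^sub>R x + t *\<^sub>R y) \<le> ereal (1 - t) * f x + ereal t * f y"
    "x \<in> V \<Longrightarrow> ereal c < f x \<Longrightarrow> \<exists>\<delta>>0. \<forall>y\<in>V. norm_of ip (y - x) < \<delta> \<longrightarrow> ereal c < f y"
  using assms by (simp_all add: Gamma0_def plus_fun_def scaleR_fun_def fun_diff_def)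


section \<open>Traces on parts of the boundary\<close>

context trace_space
begin

context
  fixes A :: "'a set"
  assumes A: "A \<in> sets borel" "A \<subseteq> frontier \<Omega>"
begin

lemma space_surface_on: "space (surface_on A) = A"
  by (simp add: space_restrict_space)

lemma restricted_trace_L2:
  assumes "x \<in> V" shows "restrict (T x) A \<in> L2 (surface_on A)"
  using trace_restrict_L2[OF A V_H1[OF assms]] L2_cong[of "surface_on A" "restrict (T x) A" "T x"]
  by (simp add: space_surface_on)

lemma restricted_trace_add:
  assumes "x \<in> V" "y \<in> V"
  shows "AE \<omega> in surface_on A. restrict (T (x + y)) A \<omega> = restrict (T x) A \<omega> + restrict (T y) A \<omega>"
  using restrict_space_AE_subset[OF subset_boundary[OF A] trace_add[OF V_H1[OF assms(1)] V_H1[OF assms(2)]]] AE_space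
  by eventually_elim (simp add: space_surface_on)

lemma restricted_trace_scale:
  assumes "x \<in> V"
  shows "AE \<omega> in surface_on A. restrict (T (c *\<^sub>R x)) A \<omega> = c * restrict (T x) A \<omega>"
  using restrict_space_AE_subset[OF subset_boundary[OF A] trace_scale[OF V_H1[OF assms]]] AE_space
  by eventually_elim (simp add: space_surface_on)

lemma restricted_trace_norm: "norm_of (L2_inner (surface_on A)) (restrict (T x) A) = norm_of (L2_inner (surface_on A)) (T x)"
  unfolding norm_of_def L2_inner_def
  by (intro arg_cong[where f = sqrt] Bochner_Integration.integral_cong) (simp_all add: space_surface_on)

lemma restricted_trace_op_norm:
  defines "\<T> \<equiv> \<lambda>x. restrict (T x) A"
  shows "0 \<le> op_norm V (grad_inner \<Omega>) (L2_inner (surface_on A)) \<T>"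
    and "x \<in> V \<Longrightarrow> norm_of (L2_inner (surface_on A)) (\<T> x) \<le> op_norm V (grad_inner \<Omega>) (L2_inner (surface_on A)) \<T> * nrm x"
proof -
  interpret L: semi_inner_space "L2 (surface_on A)" "L2_inner (surface_on A)" by (rule semi_inner_space_L2)
  obtain C where C: "\<And>x. x \<in> V \<Longrightarrow> L.nrm (T x) \<le> C * nrm x" using trace_bounded[OF A] by blast
  have 1: "L.nrm (\<T> x) \<le> C * nrm x" if "x \<in> V" for x using C[OF that] by (simp add: \<T>_def restricted_trace_norm)
  have 2: "0 \<le> L.nrm (\<T> x)" if "x \<in> V" for x using restricted_trace_L2[OF that] by (simp add: \<T>_def)
  have 3: "L.nrm (\<T> (c *\<^sub>R x)) = \<bar>c\<bar> * L.nrm (\<T> x)" if x: "x \<in> V" for c x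
  proof -
    have "L.nrm (\<T> (c *\<^sub>R x)) = L.nrm (c *\<^sub>R \<T> x)"
      using restricted_trace_scale[OF x, of c] restricted_trace_L2[OF x] restricted_trace_L2[OF scale_mem[OF x]]
      by (intro L2_norm_cong_AE L2_measurable) (simp_all add: \<T>_def)
    then show ?thesis using L.nrm_scale restricted_trace_L2[OF x] by (simp add: \<T>_def)
  qed
  show "0 \<le> op_norm V (grad_inner \<Omega>) (L2_inner (surface_on A)) \<T>" by (rule op_norm_bound(1)[OF 1 2 3])
  show "x \<in> V \<Longrightarrow> L.nrm (\<T> x) \<le> op_norm V (grad_inner \<Omega>) (L2_inner (surface_on A)) \<T> * nrm x"
    by (rule op_norm_bound(2)[OF 1 2 3])
qed

end

text \<open>
  As \<open>v j\<close> vanishes off \<open>A j\<close>, the sets may overlap: the integral over the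
  union splits into the integrals over the single sets.
\<close>

lemma neumann_functional:
  assumes J: "finite J" and A: "\<And>j. j \<in> J \<Longrightarrow> A j \<in> sets borel" "\<And>j. j \<in> J \<Longrightarrow> A j \<subseteq> frontier \<Omega>"
    and v: "\<And>j. j \<in> J \<Longrightarrow> v j \<in> L2 (surface_on (A j))" "\<And>j \<omega>. j \<in> J \<Longrightarrow> \<omega> \<notin> A j \<Longrightarrow> v j \<omega> = 0"
    and x: "x \<in> V"
  shows "(\<integral>\<omega>. T x \<omega> * (\<Sum>j\<in>J. v j \<omega>) \<partial>surface_on (\<Union>j\<in>J. A j)) = (\<Sum>j\<in>J. L2_inner (surface_on (A j)) (v j) (T x))"
proof -
  let ?U = "\<Union>j\<in>J. A j" and ?S = "surface_measure :: 'a measure"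
  have U: "?U \<inter> space ?S \<in> sets ?S" using J A by (auto intro!: sets.finite_UN)
  have Aj: "A j \<inter> space ?S \<in> sets ?S" if "j \<in> J" for j using A(1)[OF that] by simp
  have int: "integrable ?S (\<lambda>\<omega>. indicator (A j) \<omega> *\<^sub>R (v j \<omega> * T x \<omega>))" if j: "j \<in> J" for j
    using L2_mult_integrable[OF v(1)[OF j] trace_restrict_L2[OF A[OF j] V_H1[OF x]]]
    by (simp add: integrable_restrict_space[OF Aj[OF j]])
  have "(\<integral>\<omega>. T x \<omega> * (\<Sum>j\<in>J. v j \<omega>) \<partial>surface_on ?U) = (\<integral>\<omega>. indicator ?U \<omega> *\<^sub>R (T x \<omega> * (\<Sum>j\<in>J. v j \<omega>)) \<partial>?S)"
    by (rule integral_restrict_space[OF U])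
  also have "\<dots> = (\<integral>\<omega>. (\<Sum>j\<in>J. indicator (A j) \<omega> *\<^sub>R (v j \<omega> * T x \<omega>)) \<partial>?S)"
  proof (rule Bochner_Integration.integral_cong)
    fix \<omega>
    have "indicator ?U \<omega> *\<^sub>R (T x \<omega> * (\<Sum>j\<in>J. v j \<omega>)) = (\<Sum>j\<in>J. indicator ?U \<omega> *\<^sub>R (v j \<omega> * T x \<omega>))"
      by (simp add: sum_distrib_left mult_ac)
    also have "\<dots> = (\<Sum>j\<in>J. indicator (A j) \<omega> *\<^sub>R (v j \<omega> * T x \<omega>))"
      using v(2) by (intro sum.cong refl) (auto simp: indicator_def)
    finally show "indicator ?U \<omega> *\<^sub>R (T x \<omega> * (\<Sum>j\<in>J. v j \<omega>)) = (\<Sum>j\<in>J. indicator (A j) \<omega> *\<^sub>R (v j \<omega> * T x \<omega>))" .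
  qed simp
  also have "\<dots> = (\<Sum>j\<in>J. \<integral>\<omega>. indicator (A j) \<omega> *\<^sub>R (v j \<omega> * T x \<omega>) \<partial>?S)"
    using int by (rule Bochner_Integration.integral_sum)
  also have "\<dots> = (\<Sum>j\<in>J. L2_inner (surface_on (A j)) (v j) (T x))"
    unfolding L2_inner_def by (intro sum.cong refl integral_restrict_space[symmetric] Aj)
  finally show ?thesis .
qed

end

section \<open>The domain decomposition method\<close>

text \<open>
  It remains to recognize the scheme as the forward-backward iteration in the product space: the
  coupling terms are indexed by the ordered pairs in \<open>K\<close>, the sum of the Neumann
  functionals is rearranged into the derivative of the coupling by exchanging the two members of each
  pair, and minimization in each component is minimization in the product.
\<close>

theorem theorem7p3:
  fixes \<Omega> :: "(real ^ 'n) set"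
    and \<Omega>s :: "nat \<Rightarrow> (real ^ 'n) set"
    and m p :: nat
    and \<Upsilon> :: "nat \<Rightarrow> nat \<Rightarrow> (real ^ 'n) set"
    and J :: "nat \<Rightarrow> nat set"
    and T :: "nat \<Rightarrow> (real ^ 'n \<Rightarrow> real) \<Rightarrow> real ^ 'n \<Rightarrow> real"
    and Tr :: "nat \<Rightarrow> nat \<Rightarrow> (real ^ 'n \<Rightarrow> real) \<Rightarrow> real ^ 'n \<Rightarrow> real"
    and \<H> :: "nat \<Rightarrow> (real ^ 'n \<Rightarrow> real) set"
    and ip :: "nat \<Rightarrow> (real ^ 'n \<Rightarrow> real) \<Rightarrow> (real ^ 'n \<Rightarrow> real) \<Rightarrow> real"
    and G :: "nat \<Rightarrow> nat \<Rightarrow> (real ^ 'n \<Rightarrow> real) set"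
    and ipG :: "nat \<Rightarrow> nat \<Rightarrow> (real ^ 'n \<Rightarrow> real) \<Rightarrow> (real ^ 'n \<Rightarrow> real) \<Rightarrow> real"
    and f :: "nat \<Rightarrow> (real ^ 'n \<Rightarrow> real) \<Rightarrow> ereal"
    and \<phi> :: "nat \<Rightarrow> nat \<Rightarrow> (real ^ 'n \<Rightarrow> real) \<Rightarrow> real"
    and \<tau> :: "nat \<Rightarrow> nat \<Rightarrow> real"
    and objective :: "(nat \<Rightarrow> real ^ 'n \<Rightarrow> real) \<Rightarrow> ereal"
    and solution :: "(nat \<Rightarrow> real ^ 'n \<Rightarrow> real) \<Rightarrow> bool"
    and K :: "(nat \<times> nat) set"
    and \<beta> \<epsilon> :: real
    and \<gamma> \<mu> :: "nat \<Rightarrow> real"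
    and \<mu>s :: "nat \<Rightarrow> nat \<Rightarrow> real"
    and x y z a b :: "nat \<Rightarrow> nat \<Rightarrow> real ^ 'n \<Rightarrow> real"
    and v :: "nat \<Rightarrow> nat \<Rightarrow> nat \<Rightarrow> real ^ 'n \<Rightarrow> real"
  assumes dim: "2 \<le> CARD('n)" and m: "2 \<le> m"
    and \<Omega>: "open \<Omega>" "bounded \<Omega>" "\<Omega> \<noteq> {}" "lipschitz_boundary \<Omega>"
    and \<Omega>s: "\<And>i. i \<in> {1..m} \<Longrightarrow> open (\<Omega>s i) \<and> \<Omega>s i \<subseteq> \<Omega> \<and> lipschitz_boundary (\<Omega>s i)"
    and \<Omega>s_disjoint: "disjoint_family_on \<Omega>s {1..m}"
    and \<Omega>s_cover: "closure \<Omega> = (\<Union>i\<in>{1..m}. closure (\<Omega>s i))"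
    and \<Upsilon>_diag: "\<And>i. i \<in> {1..m} \<Longrightarrow>
      \<Upsilon> i i = top_of_set (frontier \<Omega>) interior_of (frontier (\<Omega>s i) \<inter> frontier \<Omega>)"
    and \<Upsilon>_diag_nonempty: "\<And>i. i \<in> {1..m} \<Longrightarrow> \<Upsilon> i i \<noteq> {}"
    and \<Upsilon>_off_diag: "\<And>i j. i \<in> {1..m} \<Longrightarrow> j \<in> {i+1..m} \<Longrightarrow>
      \<Upsilon> i j = top_of_set (frontier (\<Omega>s i)) interior_of (frontier (\<Omega>s i) \<inter> frontier (\<Omega>s j)) \<and>
      \<Upsilon> j i = \<Upsilon> i j"
    and J: "\<And>i. i \<in> {1..m} \<Longrightarrow> J i = {j \<in> {1..m} - {i}. \<Upsilon> i j \<noteq> {}}"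
    and T: "\<And>i. i \<in> {1..m} \<Longrightarrow> is_trace_operator (\<Omega>s i) (T i)"
    and \<H>: "\<And>i. i \<in> {1..m} \<Longrightarrow> \<H> i = H1_vanishing_on (\<Omega>s i) (T i) (\<Upsilon> i i)"
    and ip: "\<And>i. i \<in> {1..m} \<Longrightarrow> ip i = grad_inner (\<Omega>s i)"
    and \<H>_hilbert: "\<And>i. i \<in> {1..m} \<Longrightarrow> hilbert_space (lebesgue_on (\<Omega>s i)) (\<H> i) (ip i)"
    and f: "\<And>i. i \<in> {1..m} \<Longrightarrow> Gamma0 (\<H> i) (ip i) (f i)"
    and G: "\<And>i j. i \<in> {1..m} \<Longrightarrow> j \<in> J i \<Longrightarrow> G i j = L2 (surface_on (\<Upsilon> i j))"
    and ipG: "\<And>i j. i \<in> {1..m} \<Longrightarrow> j \<in> J i \<Longrightarrow> ipG i j = L2_inner (surface_on (\<Upsilon> i j))"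
    and \<tau>: "\<And>i j. i \<in> {1..m} \<Longrightarrow> j \<in> J i \<Longrightarrow> 0 < \<tau> i j"
    and \<phi>_convex: "\<And>i j. i \<in> {1..m} \<Longrightarrow> j \<in> J i \<Longrightarrow> convex_function (G i j) (\<phi> i j)"
    and \<phi>_differentiable: "\<And>i j. i \<in> {1..m} \<Longrightarrow> j \<in> J i \<Longrightarrow>
      differentiable_with_lipschitz_gradient (G i j) (ipG i j) (\<phi> i j) (\<tau> i j)"
    and Tr: "\<And>i j u. i \<in> {1..m} \<Longrightarrow> j \<in> J i \<Longrightarrow> Tr i j u = restrict (T i u) (\<Upsilon> i j)"
    and objective: "\<And>u. objective u = (\<Sum>i=1..m. f i (u i)) +
      ereal (\<Sum>i=1..m. \<Sum>j\<in>J i. \<phi> i j (\<lambda>\<omega>. Tr i j (u i) \<omega> - Tr j i (u j) \<omega>))"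
    and solution: "\<And>u. solution u \<longleftrightarrow> (\<forall>i\<in>{1..m}. u i \<in> \<H> i) \<and>
      (\<forall>w. (\<forall>i\<in>{1..m}. w i \<in> \<H> i) \<longrightarrow> objective u \<le> objective w)"
    and solvable: "\<exists>u. solution u"
    and K: "K = {(k, l). k \<in> {1..m} \<and> l \<in> J k}"
    and p: "p = card K"
    and \<beta>: "\<beta> = 1 / (real p * (MAX (k, l) \<in> K. \<tau> k l *
      ((op_norm (\<H> k) (ip k) (ipG k l) (Tr k l))\<^sup>2 + (op_norm (\<H> l) (ip l) (ipG l k) (Tr l k))\<^sup>2)))"
    and \<epsilon>: "\<epsilon> \<in> {0<..<min 1 \<beta>}"
    and \<gamma>: "\<And>n. \<gamma> n \<in> {\<epsilon>..2 * \<beta> - \<epsilon>}"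
    and \<mu>: "\<And>n. \<mu> n \<in> {0..1 - \<epsilon>}"
    and x_0: "\<And>i. i \<in> {1..m} \<Longrightarrow> x i 0 \<in> \<H> i"
    and a: "\<And>i n. i \<in> {1..m} \<Longrightarrow> a i n \<in> \<H> i"
    and a_summable: "\<And>i. i \<in> {1..m} \<Longrightarrow> summable (\<lambda>n.
      sqrt (\<integral>\<omega>. (norm (weak_grad (\<Omega>s i) (a i n) \<omega>))\<^sup>2 \<partial>(lebesgue_on (\<Omega>s i))))"
    and b: "\<And>i n. i \<in> {1..m} \<Longrightarrow> b i n \<in> \<H> i"
    and b_summable: "\<And>i. i \<in> {1..m} \<Longrightarrow> summable (\<lambda>n.
      sqrt (\<integral>\<omega>. (norm (weak_grad (\<Omega>s i) (b i n) \<omega>))\<^sup>2 \<partial>(lebesgue_on (\<Omega>s i))))"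
    and \<mu>s: "\<And>i n. i \<in> {1..m} \<Longrightarrow> \<mu>s i n \<in> {0..<1}"
    and \<mu>s_summable: "\<And>i. i \<in> {1..m} \<Longrightarrow> summable (\<lambda>n. \<bar>\<mu>s i n - \<mu> n\<bar>)"
    and v: "\<And>i j n \<omega>. i \<in> {1..m} \<Longrightarrow> j \<in> J i \<Longrightarrow> v i j n \<omega> =
      (if \<omega> \<in> \<Upsilon> i j
       then gradient (G i j) (ipG i j) (\<phi> i j) (\<lambda>\<omega>. Tr i j (x i n) \<omega> - Tr j i (x j n) \<omega>) \<omega> -
            gradient (G j i) (ipG j i) (\<phi> j i) (\<lambda>\<omega>. Tr j i (x j n) \<omega> - Tr i j (x i n) \<omega>) \<omega>
       else 0)"
    and z: "\<And>i n. i \<in> {1..m} \<Longrightarrow>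
      dirichlet_neumann_weak_solution (\<Omega>s i) (T i) (\<Upsilon> i i) (\<Union>j\<in>J i. \<Upsilon> i j)
        (\<lambda>\<omega>. \<Sum>j\<in>J i. v i j n \<omega>) (z i n)"
    and y: "\<And>i n. i \<in> {1..m} \<Longrightarrow>
      is_arg_min
        (\<lambda>u. ereal (\<gamma> n) * f i u +
          ereal (1 / 2 * (\<integral>\<omega>. (norm (weak_grad (\<Omega>s i) u \<omega> - weak_grad (\<Omega>s i) (x i n) \<omega> +
            \<gamma> n *\<^sub>R weak_grad (\<Omega>s i) (\<lambda>\<omega>. z i n \<omega> + b i n \<omega>) \<omega>))\<^sup>2 \<partial>(lebesgue_on (\<Omega>s i)))))
        (\<lambda>u. u \<in> \<H> i) (y i n)"
    and x_Suc: "\<And>i n. i \<in> {1..m} \<Longrightarrow>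
      AE \<omega> in lebesgue_on (\<Omega>s i).
        x i (Suc n) \<omega> = \<mu>s i n * x i n \<omega> + (1 - \<mu>s i n) * (y i n \<omega> + a i n \<omega>)"
  shows "\<exists>u. (\<forall>i\<in>{1..m}. u i \<in> \<H> i \<and> weakly_converges (\<H> i) (ip i) (x i) (u i)) \<and> solution u"
proof -
  let ?I = "{1..m}"
  \<comment> \<open>keeps \<open>{1..m}\<close> from being rewritten to \<open>{Suc 0..m}\<close> inside the locale parameters\<close>
  note One_nat_def [simp del]
  have trace: "trace_space (\<Omega>s i) (T i) (\<Upsilon> i i)" if i: "i \<in> ?I" for i
  proof
    show "open (\<Omega>s i)" using \<Omega>s[OF i] by blast
    show "is_trace_operator (\<Omega>s i) (T i)" by (rule T[OF i])
    show "\<Upsilon> i i \<subseteq> frontier (\<Omega>s i)" unfolding \<Upsilon>_diag[OF i] using interior_of_subset by fastforce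
    have "openin (top_of_set (frontier \<Omega>)) (\<Upsilon> i i)" unfolding \<Upsilon>_diag[OF i] by (rule openin_interior_of)
    then obtain U where "open U" "\<Upsilon> i i = frontier \<Omega> \<inter> U" by (auto simp: openin_open)
    then show "\<Upsilon> i i \<in> sets borel" by (simp add: borel_closed borel_open sets.Int)
    show "hilbert_space (lebesgue_on (\<Omega>s i)) (H1_vanishing_on (\<Omega>s i) (T i) (\<Upsilon> i i)) (grad_inner (\<Omega>s i))"
      using \<H>_hilbert[OF i] unfolding \<H>[OF i] ip[OF i] .
  qed
  have open_\<Omega>s: "open (\<Omega>s i)" if "i \<in> ?I" for i using \<Omega>s[OF that] by blast
  have interface_less: "\<Upsilon> i j \<in> sets borel \<and> \<Upsilon> i j \<subseteq> frontier (\<Omega>s i) \<inter> frontier (\<Omega>s j) \<and> \<Upsilon> j i = \<Upsilon> i j"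
    if i: "i \<in> ?I" and j: "j \<in> ?I" and ij: "i < j" for i j
  proof -
    have eq: "\<Upsilon> i j = top_of_set (frontier (\<Omega>s i)) interior_of (frontier (\<Omega>s i) \<inter> frontier (\<Omega>s j))" "\<Upsilon> j i = \<Upsilon> i j"
      using \<Upsilon>_off_diag[OF i, of j] i j ij by auto
    have "openin (top_of_set (frontier (\<Omega>s i))) (\<Upsilon> i j)" unfolding eq by (rule openin_interior_of)
    then obtain U where "open U" "\<Upsilon> i j = frontier (\<Omega>s i) \<inter> U" by (auto simp: openin_open)
    then have "\<Upsilon> i j \<in> sets borel" by (simp add: borel_closed borel_open sets.Int)
    moreover have "\<Upsilon> i j \<subseteq> frontier (\<Omega>s i) \<inter> frontier (\<Omega>s j)" unfolding eq by (rule interior_of_subset)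
    ultimately show ?thesis using eq by blast
  qed
  have JI: "j \<in> ?I" "j \<noteq> i" if "i \<in> ?I" "j \<in> J i" for i j using that J[OF that(1)] by auto
  have interface: "\<Upsilon> i j \<in> sets borel" "\<Upsilon> i j \<subseteq> frontier (\<Omega>s i)" "\<Upsilon> i j \<subseteq> frontier (\<Omega>s j)" "\<Upsilon> j i = \<Upsilon> i j"
    if ij: "i \<in> ?I" "j \<in> J i" for i j
  proof -
    have "\<Upsilon> i j \<in> sets borel \<and> \<Upsilon> i j \<subseteq> frontier (\<Omega>s i) \<inter> frontier (\<Omega>s j) \<and> \<Upsilon> j i = \<Upsilon> i j"
    proof (cases "i < j")
      case True
      then show ?thesis using interface_less[OF ij(1) JI(1)[OF ij]] by blast
    next
      case False
      then have "j < i" using JI(2)[OF ij] by simp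
      note less = interface_less[OF JI(1)[OF ij] ij(1) this]
      then have "\<Upsilon> i j = \<Upsilon> j i" by blast
      with less show ?thesis by (simp add: Int_commute)
    qed
    then show "\<Upsilon> i j \<in> sets borel" "\<Upsilon> i j \<subseteq> frontier (\<Omega>s i)" "\<Upsilon> i j \<subseteq> frontier (\<Omega>s j)" "\<Upsilon> j i = \<Upsilon> i j"
      by blast+
  qed
  have J_sym: "i \<in> J j" if "i \<in> ?I" "j \<in> J i" for i j
    using J[OF that(1)] J[OF JI(1)[OF that]] that JI[OF that] interface(4)[OF that] by auto
  have finite_J: "finite (J i)" if "i \<in> ?I" for i using J[OF that] by simp
  have K_eq: "K = Sigma ?I J" using K by auto
  have finite_K: "finite K" unfolding K_eq using finite_J by (intro finite_SigmaI) auto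
  have K_swap: "(j, i) \<in> K" if "(i, j) \<in> K" for i j
    using that JI[of i j] J_sym[of i j] unfolding K_eq by blast
  have Tr_eq: "Tr i j = (\<lambda>u. restrict (T i u) (\<Upsilon> i j))" if "i \<in> ?I" "j \<in> J i" for i j
    by (rule ext) (rule Tr[OF that])

  interpret HF: hilbert_family ?I \<H> ip
    by (rule hilbert_family.intro) (simp, rule hilbert_space_imp_semi_hilbert_space[OF \<H>_hilbert])
  let ?V = HF.product_space and ?ip = HF.product_inner

  \<comment> \<open>the operator norms bound the traces, by the Poincare inequality\<close>
  define \<theta> where "\<theta> k l = op_norm (\<H> k) (ip k) (ipG k l) (Tr k l)" for k l
  have Tr_L2: "Tr i j u \<in> G i j" if "i \<in> ?I" "j \<in> J i" "u \<in> \<H> i" for i j u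
    using trace_space.restricted_trace_L2[OF trace[OF that(1)] interface(1,2)[OF that(1,2)]] that
    by (simp add: Tr G \<H>)
  have \<theta>: "0 \<le> \<theta> i j" "u \<in> \<H> i \<Longrightarrow> norm_of (ipG i j) (Tr i j u) \<le> \<theta> i j * norm_of (ip i) u"
    if "i \<in> ?I" "j \<in> J i" for i j u
    using trace_space.restricted_trace_op_norm[OF trace[OF that(1)] interface(1,2)[OF that]]
    unfolding \<theta>_def Tr_eq[OF that] ip[OF that(1)] ipG[OF that] \<H>[OF that(1)] by blast+
  have G_swap: "G j i = G i j" "ipG j i = ipG i j" if "i \<in> ?I" "j \<in> J i" for i j
    using G[OF that] ipG[OF that] G[OF JI(1)[OF that] J_sym[OF that]] ipG[OF JI(1)[OF that] J_sym[OF that]] interface(4)[OF that]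
    by simp_all
  have semi_G: "semi_inner_space (G i j) (ipG i j)" if "i \<in> ?I" "j \<in> J i" for i j
    unfolding G[OF that] ipG[OF that] by (rule semi_inner_space_L2)
  have Tr_add: "AE \<omega> in surface_on (\<Upsilon> i j). Tr i j (u + u') \<omega> = Tr i j u \<omega> + Tr i j u' \<omega>"
    if "i \<in> ?I" "j \<in> J i" "u \<in> \<H> i" "u' \<in> \<H> i" for i j u u'
    using trace_space.restricted_trace_add[OF trace[OF that(1)] interface(1,2)[OF that(1,2)]] that by (simp add: Tr_eq \<H>)
  have Tr_scale: "AE \<omega> in surface_on (\<Upsilon> i j). Tr i j (c *\<^sub>R u) \<omega> = c * Tr i j u \<omega>"
    if "i \<in> ?I" "j \<in> J i" "u \<in> \<H> i" for i j u c
    using trace_space.restricted_trace_scale[OF trace[OF that(1)] interface(1,2)[OF that(1,2)]] that by (simp add: Tr_eq \<H>)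
  have Tr_inner_add: "ipG i j w (Tr i j (u + u')) = ipG i j w (Tr i j u) + ipG i j w (Tr i j u')"
    if ij: "i \<in> ?I" "j \<in> J i" and u: "u \<in> \<H> i" "u' \<in> \<H> i" and w: "w \<in> G i j" for i j u u' w
  proof -
    interpret L: semi_inner_space "G i j" "ipG i j" by (rule semi_G[OF ij])
    interpret Hi: semi_inner_space "\<H> i" "ip i" using ij by (intro HF.component_inner)
    note mem = Tr_L2[OF ij]
    have "ipG i j w (Tr i j (u + u')) = ipG i j w (Tr i j u + Tr i j u')"
      unfolding ipG[OF ij] using Tr_add[OF ij u] mem[OF Hi.add_mem[OF u]] L.add_mem[OF mem[OF u(1)] mem[OF u(2)]] w
      by (intro L2_inner_cong_AE(2) L2_measurable) (simp_all add: G[OF ij])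
    then show ?thesis using mem u w by (simp add: L.add_right)
  qed
  have Tr_inner_scale: "ipG i j w (Tr i j (c *\<^sub>R u)) = c * ipG i j w (Tr i j u)"
    if ij: "i \<in> ?I" "j \<in> J i" and u: "u \<in> \<H> i" and w: "w \<in> G i j" for i j u c w
  proof -
    interpret L: semi_inner_space "G i j" "ipG i j" by (rule semi_G[OF ij])
    interpret Hi: semi_inner_space "\<H> i" "ip i" using ij by (intro HF.component_inner)
    note mem = Tr_L2[OF ij]
    have "ipG i j w (Tr i j (c *\<^sub>R u)) = ipG i j w (c *\<^sub>R Tr i j u)"
      unfolding ipG[OF ij] using Tr_scale[OF ij u] mem[OF Hi.scale_mem[OF u]] L.scale_mem[OF mem[OF u]] w
      by (intro L2_inner_cong_AE(2) L2_measurable) (simp_all add: G[OF ij])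
    then show ?thesis using mem u w by (simp add: L.scale_right)
  qed

  \<comment> \<open>the coupling, as a sum over the pairs of neighbours\<close>
  define W where "W = (\<lambda>(k, l). G k l)"
  define ipW where "ipW = (\<lambda>(k, l). ipG k l)"
  define \<psi> where "\<psi> = (\<lambda>(k, l). \<phi> k l)"
  define t where "t = (\<lambda>(k, l). \<tau> k l)"
  define L where "L = (\<lambda>(k, l) (u :: nat \<Rightarrow> real ^ 'n \<Rightarrow> real). Tr k l (u k) - Tr l k (u l))"
  define c where "c = (\<lambda>(k, l). sqrt ((\<theta> k l)\<^sup>2 + (\<theta> l k)\<^sup>2))"
  note pair_defs = W_def ipW_def \<psi>_def t_def L_def c_def
  have L_mem: "L q u \<in> W q" if qK: "q \<in> K" and u: "u \<in> ?V" for q u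
  proof -
    obtain k l where q: "q = (k, l)" "k \<in> ?I" "l \<in> J k" using qK unfolding K_eq by (rule SigmaE)
    interpret L: semi_inner_space "G k l" "ipG k l" by (rule semi_G[OF q(2,3)])
    have "Tr k l (u k) \<in> G k l" "Tr l k (u l) \<in> G k l"
      using Tr_L2[OF q(2,3)] Tr_L2[OF JI(1)[OF q(2,3)] J_sym[OF q(2,3)]] G_swap[OF q(2,3)] HF.product_spaceD[OF u] q JI[OF q(2,3)]
      by auto
    then show ?thesis by (simp add: q pair_defs)
  qed
  have L_inner: "ipW q w (L q u) = ipG (fst q) (snd q) w (Tr (fst q) (snd q) (u (fst q))) - ipG (snd q) (fst q) w (Tr (snd q) (fst q) (u (snd q)))"
    if qK: "q \<in> K" and u: "u \<in> ?V" and w: "w \<in> W q" for q u w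
  proof -
    obtain k l where q: "q = (k, l)" "k \<in> ?I" "l \<in> J k" using qK unfolding K_eq by (rule SigmaE)
    interpret L: semi_inner_space "G k l" "ipG k l" by (rule semi_G[OF q(2,3)])
    have "Tr k l (u k) \<in> G k l" "Tr l k (u l) \<in> G k l"
      using Tr_L2[OF q(2,3)] Tr_L2[OF JI(1)[OF q(2,3)] J_sym[OF q(2,3)]] G_swap[OF q(2,3)] HF.product_spaceD[OF u] q JI[OF q(2,3)]
      by auto
    then show ?thesis using w by (simp add: q pair_defs G_swap[OF q(2,3)] L.diff_right)
  qed
  interpret SC: smooth_coupling ?V ?ip K W ipW \<psi> t L c
  proof (intro smooth_coupling.intro smooth_coupling_axioms.intro HF.P.semi_inner_space_axioms)
    show "finite K" by (rule finite_K)
    fix q assume "q \<in> K"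
    then obtain k l where q: "q = (k, l)" "k \<in> ?I" "l \<in> J k" unfolding K_eq by (rule SigmaE)
    note kl = q(2,3) and lk = JI(1)[OF q(2,3)] J_sym[OF q(2,3)]
    show "smooth_convex_function (W q) (ipW q) (\<psi> q) (t q)"
      unfolding q pair_defs prod.case
      by (intro smooth_convex_function.intro smooth_convex_function_axioms.intro semi_G \<phi>_convex \<phi>_differentiable \<tau> kl)
    show "0 \<le> c q" by (simp add: q pair_defs)
    show "L q u \<in> W q" if "u \<in> ?V" for u by (rule L_mem[OF \<open>q \<in> K\<close> that])
    fix u assume u: "u \<in> ?V"
    have uk: "u k \<in> \<H> k" "u l \<in> \<H> l" using HF.product_spaceD[OF u] kl lk by auto
    show "norm_of (ipW q) (L q u) \<le> c q * norm_of ?ip u"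
    proof -
      interpret L: semi_inner_space "G k l" "ipG k l" by (rule semi_G[OF kl])
      have mem: "Tr k l (u k) \<in> G k l" "Tr l k (u l) \<in> G k l"
        using Tr_L2[OF kl uk(1)] Tr_L2[OF lk uk(2)] G_swap[OF kl] by auto
      have "L.nrm (Tr k l (u k) - Tr l k (u l)) \<le> L.nrm (Tr k l (u k)) + L.nrm (Tr l k (u l))"
        using mem by (rule L.nrm_triangle_diff)
      also have "\<dots> \<le> \<theta> k l * norm_of (ip k) (u k) + \<theta> l k * norm_of (ip l) (u l)"
        using \<theta>(2)[OF kl uk(1)] \<theta>(2)[OF lk uk(2)] unfolding G_swap[OF kl] by (rule add_mono)
      also have "\<dots> \<le> sqrt ((\<theta> k l)\<^sup>2 + (\<theta> l k)\<^sup>2) * sqrt ((norm_of (ip k) (u k))\<^sup>2 + (norm_of (ip l) (u l))\<^sup>2)"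
      proof -
        have "(x1 * y1 + x2 * y2)\<^sup>2 \<le> (x1\<^sup>2 + x2\<^sup>2) * (y1\<^sup>2 + y2\<^sup>2)" for x1 x2 y1 y2 :: real
        proof -
          have "(x1\<^sup>2 + x2\<^sup>2) * (y1\<^sup>2 + y2\<^sup>2) - (x1 * y1 + x2 * y2)\<^sup>2 = (x1 * y2 - x2 * y1)\<^sup>2" by algebra
          then show ?thesis using zero_le_power2[of "x1 * y2 - x2 * y1"] by linarith
        qed
        then show ?thesis unfolding real_sqrt_mult[symmetric] by (rule real_le_rsqrt)
      qed
      also have "sqrt ((norm_of (ip k) (u k))\<^sup>2 + (norm_of (ip l) (u l))\<^sup>2) \<le> norm_of ?ip u"
        unfolding HF.product_norm_L2_set[OF u] L2_set_def
      proof (rule real_sqrt_le_mono)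
        have "(norm_of (ip k) (u k))\<^sup>2 + (norm_of (ip l) (u l))\<^sup>2 = (\<Sum>i\<in>{k, l}. (norm_of (ip i) (u i))\<^sup>2)"
          using JI(2)[OF kl] by simp
        also have "\<dots> \<le> (\<Sum>i\<in>?I. (norm_of (ip i) (u i))\<^sup>2)" using kl lk by (intro sum_mono2) auto
        finally show "(norm_of (ip k) (u k))\<^sup>2 + (norm_of (ip l) (u l))\<^sup>2 \<le> (\<Sum>i\<in>?I. (norm_of (ip i) (u i))\<^sup>2)" .
      qed
      finally show ?thesis by (simp add: q pair_defs mult_left_mono)
    qed
    fix w assume w: "w \<in> W q"
    then have wG: "w \<in> G k l" "w \<in> G l k" using G_swap[OF kl] by (simp_all add: q pair_defs)
    show "ipW q w (L q (r *\<^sub>R u)) = r * ipW q w (L q u)" for r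
      unfolding L_inner[OF \<open>q \<in> K\<close> HF.P.scale_mem[OF u] w] L_inner[OF \<open>q \<in> K\<close> u w]
      using Tr_inner_scale[OF kl uk(1) wG(1)] Tr_inner_scale[OF lk uk(2) wG(2)] by (simp add: q algebra_simps)
    fix u' assume u': "u' \<in> ?V"
    have uk': "u' k \<in> \<H> k" "u' l \<in> \<H> l" using HF.product_spaceD[OF u'] kl lk by auto
    show "ipW q w (L q (u + u')) = ipW q w (L q u) + ipW q w (L q u')"
      unfolding L_inner[OF \<open>q \<in> K\<close> HF.P.add_mem[OF u u'] w] L_inner[OF \<open>q \<in> K\<close> u w] L_inner[OF \<open>q \<in> K\<close> u' w]
      using Tr_inner_add[OF kl uk(1) uk'(1) wG(1)] Tr_inner_add[OF lk uk(2) uk'(2) wG(2)] by (simp add: q)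
  qed

  \<comment> \<open>\<open>\<beta> > 0\<close> excludes the degenerate cases of no neighbours and of vanishing traces, where \<open>\<beta>\<close> would be \<open>1 / 0 = 0\<close>\<close>
  define M where "M = (MAX (k, l) \<in> K. \<tau> k l * ((\<theta> k l)\<^sup>2 + (\<theta> l k)\<^sup>2))"
  have \<beta>_eq: "\<beta> = 1 / (real (card K) * M)" unfolding \<beta> p M_def \<theta>_def by simp
  have \<beta>_pos: "0 < \<beta>" using \<epsilon> by auto
  then have "real (card K) * M > 0" unfolding \<beta>_eq by (simp add: zero_less_divide_iff)
  then have M_pos: "0 < M" by (simp add: zero_less_mult_iff)
  have M_ge: "t q * (c q)\<^sup>2 \<le> M" if q: "q \<in> K" for q
  proof -
    have "t q * (c q)\<^sup>2 = (case q of (k, l) \<Rightarrow> \<tau> k l * ((\<theta> k l)\<^sup>2 + (\<theta> l k)\<^sup>2))"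
      by (cases q) (simp add: pair_defs)
    also have "\<dots> \<le> M" unfolding M_def using q finite_K by (intro Max_ge) auto
    finally show ?thesis .
  qed

  define F where "F u = (\<Sum>i\<in>?I. f i (u i))" for u
  note \<Gamma> = Gamma0D[OF f]
  interpret FB: smooth_plus_convex ?V ?ip F SC.coupling SC.coupling_derivative \<beta> "\<Sum>q\<in>K. t q / 2 * (c q)\<^sup>2"
  proof (intro smooth_plus_convex.intro smooth_plus_convex_axioms.intro HF.P.semi_hilbert_space_axioms)
    show "F u \<noteq> -\<infinity>" if "u \<in> ?V" for u unfolding F_def using \<Gamma>(1) that by (rule HF.separable_not_minf)
    show "\<exists>u\<in>?V. F u \<noteq> \<infinity>" unfolding F_def using \<Gamma>(1) \<Gamma>(2) by (rule HF.separable_proper)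
    show "F ((1 - s) *\<^sub>R u + s *\<^sub>R w) \<le> ereal (1 - s) * F u + ereal s * F w"
      if "u \<in> ?V" "w \<in> ?V" "0 < s" "s < 1" for u w s
      unfolding F_def by (rule HF.separable_convex[OF \<Gamma>(1) \<Gamma>(3)[OF _ _ _ that(3,4)] that])
    show "\<exists>\<delta>>0. \<forall>w\<in>?V. norm_of ?ip (w - u) < \<delta> \<longrightarrow> ereal r < F w" if "u \<in> ?V" "ereal r < F u" for u r
      unfolding F_def by (rule HF.separable_lsc[OF \<Gamma>(1) \<Gamma>(4) that[unfolded F_def]])
    show "0 < \<beta>" by (rule \<beta>_pos)
    show "\<beta> * (SC.coupling_derivative u h - SC.coupling_derivative w h)\<^sup>2
        \<le> (SC.coupling_derivative u (u - w) - SC.coupling_derivative w (u - w)) * (norm_of ?ip h)\<^sup>2"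
      if "u \<in> ?V" "w \<in> ?V" "h \<in> ?V" for u w h
      unfolding \<beta>_eq using that M_pos M_ge by (intro SC.coupling_derivative_cocoercive)
  qed (fact SC.coupling_derivative_add SC.coupling_derivative_scale SC.coupling_derivative_bounded
      SC.coupling_lower SC.coupling_upper)+

  have objective_eq: "objective u = F u + ereal (SC.coupling u)" for u
  proof -
    have "(\<Sum>i=1..m. \<Sum>j\<in>J i. \<phi> i j (\<lambda>\<omega>. Tr i j (u i) \<omega> - Tr j i (u j) \<omega>)) = (\<Sum>q\<in>K. \<psi> q (L q u))"
      unfolding K_eq using finite_J by (subst sum.Sigma) (simp_all add: pair_defs fun_diff_def split_def)
    also have "\<dots> = SC.coupling u" by (rule SC.coupling_def[symmetric])
    finally have "(\<Sum>i=1..m. \<Sum>j\<in>J i. \<phi> i j (\<lambda>\<omega>. Tr i j (u i) \<omega> - Tr j i (u j) \<omega>)) = SC.coupling u" .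
    then show ?thesis unfolding objective F_def by simp
  qed
  have solution_eq: "solution u \<longleftrightarrow> FB.minimizer u" for u
    unfolding solution FB.minimizer_def objective_eq by (auto simp: HF.product_space_def)

  have zH: "z i n \<in> \<H> i" if "i \<in> ?I" for i n
    using z[OF that] by (simp add: dirichlet_neumann_weak_solution_def \<H>[OF that])
  have yH: "y i n \<in> \<H> i" if "i \<in> ?I" for i n
    using y[OF that] by (simp add: is_arg_min_def)
  have H1: "u \<in> H1 (\<Omega>s i)" if "i \<in> ?I" "u \<in> \<H> i" for i u
    using that by (simp add: \<H> H1_vanishing_on_def)
  have next_iterate: "(1 - \<mu>s i n) *\<^sub>R (y i n + a i n) + \<mu>s i n *\<^sub>R x i n \<in> \<H> i \<Longrightarrow>
      x i (Suc n) \<in> \<H> i \<and> norm_of (ip i) (x i (Suc n) - ((1 - \<mu>s i n) *\<^sub>R (y i n + a i n) + \<mu>s i n *\<^sub>R x i n)) = 0"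
    if i: "i \<in> ?I" for i n
  proof -
    let ?w = "(1 - \<mu>s i n) *\<^sub>R (y i n + a i n) + \<mu>s i n *\<^sub>R x i n"
    assume w: "?w \<in> \<H> i"
    have ae: "AE \<omega> in lebesgue_on (\<Omega>s i). x i (Suc n) \<omega> = ?w \<omega>"
      using x_Suc[OF i, of n] by eventually_elim (simp add: algebra_simps)
    have wV: "?w \<in> H1_vanishing_on (\<Omega>s i) (T i) (\<Upsilon> i i)" using w unfolding \<H>[OF i] .
    show "x i (Suc n) \<in> \<H> i \<and> norm_of (ip i) (x i (Suc n) - ?w) = 0"
      unfolding \<H>[OF i] ip[OF i]
      using trace_space.V_cong_AE[where x = ?w and w = "x i (Suc n)", OF trace[OF i] wV ae] by blast
  qed
  have xH: "x i n \<in> \<H> i" if i: "i \<in> ?I" for i n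
  proof (induction n)
    case 0
    show ?case by (rule x_0[OF i])
  next
    case (Suc n)
    interpret Hi: semi_inner_space "\<H> i" "ip i" using i by (intro HF.component_inner)
    show ?case using next_iterate[OF i] Suc yH[OF i] a[OF i] by simp
  qed
  define X Y Z B where "X n i = x i n" and "Y n i = y i n" and "Z n i = z i n" and "B n i = b i n" for n i
  have mem: "X n \<in> ?V" "Y n \<in> ?V" "Z n \<in> ?V" "B n \<in> ?V" for n
    using xH yH zH b by (auto simp: HF.product_space_def X_def Y_def Z_def B_def)

  \<comment> \<open>the weak form of the boundary value problems: \<open>Z n\<close> represents the derivative of the coupling at \<open>X n\<close>\<close>
  have z_represents: "SC.coupling_derivative (X n) h = ?ip (Z n) h" if h: "h \<in> ?V" for n h
  proof -
    define g where "g q = gradient (W q) (ipW q) (\<psi> q) (L q (X n))" for q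
    have gW: "g q \<in> W q" if "q \<in> K" for q
      unfolding g_def using SC.coupling_term(1)[OF that mem(1) mem(1)] .
    have swap: "g (j, i) \<in> G i j" if "i \<in> ?I" "j \<in> J i" for i j
      using gW[of "(j, i)"] JI[OF that] J_sym[OF that] G_swap[OF that] by (simp add: K_eq W_def)
    have gG: "g (i, j) \<in> G i j" if "i \<in> ?I" "j \<in> J i" for i j
      using gW[of "(i, j)"] that by (simp add: K_eq W_def)
    have v_eq: "v i j n \<omega> = (if \<omega> \<in> \<Upsilon> i j then (g (i, j) - g (j, i)) \<omega> else 0)" if "i \<in> ?I" "j \<in> J i" for i j \<omega>
      unfolding v[OF that] by (simp add: g_def pair_defs X_def fun_diff_def)
    have v_L2: "v i j n \<in> L2 (surface_on (\<Upsilon> i j))" if ij: "i \<in> ?I" "j \<in> J i" for i j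
    proof -
      interpret L: semi_inner_space "G i j" "ipG i j" by (rule semi_G[OF ij])
      have "g (i, j) - g (j, i) \<in> L2 (surface_on (\<Upsilon> i j))"
        using gG[OF ij] swap[OF ij] L.diff_mem by (simp add: G[OF ij])
      then show ?thesis
        by (subst L2_cong[where v = "g (i, j) - g (j, i)"]) (auto simp: v_eq[OF ij] space_restrict_space)
    qed
    have v_term: "L2_inner (surface_on (\<Upsilon> i j)) (v i j n) (T i (h i)) = ipG i j (g (i, j)) (Tr i j (h i)) - ipG i j (g (j, i)) (Tr i j (h i))"
      if ij: "i \<in> ?I" "j \<in> J i" for i j
    proof -
      interpret L: semi_inner_space "G i j" "ipG i j" by (rule semi_G[OF ij])
      have "L2_inner (surface_on (\<Upsilon> i j)) (v i j n) (T i (h i)) = ipG i j (g (i, j) - g (j, i)) (Tr i j (h i))"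
        unfolding ipG[OF ij] L2_inner_def
        by (intro Bochner_Integration.integral_cong) (simp_all add: v_eq[OF ij] Tr[OF ij] space_restrict_space)
      then show ?thesis using gG[OF ij] swap[OF ij] Tr_L2[OF ij HF.product_spaceD[OF h ij(1)]] by (simp add: L.diff_left)
    qed
    have "?ip (Z n) h = (\<Sum>i\<in>?I. grad_inner (\<Omega>s i) (h i) (z i n))"
      unfolding HF.product_inner_def by (intro sum.cong refl) (simp add: ip Z_def grad_inner_def inner_commute)
    also have "\<dots> = (\<Sum>i\<in>?I. \<Sum>j\<in>J i. L2_inner (surface_on (\<Upsilon> i j)) (v i j n) (T i (h i)))"
    proof (intro sum.cong refl)
      fix i assume i: "i \<in> ?I"
      have hV: "h i \<in> H1_vanishing_on (\<Omega>s i) (T i) (\<Upsilon> i i)" using HF.product_spaceD[OF h i] by (simp add: \<H>[OF i])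
      have "grad_inner (\<Omega>s i) (h i) (z i n) = (\<integral>\<omega>. T i (h i) \<omega> * (\<Sum>j\<in>J i. v i j n \<omega>) \<partial>(surface_on (\<Union>j\<in>J i. \<Upsilon> i j)))"
        using z[OF i, of n] hV by (simp add: dirichlet_neumann_weak_solution_def)
      also have "\<dots> = (\<Sum>j\<in>J i. L2_inner (surface_on (\<Upsilon> i j)) (v i j n) (T i (h i)))"
        by (rule trace_space.neumann_functional[OF trace[OF i] finite_J[OF i] interface(1)[OF i] interface(2)[OF i] v_L2[OF i] _ hV])
          (simp_all add: v_eq[OF i])
      finally show "grad_inner (\<Omega>s i) (h i) (z i n) = (\<Sum>j\<in>J i. L2_inner (surface_on (\<Upsilon> i j)) (v i j n) (T i (h i)))" .
    qed
    also have "\<dots> = (\<Sum>(i, j)\<in>K. ipG i j (g (i, j)) (Tr i j (h i)) - ipG i j (g (j, i)) (Tr i j (h i)))"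
      unfolding K_eq using finite_J by (subst sum.Sigma) (auto simp: v_term intro!: sum.cong)
    also have "\<dots> = (\<Sum>(i, j)\<in>K. ipG i j (g (i, j)) (Tr i j (h i))) - (\<Sum>(i, j)\<in>K. ipG i j (g (j, i)) (Tr i j (h i)))"
      by (simp add: split_def sum_subtractf)
    \<comment> \<open>exchange of \<open>i\<close> and \<open>j\<close>\<close>
    also have "(\<Sum>(i, j)\<in>K. ipG i j (g (j, i)) (Tr i j (h i))) = (\<Sum>(i, j)\<in>K. ipG j i (g (i, j)) (Tr j i (h j)))"
      by (rule sum.reindex_bij_witness[where i = prod.swap and j = prod.swap]) (auto intro: K_swap)
    also have "(\<Sum>(i, j)\<in>K. ipG i j (g (i, j)) (Tr i j (h i))) - (\<Sum>(i, j)\<in>K. ipG j i (g (i, j)) (Tr j i (h j)))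
      = (\<Sum>q\<in>K. ipW q (g q) (L q h))"
      using L_inner[OF _ h gW] by (simp add: split_def sum_subtractf)
    also have "\<dots> = SC.coupling_derivative (X n) h" by (simp add: SC.coupling_derivative_def g_def)
    finally show ?thesis ..
  qed

  have prox: "ereal (\<gamma> n) * F (Y n) + ereal (1/2 * (norm_of ?ip (Y n - (X n - \<gamma> n *\<^sub>R (Z n + B n))))\<^sup>2)
      \<le> ereal (\<gamma> n) * F u + ereal (1/2 * (norm_of ?ip (u - (X n - \<gamma> n *\<^sub>R (Z n + B n))))\<^sup>2)" if u: "u \<in> ?V" for n u
    unfolding F_def
  proof (rule HF.separable_prox[OF \<Gamma>(1)])
    show "0 < \<gamma> n" using \<gamma>[of n] \<epsilon> by auto
    show "X n - \<gamma> n *\<^sub>R (Z n + B n) \<in> ?V" "Y n \<in> ?V" "u \<in> ?V" using mem u by auto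
    fix i w assume i: "i \<in> ?I" and w: "w \<in> \<H> i"
    interpret Hi: semi_inner_space "\<H> i" "ip i" using i by (intro HF.component_inner)
    have dist: "(\<integral>\<omega>. (norm (weak_grad (\<Omega>s i) u \<omega> - weak_grad (\<Omega>s i) (x i n) \<omega> +
            \<gamma> n *\<^sub>R weak_grad (\<Omega>s i) (\<lambda>\<omega>. z i n \<omega> + b i n \<omega>) \<omega>))\<^sup>2 \<partial>(lebesgue_on (\<Omega>s i)))
        = (norm_of (ip i) (u - (X n - \<gamma> n *\<^sub>R (Z n + B n)) i))\<^sup>2" if "u \<in> \<H> i" for u
      using grad_inner_distance[OF open_\<Omega>s[OF i] H1[OF i that] H1[OF i xH[OF i, of n]] H1[OF i Hi.add_mem[OF zH[OF i, of n] b[OF i, of n]]], of "\<gamma> n"]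
      by (simp add: ip[OF i] X_def Z_def B_def plus_fun_def)
    define g where "g u = ereal (\<gamma> n) * f i u + ereal (1 / 2 * (\<integral>\<omega>. (norm (weak_grad (\<Omega>s i) u \<omega> - weak_grad (\<Omega>s i) (x i n) \<omega> +
            \<gamma> n *\<^sub>R weak_grad (\<Omega>s i) (\<lambda>\<omega>. z i n \<omega> + b i n \<omega>) \<omega>))\<^sup>2 \<partial>(lebesgue_on (\<Omega>s i))))" for u
    have g: "g u = ereal (\<gamma> n) * f i u + ereal (1/2 * (norm_of (ip i) (u - (X n - \<gamma> n *\<^sub>R (Z n + B n)) i))\<^sup>2)" if "u \<in> \<H> i" for u
      unfolding g_def dist[OF that] ..
    have "is_arg_min g (\<lambda>u. u \<in> \<H> i) (y i n)" unfolding g_def by (rule y[OF i])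
    then have "g (y i n) \<le> g w" using w by (auto simp: is_arg_min_def not_less)
    then show "ereal (\<gamma> n) * f i (Y n i) + ereal (1/2 * (norm_of (ip i) (Y n i - (X n - \<gamma> n *\<^sub>R (Z n + B n)) i))\<^sup>2)
        \<le> ereal (\<gamma> n) * f i w + ereal (1/2 * (norm_of (ip i) (w - (X n - \<gamma> n *\<^sub>R (Z n + B n)) i))\<^sup>2)"
      unfolding g[OF w] g[OF yH[OF i]] Y_def .
  qed

  \<comment> \<open>the componentwise relaxation parameters cost an error proportional to the distance from \<open>X n\<close> to \<open>Y n\<close>\<close>
  define \<delta> where "\<delta> n = (\<Sum>i\<in>?I. \<bar>\<mu>s i n - \<mu> n\<bar>)" for n
  define \<eta> where "\<eta> n = (\<Sum>i\<in>?I. norm_of (ip i) (a i n))" for n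
  have relax: "norm_of ?ip (X (Suc n) - (\<mu> n *\<^sub>R X n + (1 - \<mu> n) *\<^sub>R Y n)) \<le> \<delta> n * norm_of ?ip (X n - Y n) + \<eta> n" for n
  proof -
    let ?R = "X (Suc n) - (\<mu> n *\<^sub>R X n + (1 - \<mu> n) *\<^sub>R Y n)"
    have "norm_of ?ip ?R \<le> (\<Sum>i\<in>?I. norm_of (ip i) (?R i))" using mem by (intro HF.product_norm_le) auto
    also have "\<dots> \<le> (\<Sum>i\<in>?I. \<bar>\<mu>s i n - \<mu> n\<bar> * norm_of ?ip (X n - Y n) + norm_of (ip i) (a i n))"
    proof (rule sum_mono)
      fix i assume i: "i \<in> ?I"
      interpret Hi: semi_inner_space "\<H> i" "ip i" using i by (intro HF.component_inner)
      let ?w = "(1 - \<mu>s i n) *\<^sub>R (y i n + a i n) + \<mu>s i n *\<^sub>R x i n"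
      have w: "?w \<in> \<H> i" using xH[OF i] yH[OF i] a[OF i] by simp
      let ?e = "(\<mu>s i n - \<mu> n) *\<^sub>R (x i n - y i n)" and ?a = "(1 - \<mu>s i n) *\<^sub>R a i n"
      have "?R i = (x i (Suc n) - ?w) + (?e + ?a)" by (simp add: X_def Y_def algebra_simps)
      then have "Hi.nrm (?R i) \<le> Hi.nrm (x i (Suc n) - ?w) + Hi.nrm (?e + ?a)"
        using Hi.nrm_triangle[of "x i (Suc n) - ?w" "?e + ?a"] w xH[OF i] yH[OF i] a[OF i] by simp
      moreover have "Hi.nrm (x i (Suc n) - ?w) = 0" using next_iterate[OF i w] by simp
      moreover have "Hi.nrm (?e + ?a) \<le> Hi.nrm ?e + Hi.nrm ?a"
        using xH[OF i] yH[OF i] a[OF i] by (intro Hi.nrm_triangle) simp_all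
      moreover have "Hi.nrm ?e \<le> \<bar>\<mu>s i n - \<mu> n\<bar> * norm_of ?ip (X n - Y n)"
        using HF.component_norm_le[OF HF.P.diff_mem[OF mem(1)[of n] mem(2)[of n]] i] xH[OF i] yH[OF i]
        by (simp add: Hi.nrm_scale X_def Y_def mult_left_mono)
      moreover have "Hi.nrm ?a \<le> Hi.nrm (a i n)"
        using \<mu>s[OF i, of n] a[OF i] by (simp add: Hi.nrm_scale mult_left_le_one_le)
      ultimately show "Hi.nrm (?R i) \<le> \<bar>\<mu>s i n - \<mu> n\<bar> * norm_of ?ip (X n - Y n) + Hi.nrm (a i n)" by linarith
    qed
    also have "\<dots> = \<delta> n * norm_of ?ip (X n - Y n) + \<eta> n" by (simp add: \<delta>_def \<eta>_def sum.distrib sum_distrib_right)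
    finally show ?thesis .
  qed
  have grad_norm: "sqrt (\<integral>\<omega>. (norm (weak_grad (\<Omega>s i) u \<omega>))\<^sup>2 \<partial>(lebesgue_on (\<Omega>s i))) = norm_of (ip i) u" if "i \<in> ?I" for i u
    by (simp add: ip[OF that] norm_of_def grad_inner_def power2_norm_eq_inner)
  have \<delta>_sum: "summable \<delta>" unfolding \<delta>_def using \<mu>s_summable by (intro summable_sum)
  have \<eta>_sum: "summable \<eta>" unfolding \<eta>_def using a_summable by (intro summable_sum) (simp add: grad_norm)
  have \<eta>_nonneg: "0 \<le> \<eta> n" for n
    unfolding \<eta>_def using a by (intro sum_nonneg semi_inner_space.nrm_nonneg[OF HF.component_inner])
  have B_sum: "summable (\<lambda>n. norm_of ?ip (B n))"
  proof (rule summable_comparison_test)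
    show "summable (\<lambda>n. \<Sum>i\<in>?I. norm_of (ip i) (b i n))" using b_summable by (intro summable_sum) (simp add: grad_norm)
    show "\<exists>N. \<forall>n\<ge>N. norm (norm_of ?ip (B n)) \<le> (\<Sum>i\<in>?I. norm_of (ip i) (b i n))"
      using HF.product_norm_le[OF mem(4)] mem(4) by (simp add: B_def)
  qed
  have "\<exists>u. FB.minimizer u \<and> weakly_converges ?V ?ip X u"
  proof (rule FB.forward_backward_weak_convergence[OF mem _ \<gamma> \<mu> z_represents prox relax _ \<delta>_sum \<eta>_nonneg \<eta>_sum B_sum])
    show "0 < \<epsilon>" using \<epsilon> by auto
    show "0 \<le> \<delta> n" for n by (simp add: \<delta>_def sum_nonneg)
    show "\<exists>s. FB.minimizer s" using solvable by (simp add: solution_eq)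
  qed
  then obtain u where u: "FB.minimizer u" "weakly_converges ?V ?ip X u" by blast
  have uV: "u \<in> ?V" using u(1) by (simp add: FB.minimizer_def)
  have "u i \<in> \<H> i \<and> weakly_converges (\<H> i) (ip i) (x i) (u i)" if i: "i \<in> ?I" for i
    using HF.weakly_converges_component[OF mem(1) uV u(2) i] HF.product_spaceD[OF uV i] by (simp add: X_def)
  then show ?thesis using u(1) solution_eq by blast
qed

end
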